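(* Let $d\geq 2$. There exists $C>0$ such that if $H_p$ and $H_q$ are two spherical harmonics on the sphere $\mathbb{S}^d$ of respective degrees $p$ and $q$ greater than $1$, then $$\|H_pH_q\|_{L^2(\mathbb{S}^d)}\leq C\,\Lambda(d,\min(p,q))\,\|H_p\|_{L^2(\mathbb{S}^d)}\|H_q\|_{L^2(\mathbb{S}^d)},$$ where $$\Lambda(d,\nu)=\begin{cases}\nu^{1/4}&\text{if }d=2,\\ \nu^{(d-2)/2}\log^{1/2}(\nu)&\text{if }d=3,\\ \nu^{(d-2)/2}&\text{if }d\geq 4.\end{cases}$$
   Context: $\mathbb{S}^d\subset\mathbb{R}^{d+1}$ is the unit sphere with its standard metric and surface measure. A spherical harmonic of degree $p$ is the restriction to $\mathbb{S}^d$ of a homogeneous harmonic polynomial of degree $p$ on $\mathbb{R}^{d+1}$; equivalently, an eigenfunction of $-\Delta_{\mathbb{S}^d}$ with eigenvalue $p(p+d-1)$. *)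

theory Defs
  imports "HOL-Analysis.Analysis"
begin

definition homogeneous_polynomial :: "nat \<Rightarrow> (real ^ 'n \<Rightarrow> complex) \<Rightarrow> bool" where
  "homogeneous_polynomial p P \<longleftrightarrow>
     (\<exists>c :: ('n \<Rightarrow> nat) \<Rightarrow> complex.
        P = (\<lambda>x. \<Sum>\<alpha> | sum \<alpha> UNIV = p. c \<alpha> * of_real (\<Prod>i\<in>UNIV. (x $ i) ^ \<alpha> i)))"

lemma finite_multiindices: "finite {\<alpha> :: 'n::finite \<Rightarrow> nat. sum \<alpha> UNIV = p}"
proof (rule finite_subset)
  show "{\<alpha> :: 'n \<Rightarrow> nat. sum \<alpha> UNIV = p} \<subseteq> UNIV \<rightarrow>\<^sub>E {..p}"
    by (auto intro: member_le_sum)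
  show "finite ((UNIV :: 'n set) \<rightarrow>\<^sub>E {..p})"
    by (intro finite_PiE) auto
qed

definition partial_deriv :: "'n \<Rightarrow> (real ^ 'n \<Rightarrow> complex) \<Rightarrow> real ^ 'n \<Rightarrow> complex" where
  "partial_deriv i f x = frechet_derivative f (at x) (axis i 1)"

definition laplacian :: "(real ^ 'n \<Rightarrow> complex) \<Rightarrow> real ^ 'n \<Rightarrow> complex" where
  "laplacian f x = (\<Sum>i\<in>UNIV. partial_deriv i (partial_deriv i f) x)"

(* Only the values of H on the unit sphere matter. As usual for a space of spherical
   harmonics, H may be complex-valued, and the zero function is admitted in every degree. *)
definition spherical_harmonic :: "nat \<Rightarrow> (real ^ 'n \<Rightarrow> complex) \<Rightarrow> bool" where
  "spherical_harmonic p H \<longleftrightarrow>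
     (\<exists>P. homogeneous_polynomial p P \<and> (\<forall>x. laplacian P x = 0) \<and>
          (\<forall>x \<in> sphere 0 1. H x = P x))"

(* Surface measure of the unit sphere in dimension n = CARD('n), in the usual polar-coordinates
   form: the measure of A is n times the Lebesgue measure of the cone over A, the factor n
   coming from the integral of n * r^(n-1) over 0 < r < 1.  It is written as an image measure
   under radial projection; emeasure_sphere_measure gives the explicit formula. *)
definition sphere_measure :: "(real ^ 'n) measure" where
  "sphere_measure = scale_measure (of_nat CARD('n))
     (distr (restrict_space lborel (ball 0 1 - {0})) (restrict_space borel (sphere 0 1))
            (\<lambda>x. x /\<^sub>R norm x))"

lemma space_sphere_measure [simp]: "space sphere_measure = sphere 0 1"
  by (simp add: sphere_measure_def space_restrict_space space_scale_measure)

lemma sets_sphere_measure [measurable_cong]: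
  "sets sphere_measure = sets (restrict_space borel (sphere 0 1))"
  by (simp add: sphere_measure_def)

lemma radial_projection_measurable:
  "(\<lambda>x :: real ^ 'n. x /\<^sub>R norm x) \<in>
     restrict_space lborel (ball 0 1 - {0}) \<rightarrow>\<^sub>M restrict_space borel (sphere 0 1)"
proof (rule measurable_restrict_space2)
  show "(\<lambda>x :: real ^ 'n. x /\<^sub>R norm x) \<in> space (restrict_space lborel (ball 0 1 - {0})) \<rightarrow> sphere 0 1"
    by (auto simp: space_restrict_space)
  show "(\<lambda>x :: real ^ 'n. x /\<^sub>R norm x) \<in> borel_measurable (restrict_space lborel (ball 0 1 - {0}))"
    by (rule measurable_restrict_space1) measurable
qed

lemma emeasure_sphere_measure:
  fixes A :: "(real ^ 'n) set"
  assumes "A \<in> sets borel" and "A \<subseteq> sphere 0 1"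
  shows "emeasure sphere_measure A =
           of_nat CARD('n) * emeasure lborel {r *\<^sub>R x |r x. 0 < r \<and> r < 1 \<and> x \<in> A}"
proof -
  have *: "A \<in> sets (restrict_space borel (sphere 0 1))"
    using assms by (auto simp: sets_restrict_space image_iff)
  have eq: "(\<lambda>x. x /\<^sub>R norm x) -` A \<inter> (ball 0 1 - {0}) = {r *\<^sub>R x |r x. 0 < r \<and> r < 1 \<and> x \<in> A}"
    (is "?L = ?R")
  proof (intro set_eqI iffI)
    fix y assume "y \<in> ?L"
    then show "y \<in> ?R"
      by (intro CollectI exI[of _ "norm y"] exI[of _ "y /\<^sub>R norm y"]) auto
  next
    fix y assume "y \<in> ?R"
    then obtain r x where "y = r *\<^sub>R x" "0 < r" "r < 1" "x \<in> A" by auto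
    moreover from this have "norm x = 1" using assms(2) by auto
    ultimately show "y \<in> ?L" by auto
  qed
  have "?R \<subseteq> ball 0 1 - {0}"
    by (simp flip: eq)
  then have "emeasure (restrict_space lborel (ball 0 1 - {0})) ?R = emeasure lborel ?R"
    by (intro emeasure_restrict_space) auto
  then show ?thesis
    unfolding sphere_measure_def
    by (simp add: emeasure_distr[OF radial_projection_measurable *] space_restrict_space eq)
qed

definition L2_norm :: "'a measure \<Rightarrow> ('a \<Rightarrow> complex) \<Rightarrow> real" where
  "L2_norm M f = sqrt (LINT x|M. (cmod (f x))\<^sup>2)"

(* Meaningful for d >= 2 only. *)
definition Lambda :: "nat \<Rightarrow> nat \<Rightarrow> real" where
  "Lambda d \<nu> =
     (if d = 2 then real \<nu> powr (1 / 4)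
      else if d = 3 then real \<nu> powr ((real d - 2) / 2) * ln (real \<nu>) powr (1 / 2)
      else real \<nu> powr ((real d - 2) / 2))"

end

theory Submission
  imports Defs
begin

text \<open>
  Let \<open>p \<le> q\<close> and \<open>\<mu> = |H\<^sub>q|\<^sup>2 d\<sigma>\<close>.  By the \<open>T T\<^sup>*\<close> argument, the norm of the restriction of harmonics
  of degree \<open>p\<close> to \<open>L\<^sup>2(\<mu>)\<close> is controlled through Schur's test by \<open>sup\<^sub>x \<integral> |Z\<^sub>p(x \<bullet> y)| d\<mu>(y)\<close>, where
  \<open>Z\<^sub>p\<close> is the reproducing (zonal) kernel.  Two facts bound this integral.

  First, a spherical harmonic of degree \<open>q\<close> has at most the proportion \<open>C r\<close> of its mass in the polar
  caps of radius \<open>r\<close> around \<open>e\<close> and \<open>-e\<close>, as long as \<open>r \<ge> 1/q\<close>.  This is a virial (Pohozaev) identity with the multiplier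
  \<open>\<Phi> = sqrt (\<epsilon>\<^sup>2 + sin\<^sup>2 \<theta>)\<close>, \<open>\<epsilon>\<close> comparable to \<open>r\<close>: its Hessian is of size \<open>1/\<epsilon>\<close> in the caps and
  bounded below elsewhere.

  Second, \<open>|Z\<^sub>p| \<le> C p\<^bsup>d-1\<^esup> min (1, (p sin \<theta>)\<^bsup>-(d-1)/2\<^esup>)\<close>, by a Gronwall argument for an energy of the
  Gegenbauer equation; the value at the pole, which equals \<open>\<parallel>Z\<^sub>p\<parallel>\<^sup>2\<close>, is itself bounded by applying the cap
  estimate to \<open>Z\<^sub>p\<close>.

  Summing over the dyadic caps of radius \<open>2\<^sup>j / p\<close> gives \<open>p\<^bsup>d-2\<^esup> \<Sum>\<^sub>j 2\<^bsup>j(3-d)/2\<^esup>\<close>, and the three regimes of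
  this geometric sum are the three cases of \<open>\<Lambda>(d, p)\<^sup>2\<close>.
\<close>

section \<open>The surface measure\<close>

text \<open>All calculus takes place in the ambient space. A harmonic is replaced by its homogeneous
  polynomial, Euler's identity supplies the radial derivative, and the only source of integration by
  parts is the rotation invariance of the surface measure, inherited from Lebesgue measure. No
  spherical gradient or Laplacian is introduced. The kernel is normalised to be monic in
  \<open>x \<bullet> y\<close>, so its reproducing factor is an explicit constant M instead of 1. M
  is never estimated: the pole value is bounded by a multiple of M p^(d-1), Schur's test divides by
  M, and M cancels. Bounding the pole value in this way replaces a count of the dimension of the
  space of harmonics. The radii 2^j / p start at 1/p, the scale on which the kernel is flat near its
  pole. They are admissible in the cap estimate for the function of degree q because q \<ge> p,
  which is why the smaller degree governs the bound.\<close>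

lemma lborel_orthogonal_invariant:
  fixes R :: "'a::euclidean_space \<Rightarrow> 'a"
  assumes R: "orthogonal_transformation R"
  shows "distr lborel borel R = lborel"
proof -
  define \<nu> where "\<nu> = distr lborel borel R"
  have linR: "linear R" and contR: "continuous_on UNIV R"
    using R orthogonal_transformation_linear linear_continuous_on linear_conv_bounded_linear by blast+
  have [measurable]: "R \<in> borel_measurable borel"
    using contR by (rule borel_measurable_continuous_onI)
  have sets_\<nu> [measurable_cong, simp]: "sets \<nu> = sets borel" by (simp add: \<nu>_def)
  obtain R' where R': "R' \<circ> R = id" "R \<circ> R' = id" "orthogonal_transformation R'"
    using orthogonal_transformation_inv[OF R] orthogonal_transformation_bij[OF R]
    by (metis bij_is_inj bij_is_surj inv_o_cancel surj_iff)
  have trans: "(\<integral>\<^sup>+y. f (z + y) \<partial>\<nu>) = (\<integral>\<^sup>+y. f y \<partial>\<nu>)" if [measurable]: "f \<in> borel_measurable borel" for f z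
  proof -
    have "(\<integral>\<^sup>+y. f (z + y) \<partial>\<nu>) = (\<integral>\<^sup>+y. f (z + R y) \<partial>lborel)"
      unfolding \<nu>_def by (subst nn_integral_distr) auto
    also have "\<dots> = (\<integral>\<^sup>+y. f (R (R' z + y)) \<partial>lborel)"
      using R'(2) by (simp add: linear_add[OF linR] fun_eq_iff)
    also have "\<dots> = (\<integral>\<^sup>+y. f (R y) \<partial>distr lborel borel ((+) (R' z)))"
      by (subst nn_integral_distr) auto
    also have "\<dots> = (\<integral>\<^sup>+y. f y \<partial>\<nu>)"
      unfolding \<nu>_def by (subst nn_integral_distr) (auto simp: lborel_distr_plus)
    finally show ?thesis .
  qed
  have pre: "R -` ball 0 r = ball 0 r" for r
    using R by (auto simp: orthogonal_transformation_norm)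
  have \<nu>_ball: "emeasure \<nu> (ball 0 r) = emeasure lborel (ball (0::'a) r)" for r
    unfolding \<nu>_def by (subst emeasure_distr) (auto simp: pre)
  have sf: "sigma_finite_measure \<nu>"
  proof
    show "\<exists>A. countable A \<and> A \<subseteq> sets \<nu> \<and> \<Union> A = space \<nu> \<and> (\<forall>a\<in>A. emeasure \<nu> a \<noteq> \<infinity>)"
    proof (intro exI[of _ "range (\<lambda>k::nat. ball 0 (real k))"] conjI ballI)
      show "\<Union> (range (\<lambda>k::nat. ball (0::'a) (real k))) = space \<nu>"
        by (auto simp: \<nu>_def reals_Archimedean2)
    next
      fix a assume "a \<in> range (\<lambda>k::nat. ball (0::'a) (real k))"
      then show "emeasure \<nu> a \<noteq> \<infinity>"
        using emeasure_bounded_finite[of a] by (auto simp: \<nu>_ball less_top)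
    qed auto
  qed
  interpret \<nu>: sigma_finite_measure \<nu> by (rule sf)
  interpret pair_sigma_finite lborel \<nu> ..
  define B where "B = emeasure lborel (ball (0::'a) 1)"
  have B: "B \<noteq> 0" "B \<noteq> \<infinity>"
    using emeasure_bounded_finite[of "ball (0::'a) 1"]
    by (auto simp: B_def less_top emeasure_ball)
       (metis unit_ball_vol_pos of_nat_0_le_iff less_irrefl)
  have "\<nu> = lborel"
  proof (rule measure_eqI)
    fix A assume "A \<in> sets \<nu>"
    then have [measurable]: "A \<in> sets borel" by simp
    let ?f = "indicator A :: 'a \<Rightarrow> ennreal" and ?g = "indicator (ball 0 1) :: 'a \<Rightarrow> ennreal"
    have [measurable]: "ball (0::'a) 1 \<in> sets borel" by simp
    \<comment> \<open>Uniqueness of translation-invariant measures: the shifts x -> y + x in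
      \<open>lborel\<close> and y -> y - x in \<open>\<nu>\<close> carry the indicator of A from one
      measure to the other, and the factor B is common to both because they agree on balls.\<close>
    have "emeasure lborel A * B = (\<integral>\<^sup>+y. (\<integral>\<^sup>+x. ?f x * ?g y \<partial>lborel) \<partial>\<nu>)"
      by (simp add: nn_integral_multc nn_integral_cmult \<nu>_ball B_def)
    also have "\<dots> = (\<integral>\<^sup>+y. (\<integral>\<^sup>+x. ?f (y + x) * ?g y \<partial>lborel) \<partial>\<nu>)"
    proof (rule nn_integral_cong)
      fix y :: 'a
      have "(\<integral>\<^sup>+x. ?f x * ?g y \<partial>lborel) = (\<integral>\<^sup>+x. ?f x * ?g y \<partial>distr lborel borel ((+) y))"
        by (simp add: lborel_distr_plus)
      then show "(\<integral>\<^sup>+x. ?f x * ?g y \<partial>lborel) = (\<integral>\<^sup>+x. ?f (y + x) * ?g y \<partial>lborel)"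
        by (subst (asm) nn_integral_distr) auto
    qed
    also have "\<dots> = (\<integral>\<^sup>+x. (\<integral>\<^sup>+y. ?f (y + x) * ?g y \<partial>\<nu>) \<partial>lborel)"
      by (rule Fubini') measurable
    also have "\<dots> = (\<integral>\<^sup>+x. (\<integral>\<^sup>+y. ?f y * ?g (y - x) \<partial>\<nu>) \<partial>lborel)"
    proof (rule nn_integral_cong)
      fix x :: 'a
      show "(\<integral>\<^sup>+y. ?f (y + x) * ?g y \<partial>\<nu>) = (\<integral>\<^sup>+y. ?f y * ?g (y - x) \<partial>\<nu>)"
        using trans[of "\<lambda>y. ?f y * ?g (y - x)" x] by (simp add: add.commute)
    qed
    also have "\<dots> = (\<integral>\<^sup>+y. (\<integral>\<^sup>+x. ?f y * ?g (y - x) \<partial>lborel) \<partial>\<nu>)"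
      by (rule Fubini'[symmetric]) measurable
    also have "\<dots> = (\<integral>\<^sup>+y. ?f y * B \<partial>\<nu>)"
    proof (rule nn_integral_cong)
      fix y :: 'a
      have "(\<integral>\<^sup>+x. ?f y * ?g (y - x) \<partial>lborel) = ?f y * (\<integral>\<^sup>+x. ?g (y - x) \<partial>lborel)"
        by (rule nn_integral_cmult) measurable
      also have "(\<integral>\<^sup>+x. ?g (y - x) \<partial>lborel) = (\<integral>\<^sup>+x. indicator (ball y 1) x \<partial>lborel)"
        by (intro nn_integral_cong) (auto simp: indicator_def dist_norm norm_minus_commute)
      also have "\<dots> = B" by (simp add: B_def emeasure_ball)
      finally show "(\<integral>\<^sup>+x. ?f y * ?g (y - x) \<partial>lborel) = ?f y * B" .
    qed
    also have "\<dots> = emeasure \<nu> A * B" by (simp add: nn_integral_multc)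
    finally show "emeasure \<nu> A = emeasure lborel A"
      using B by (metis ennreal_mult_cancel_left ennreal_mult_le_mult_iff infinity_ennreal_def mult.commute)
  qed simp
  then show ?thesis by (simp add: \<nu>_def)
qed

lemma finite_measure_sphere_measure: "finite_measure (sphere_measure :: (real ^ 'n) measure)"
proof
  have "emeasure (sphere_measure :: (real ^ 'n) measure) (sphere 0 1)
      \<le> of_nat CARD('n) * emeasure lborel (ball (0 :: real ^ 'n) 1)"
    by (subst emeasure_sphere_measure) (auto intro!: mult_left_mono emeasure_mono)
  also have "\<dots> < \<infinity>"
    using emeasure_bounded_finite[of "ball (0 :: real ^ 'n) 1"]
    by (simp add: ennreal_mult_less_top of_nat_less_top)
  finally show "emeasure (sphere_measure :: (real ^ 'n) measure) (space sphere_measure) \<noteq> \<infinity>"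
    by simp
qed

interpretation sphere: finite_measure "sphere_measure :: (real ^ 'n) measure"
  by (rule finite_measure_sphere_measure)

lemma measurable_sphere:
  fixes f :: "real ^ 'n \<Rightarrow> 'b::topological_space"
  assumes "continuous_on (sphere 0 1) f"
  shows "f \<in> borel_measurable sphere_measure"
  using borel_measurable_continuous_on_restrict[OF assms]
  by (simp cong: measurable_cong_sets add: sets_sphere_measure)

lemma integrable_sphere:
  fixes f :: "real ^ 'n \<Rightarrow> real"
  assumes "continuous_on (sphere 0 1) f"
  shows "integrable sphere_measure f"
proof -
  have "compact (f ` sphere 0 1)"
    by (intro compact_continuous_image assms) auto
  then obtain B where "\<And>x. x \<in> sphere 0 1 \<Longrightarrow> \<bar>f x\<bar> \<le> B"
    using compact_imp_bounded[of "f ` sphere 0 1"] unfolding bounded_iff by (metis imageI real_norm_def)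
  then show ?thesis
    by (intro sphere.integrable_const_bound[where B = B] measurable_sphere assms)
       (auto intro!: AE_I2)
qed

lemma integral_sphere_measure:
  fixes f :: "real ^ 'n \<Rightarrow> real"
  assumes "f \<in> borel_measurable sphere_measure"
  shows "(LINT y|sphere_measure. f y) =
    CARD('n) * (LINT x|restrict_space lborel (ball 0 1 - {0}). f (x /\<^sub>R norm x))"
proof -
  let ?M = "distr (restrict_space lborel (ball 0 1 - {0})) (restrict_space borel (sphere (0::real^'n) 1)) (\<lambda>x. x /\<^sub>R norm x)"
  have f: "f \<in> borel_measurable (restrict_space borel (sphere 0 1))"
    using assms by (simp cong: measurable_cong_sets add: sets_sphere_measure)
  have "(sphere_measure :: (real^'n) measure) = density ?M (\<lambda>_. of_nat CARD('n))"
    unfolding sphere_measure_def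
    by (intro measure_eqI) (auto simp: emeasure_density nn_integral_cmult)
  then have "(LINT y|sphere_measure. f y) = (LINT y|density ?M (\<lambda>_. ennreal CARD('n)). f y)"
    by (simp add: ennreal_of_nat_eq_real_of_nat)
  also have "\<dots> = (LINT y|?M. CARD('n) *\<^sub>R f y)"
    using f by (intro integral_density) auto
  also have "\<dots> = CARD('n) * (LINT y|?M. f y)" by simp
  also have "(LINT y|?M. f y) = (LINT x|restrict_space lborel (ball 0 1 - {0}). f (x /\<^sub>R norm x))"
    by (intro integral_distr radial_projection_measurable f)
  finally show ?thesis .
qed

lemma integral_sphere_orthogonal:
  fixes f :: "real ^ 'n \<Rightarrow> real" and R :: "real ^ 'n \<Rightarrow> real ^ 'n"
  assumes R: "orthogonal_transformation R" and f: "continuous_on (sphere 0 1) f"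
  shows "(LINT y|sphere_measure. f (R y)) = (LINT y|sphere_measure. f y)"
proof -
  have linR: "linear R" and contR: "continuous_on UNIV R"
    using R orthogonal_transformation_linear linear_continuous_on linear_conv_bounded_linear by blast+
  have [measurable]: "R \<in> borel_measurable borel"
    using contR by (rule borel_measurable_continuous_onI)
  have nR [simp]: "norm (R x) = norm x" for x
    using R by (simp add: orthogonal_transformation_norm)
  have fR0 [simp]: "R x = 0 \<longleftrightarrow> x = 0" for x
    by (metis nR norm_eq_zero)
  have fR: "continuous_on (sphere 0 1) (\<lambda>y. f (R y))"
    by (intro continuous_on_compose2[OF f] continuous_on_subset[OF contR]) auto
  let ?D = "ball 0 1 - {0} :: (real ^ 'n) set"
  let ?h = "\<lambda>x. indicator ?D x *\<^sub>R f (x /\<^sub>R norm x)"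
  have sg: "sgn ` ?D \<subseteq> sphere 0 1"
    by (auto simp: norm_sgn split: if_splits)
  have "continuous_on ?D (\<lambda>x. f (sgn x))"
    using sg by (intro continuous_on_compose2[OF f, of ?D sgn])
      (auto simp: sgn_div_norm[abs_def] intro!: continuous_intros)
  then have "(\<lambda>x. f (x /\<^sub>R norm x)) \<in> borel_measurable (restrict_space borel ?D)"
    by (intro borel_measurable_continuous_on_restrict) (simp add: sgn_div_norm)
  then have h [measurable]: "?h \<in> borel_measurable borel"
    by (subst (asm) borel_measurable_restrict_space_iff) (auto simp: mult.commute)
  have "(LINT y|sphere_measure. f (R y)) = CARD('n) * (LINT x|lborel. ?h (R x))"
    by (subst integral_sphere_measure[OF measurable_sphere[OF fR]], subst integral_restrict_space)
       (auto intro!: Bochner_Integration.integral_cong simp: linear_cmul[OF linR] split: split_indicator)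
  also have "(LINT x|lborel. ?h (R x)) = (LINT x|distr lborel borel R. ?h x)"
    by (rule integral_distr[symmetric]) measurable
  also have "CARD('n) * \<dots> = (LINT y|sphere_measure. f y)"
    unfolding lborel_orthogonal_invariant[OF R]
    by (subst integral_sphere_measure[OF measurable_sphere[OF f]], subst integral_restrict_space) auto
  finally show ?thesis .
qed

section \<open>Integration by parts on the sphere\<close>

text \<open>With R s the rotation by the angle s in the plane of a and b, the integral of F (R s y)
  does not depend on s; its derivative at s = 0 is the integral on the left.\<close>

lemma integral_sphere_rotation_generator:
  fixes F :: "real ^ 'n \<Rightarrow> real" and a b :: "real ^ 'n"
  assumes ab: "norm a = 1" "norm b = 1" "a \<bullet> b = 0"
    and F: "\<And>y. y \<in> sphere 0 1 \<Longrightarrow> (F has_derivative (\<lambda>h. g y \<bullet> h)) (at y)"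
    and g: "continuous_on (sphere 0 1) g"
  shows "(LINT y|sphere_measure. g y \<bullet> ((y \<bullet> a) *\<^sub>R b - (y \<bullet> b) *\<^sub>R a)) = 0"
proof -
  define R where "R s y = y + (cos s - 1) *\<^sub>R ((y \<bullet> a) *\<^sub>R a + (y \<bullet> b) *\<^sub>R b)
     + sin s *\<^sub>R ((y \<bullet> a) *\<^sub>R b - (y \<bullet> b) *\<^sub>R a)" for s and y :: "real ^ 'n"
  define L where "L y = (y \<bullet> a) *\<^sub>R b - (y \<bullet> b) *\<^sub>R a" for y :: "real ^ 'n"
  have ab': "a \<bullet> a = 1" "b \<bullet> b = 1" "b \<bullet> a = 0"
    using ab by (auto simp: norm_eq_1 inner_commute)
  have linR: "linear (R s)" for s
    unfolding R_def by (intro linearI) (auto simp: algebra_simps inner_add_left)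
  have "R s y \<bullet> R s y = y \<bullet> y" for s y
  proof -
    have sq: "(y + p *\<^sub>R a + r *\<^sub>R b) \<bullet> (y + p *\<^sub>R a + r *\<^sub>R b)
        = y \<bullet> y + p\<^sup>2 + r\<^sup>2 + 2 * p * (y \<bullet> a) + 2 * r * (y \<bullet> b)" for p r
      using ab ab' inner_commute[of a y] inner_commute[of b y]
      by (simp add: inner_add_left inner_add_right power2_eq_square algebra_simps)
    have Ry: "R s y = y + ((cos s - 1) * (y \<bullet> a) - sin s * (y \<bullet> b)) *\<^sub>R a
        + ((cos s - 1) * (y \<bullet> b) + sin s * (y \<bullet> a)) *\<^sub>R b"
      unfolding R_def by (simp add: scaleR_add_left scaleR_diff_left scaleR_add_right scaleR_diff_right)
    have e: "R s y \<bullet> R s y = y \<bullet> y + ((y \<bullet> a)\<^sup>2 + (y \<bullet> b)\<^sup>2) * (2 * (cos s - 1) + (cos s - 1)\<^sup>2 + (sin s)\<^sup>2)"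
      unfolding Ry sq by (simp only: power2_eq_square) algebra
    have "2 * (cos s - 1) + (cos s - 1)\<^sup>2 + (sin s)\<^sup>2 = 0"
      using sin_cos_squared_add[of s] by (simp add: power2_eq_square algebra_simps)
    with e show ?thesis by simp
  qed
  then have nR: "norm (R s y) = norm y" for s y
    by (simp add: norm_eq_sqrt_inner)
  have oR: "orthogonal_transformation (R s)" for s
    by (simp add: orthogonal_transformation linR nR)
  have dR: "((\<lambda>s. R s y) has_vector_derivative L (R s y)) (at s)" for s y
  proof -
    have *: "R s y \<bullet> a = cos s * (y \<bullet> a) - sin s * (y \<bullet> b)" "R s y \<bullet> b = cos s * (y \<bullet> b) + sin s * (y \<bullet> a)"
      using ab ab' by (simp_all add: R_def inner_simps algebra_simps)
    show ?thesis
      unfolding L_def *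
      unfolding R_def
      by (auto intro!: derivative_eq_intros simp: has_vector_derivative_def algebra_simps fun_eq_iff)
  qed
  have dFR: "((\<lambda>s. F (R s y)) has_real_derivative g (R s y) \<bullet> L (R s y)) (at s)" if "y \<in> sphere 0 1" for s y
  proof -
    have "((\<lambda>s. F (R s y)) has_derivative (\<lambda>h. g (R s y) \<bullet> (h *\<^sub>R L (R s y)))) (at s)"
      using dR[of y s] that unfolding has_vector_derivative_def
      by (intro has_derivative_compose[OF _ F]) (auto simp: nR)
    then show ?thesis
      by (simp add: has_field_derivative_def mult_commute_abs)
  qed
  have contF: "continuous_on (sphere 0 1) F"
    using F has_derivative_continuous by (blast intro: continuous_at_imp_continuous_on)
  have contR: "continuous_on A (R s)" for A s
    using linR linear_continuous_on linear_conv_bounded_linear by blast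
  have contL: "continuous_on (sphere 0 1) (\<lambda>y. g y \<bullet> L y)"
    unfolding L_def by (intro continuous_intros g)
  have contFR: "continuous_on (sphere 0 1) (\<lambda>y. F (R s y))" for s
    by (intro continuous_on_compose2[OF contF contR]) (auto simp: nR)
  have "compact ((\<lambda>y. g y \<bullet> L y) ` sphere 0 1)"
    by (intro compact_continuous_image contL) auto
  then obtain B where B: "\<And>y. y \<in> sphere 0 1 \<Longrightarrow> \<bar>g y \<bullet> L y\<bar> \<le> B"
    using compact_imp_bounded[of "(\<lambda>y. g y \<bullet> L y) ` sphere 0 1"]
    unfolding bounded_iff by (metis imageI real_norm_def)
  \<comment> \<open>Difference quotients at s = 1 / (m + 1). The mean value theorem bounds them by
    B, so that dominated convergence applies, while rotation invariance makes each of their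
    integrals zero.\<close>
  define q where "q m y = (F (R (1 / Suc m) y) - F y) * Suc m" for m y
  have R0 [simp]: "R 0 y = y" for y by (simp add: R_def)
  have "(\<lambda>m. (LINT y|sphere_measure. q m y)) \<longlonglongrightarrow> (LINT y|sphere_measure. g y \<bullet> L y)"
  proof (rule integral_dominated_convergence[where w = "\<lambda>_. B"])
    show "(\<lambda>y. g y \<bullet> L y) \<in> borel_measurable sphere_measure"
      by (intro measurable_sphere contL)
    show "q m \<in> borel_measurable sphere_measure" for m
      unfolding q_def by (intro measurable_sphere continuous_intros contFR contF)
    show "AE y in sphere_measure. (\<lambda>m. q m y) \<longlonglongrightarrow> g y \<bullet> L y"
    proof (rule AE_I2)
      fix y :: "real ^ 'n" assume "y \<in> space sphere_measure"
      then have "((\<lambda>s. F (R s y)) has_real_derivative g y \<bullet> L y) (at 0)"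
        using dFR[of y 0] by simp
      then have "((\<lambda>h. (F (R h y) - F y) / h) \<longlongrightarrow> g y \<bullet> L y) (at 0)"
        by (simp add: DERIV_def)
      moreover have "filterlim (\<lambda>m. 1 / real (Suc m)) (at 0) sequentially"
        using LIMSEQ_inverse_real_of_nat by (auto simp: filterlim_at inverse_eq_divide)
      ultimately have "(\<lambda>m. (F (R (1 / real (Suc m)) y) - F y) / (1 / real (Suc m))) \<longlonglongrightarrow> g y \<bullet> L y"
        by (rule filterlim_compose)
      then show "(\<lambda>m. q m y) \<longlonglongrightarrow> g y \<bullet> L y" by (simp add: q_def)
    qed
    show "AE y in sphere_measure. norm (q m y) \<le> B" for m
    proof (rule AE_I2)
      fix y :: "real ^ 'n" assume y: "y \<in> space sphere_measure"
      obtain z where "0 < z" "z < 1 / Suc m"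
        "F (R (1 / Suc m) y) - F (R 0 y) = (1 / Suc m - 0) * (g (R z y) \<bullet> L (R z y))"
        using MVT2[of 0 "1 / real (Suc m)" "\<lambda>s. F (R s y)" "\<lambda>s. g (R s y) \<bullet> L (R s y)"] dFR[of y] y by auto
      then have "q m y = g (R z y) \<bullet> L (R z y)" by (simp add: q_def)
      then show "norm (q m y) \<le> B" using B[of "R z y"] y by (simp add: nR)
    qed
  qed simp
  moreover have "(LINT y|sphere_measure. q m y) = 0" for m
  proof -
    have "(LINT y|sphere_measure. q m y)
        = ((LINT y|sphere_measure. F (R (1 / Suc m) y)) - (LINT y|sphere_measure. F y)) * Suc m"
      unfolding q_def
      by (subst integral_mult_left_zero, subst Bochner_Integration.integral_diff)
         (auto intro!: integrable_sphere contFR contF)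
    then show ?thesis by (simp add: integral_sphere_orthogonal[OF oR contF])
  qed
  ultimately show ?thesis
    by (simp add: L_def LIMSEQ_const_iff)
qed

text \<open>Summing the rotation generators
  \<open>y\<^sub>j \<partial>\<^sub>i - y\<^sub>i \<partial>\<^sub>j\<close> applied to \<open>y\<^sub>j F\<close> over \<open>j\<close> produces
  the tangential derivative of \<open>F\<close>.\<close>

lemma sphere_divergence:
  fixes F :: "real ^ 'n \<Rightarrow> real" and v :: "real ^ 'n"
  assumes F: "\<And>y. y \<in> sphere 0 1 \<Longrightarrow> (F has_derivative (\<lambda>h. g y \<bullet> h)) (at y)"
    and g: "continuous_on (sphere 0 1) g"
  shows "(LINT y|sphere_measure. v \<bullet> g y - (v \<bullet> y) * (y \<bullet> g y) - (real CARD('n) - 1) * ((v \<bullet> y) * F y)) = 0"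
proof -
  have contF: "continuous_on (sphere 0 1) F"
    using F has_derivative_continuous by (blast intro: continuous_at_imp_continuous_on)
  \<comment> \<open>For i \<noteq> j this is the rotation generator applied to y_j F. The
    conditional makes the diagonal term vanish identically, so that j may range over all indices;
    the factor n - 1 then counts the off-diagonal ones.\<close>
  define T where "T i j y = (y $ j)\<^sup>2 * g y $ i - y $ i * (y $ j * g y $ j) - (if i = j then 0 else y $ i * F y)"
    for i j and y :: "real ^ 'n"
  have Tc: "continuous_on (sphere 0 1) (T i j)" for i j
    unfolding T_def by (cases "i = j") (auto intro!: continuous_intros g contF)
  have T0: "(LINT y|sphere_measure. T i j y) = 0" for i j
  proof (cases "i = j")
    case True
    then show ?thesis by (simp add: T_def power2_eq_square algebra_simps)
  next
    case False
    have axj: "axis j (1::real) $ i = 0" using False by (simp add: axis_def)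
    have "((\<lambda>y. (y $ j) * F y) has_derivative (\<lambda>h. (F y *\<^sub>R axis j 1 + (y $ j) *\<^sub>R g y) \<bullet> h)) (at y)"
      if "y \<in> sphere 0 1" for y
      using F[OF that]
      by (auto intro!: derivative_eq_intros bounded_linear_imp_has_derivative[OF bounded_linear_vec_nth]
           simp: inner_simps inner_axis' algebra_simps)
    then have "(LINT y|sphere_measure. (F y *\<^sub>R axis j 1 + (y $ j) *\<^sub>R g y) \<bullet>
        ((y \<bullet> axis j 1) *\<^sub>R axis i 1 - (y \<bullet> axis i 1) *\<^sub>R axis j 1)) = 0"
      using False
      by (intro integral_sphere_rotation_generator[where F = "\<lambda>y. (y $ j) * F y"])
         (auto simp: inner_axis_axis norm_axis_1 intro!: continuous_intros contF g)
    moreover have "(F y *\<^sub>R axis j 1 + (y $ j) *\<^sub>R g y) \<bullet>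
        ((y \<bullet> axis j 1) *\<^sub>R axis i 1 - (y \<bullet> axis i 1) *\<^sub>R axis j 1) = T i j y" for y
      using False axj by (simp add: T_def inner_simps inner_axis inner_axis' inner_axis_axis power2_eq_square algebra_simps)
    ultimately show ?thesis by simp
  qed
  have sumT: "(\<Sum>i\<in>UNIV. \<Sum>j\<in>UNIV. v $ i * T i j y)
      = v \<bullet> g y - (v \<bullet> y) * (y \<bullet> g y) - (real CARD('n) - 1) * ((v \<bullet> y) * F y)" if "y \<in> sphere 0 1" for y
  proof -
    have yy: "(\<Sum>j\<in>UNIV. (y $ j)\<^sup>2) = 1"
      using that by (simp add: norm_eq_1 inner_vec_def power2_eq_square)
    have "(\<Sum>j\<in>UNIV. T i j y) = g y $ i - y $ i * (y \<bullet> g y) - (real CARD('n) - 1) * (y $ i * F y)" for i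
    proof -
      have "(\<Sum>j\<in>UNIV. if i = j then 0 else y $ i * F y) = (\<Sum>j\<in>UNIV - {i}. y $ i * F y)"
        by (rule sum.mono_neutral_cong_right) auto
      then have "(\<Sum>j\<in>UNIV. if i = j then 0 else y $ i * F y) = (real CARD('n) - 1) * (y $ i * F y)"
        by (simp add: card_Diff_singleton of_nat_diff algebra_simps)
      then show ?thesis
        unfolding T_def sum_subtractf
        by (simp add: sum_distrib_left[symmetric] sum_distrib_right[symmetric] yy inner_vec_def)
    qed
    then have "(\<Sum>i\<in>UNIV. \<Sum>j\<in>UNIV. v $ i * T i j y)
        = (\<Sum>i\<in>UNIV. v $ i * (g y $ i - y $ i * (y \<bullet> g y) - (real CARD('n) - 1) * (y $ i * F y)))"
      by (simp add: sum_distrib_left[symmetric])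
    also have "\<dots> = (\<Sum>i\<in>UNIV. v $ i * g y $ i) - (\<Sum>i\<in>UNIV. v $ i * y $ i) * (y \<bullet> g y)
        - (real CARD('n) - 1) * ((\<Sum>i\<in>UNIV. v $ i * y $ i) * F y)"
      by (simp only: sum_distrib_left sum_distrib_right sum_subtractf[symmetric] right_diff_distrib mult.assoc mult.left_commute)
    finally show ?thesis by (simp add: inner_vec_def[of v])
  qed
  have "(LINT y|sphere_measure. v \<bullet> g y - (v \<bullet> y) * (y \<bullet> g y) - (real CARD('n) - 1) * ((v \<bullet> y) * F y))
      = (LINT y|sphere_measure. (\<Sum>i\<in>UNIV. \<Sum>j\<in>UNIV. v $ i * T i j y))"
    by (intro Bochner_Integration.integral_cong) (auto simp: sumT)
  also have "\<dots> = 0"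
    by (subst Bochner_Integration.integral_sum | subst integral_sum |
        simp add: T0 integrable_sphere[OF Tc] Bochner_Integration.integrable_sum)+
  finally show ?thesis .
qed

section \<open>Solid harmonics\<close>

definition pd :: "'n \<Rightarrow> (real ^ 'n \<Rightarrow> real) \<Rightarrow> real ^ 'n \<Rightarrow> real" where
  "pd i f x = frechet_derivative f (at x) (axis i 1)"

definition grad :: "(real ^ 'n \<Rightarrow> real) \<Rightarrow> real ^ 'n \<Rightarrow> real ^ 'n" where
  "grad f x = (\<chi> i. pd i f x)"

lemma grad_nth [simp]: "grad f x $ i = pd i f x"
  by (simp add: grad_def)

lemma pd_eqI:
  assumes "(f has_derivative (\<lambda>h. g \<bullet> h)) (at x)"
  shows "pd i f x = g $ i"
  using frechet_derivative_at[OF assms] by (simp add: pd_def inner_axis fun_eq_iff flip: fun_eq_iff)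
     (metis inner_axis inner_real_def mult.right_neutral)

lemma has_derivative_grad:
  fixes f :: "real ^ 'n \<Rightarrow> real"
  assumes "real_polynomial_function f"
  shows "(f has_derivative (\<lambda>h. grad f x \<bullet> h)) (at x)"
proof -
  let ?D = "frechet_derivative f (at x)"
  have d: "(f has_derivative ?D) (at x)"
    using assms differentiable_at_real_polynomial_function frechet_derivative_works by blast
  then have l: "linear ?D" by (rule has_derivative_linear)
  have "?D h = grad f x \<bullet> h" for h
  proof -
    have "?D h = ?D (\<Sum>i\<in>UNIV. h $ i *\<^sub>R axis i 1)"
      by (simp add: basis_expansion[of h, folded scalar_mult_eq_scaleR] flip: scalar_mult_eq_scaleR)
    also have "\<dots> = (\<Sum>i\<in>UNIV. h $ i * pd i f x)"
      by (simp add: linear_sum[OF l] linear_cmul[OF l] pd_def)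
    finally show ?thesis by (simp add: inner_vec_def mult.commute)
  qed
  then have "?D = (\<lambda>h. grad f x \<bullet> h)" by auto
  with d show ?thesis by simp
qed

lemma pd_add:
  assumes "real_polynomial_function f" "real_polynomial_function g"
  shows "pd i (\<lambda>x. f x + g x) = (\<lambda>x. pd i f x + pd i g x)"
proof
  fix x
  have "((\<lambda>x. f x + g x) has_derivative (\<lambda>h. (grad f x + grad g x) \<bullet> h)) (at x)"
    using has_derivative_add[OF has_derivative_grad[OF assms(1)] has_derivative_grad[OF assms(2)]]
    by (simp add: inner_add_left)
  then show "pd i (\<lambda>x. f x + g x) x = pd i f x + pd i g x" by (simp add: pd_eqI)
qed

lemma pd_mult:
  assumes "real_polynomial_function f" "real_polynomial_function g"
  shows "pd i (\<lambda>x. f x * g x) = (\<lambda>x. f x * pd i g x + pd i f x * g x)"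
proof
  fix x
  have "((\<lambda>x. f x * g x) has_derivative (\<lambda>h. (f x *\<^sub>R grad g x + g x *\<^sub>R grad f x) \<bullet> h)) (at x)"
    using has_derivative_mult[OF has_derivative_grad[OF assms(1)] has_derivative_grad[OF assms(2)]]
    by (simp add: inner_add_left algebra_simps)
  then show "pd i (\<lambda>x. f x * g x) x = f x * pd i g x + pd i f x * g x"
    by (simp add: pd_eqI)
qed

lemma pd_const [simp]: "pd i (\<lambda>x. c) = (\<lambda>x. 0)"
  by (simp add: pd_def fun_eq_iff)

lemma pd_linear:
  assumes "bounded_linear f"
  shows "pd i f = (\<lambda>x. f (axis i 1))"
  using frechet_derivative_at[OF bounded_linear_imp_has_derivative[OF assms]]
  by (metis pd_def ext)

lemma pd_cmult:
  assumes "real_polynomial_function f"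
  shows "pd i (\<lambda>x. c * f x) = (\<lambda>x. c * pd i f x)"
  using pd_mult[OF real_polynomial_function.intros(2) assms] by simp

lemma pd_sum:
  assumes "finite A" "\<And>a. a \<in> A \<Longrightarrow> real_polynomial_function (f a)"
  shows "pd i (\<lambda>x. \<Sum>a\<in>A. f a x) = (\<lambda>x. \<Sum>a\<in>A. pd i (f a) x)"
  using assms
proof (induction A rule: finite_induct)
  case (insert a A)
  then show ?case
    using pd_add[of "f a" "\<lambda>x. \<Sum>a\<in>A. f a x" i] real_polynomial_function_sum[of A "\<lambda>x a. f a x"]
    by (simp add: fun_eq_iff)
qed simp

lemma real_polynomial_function_pd [intro]:
  fixes f :: "real ^ 'n \<Rightarrow> real"
  assumes "real_polynomial_function f"
  shows "real_polynomial_function (pd i f)"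
  using assms
  by (induction f rule: real_polynomial_function.induct) (auto simp: pd_linear pd_add pd_mult)

lemma pd_commute:
  fixes f :: "real ^ 'n \<Rightarrow> real"
  assumes "real_polynomial_function f"
  shows "pd i (pd j f) = pd j (pd i f)"
  using assms
proof (induction f rule: real_polynomial_function.induct)
  case (add f g)
  then show ?case by (simp add: pd_add real_polynomial_function_pd)
next
  case (mult f g)
  then show ?case
    by (simp add: pd_add pd_mult real_polynomial_function_pd real_polynomial_function.intros fun_eq_iff algebra_simps)
qed (simp_all add: pd_linear)

lemma continuous_on_real_polynomial_function:
  fixes f :: "real ^ 'n \<Rightarrow> real"
  assumes "real_polynomial_function f"
  shows "continuous_on A f"
  using assms continuous_on_polymonial_function[of f A] by (simp add: real_polynomial_function_eq)

lemma continuous_on_grad: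
  assumes "real_polynomial_function f"
  shows "continuous_on A (grad f)"
  unfolding grad_def[abs_def]
  by (intro continuous_intros continuous_on_real_polynomial_function real_polynomial_function_pd assms)

text \<open>Homogeneity is stated through dilations rather than through coefficients: in this form
  it passes to derivatives and to zonal polynomials without expanding them, and positive c are
  enough for Euler's identity.\<close>

definition solid_harmonic :: "nat \<Rightarrow> (real ^ 'n \<Rightarrow> real) \<Rightarrow> bool" where
  "solid_harmonic p f \<longleftrightarrow> real_polynomial_function f \<and> (\<forall>c>0. \<forall>x. f (c *\<^sub>R x) = c ^ p * f x) \<and>
     (\<forall>x. (\<Sum>i\<in>UNIV. pd i (pd i f) x) = 0)"

lemma solid_harmonicD:
  assumes "solid_harmonic p f"
  shows "real_polynomial_function f" "c > 0 \<Longrightarrow> f (c *\<^sub>R x) = c ^ p * f x" "(\<Sum>i\<in>UNIV. pd i (pd i f) x) = 0"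
  using assms by (auto simp: solid_harmonic_def)

text \<open>Euler's identity: two evaluations of the derivative of c -> f (c x) at c = 1.\<close>

lemma inner_grad_homogeneous:
  assumes f: "real_polynomial_function f" and hom: "\<And>c. c > 0 \<Longrightarrow> f (c *\<^sub>R x) = c ^ p * f x"
  shows "x \<bullet> grad f x = p * f x"
proof -
  have "((\<lambda>c. f (c *\<^sub>R x)) has_derivative (\<lambda>h. grad f (1 *\<^sub>R x) \<bullet> (h *\<^sub>R x))) (at (1::real))"
    by (rule has_derivative_compose[OF _ has_derivative_grad[OF f]]) (auto intro!: derivative_eq_intros)
  then have "((\<lambda>c. f (c *\<^sub>R x)) has_real_derivative x \<bullet> grad f x) (at 1)"
    by (simp add: has_field_derivative_def mult_commute_abs inner_commute)
  moreover have "((\<lambda>c. f (c *\<^sub>R x)) has_real_derivative p * f x) (at 1)"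
  proof -
    have "((\<lambda>c::real. c ^ p * f x) has_real_derivative p * f x) (at 1)"
      by (auto intro!: derivative_eq_intros)
    then show ?thesis
      by (rule has_field_derivative_transform_within_open[where S = "{0<..}"]) (auto simp: hom)
  qed
  ultimately show ?thesis by (rule DERIV_unique)
qed

lemma pd_homogeneous:
  assumes f: "real_polynomial_function f" and hom: "\<And>c x. c > 0 \<Longrightarrow> f (c *\<^sub>R x) = c ^ Suc p * f x" and c: "c > 0"
  shows "pd i f (c *\<^sub>R x) = c ^ p * pd i f x"
proof -
  have "((\<lambda>x. f (c *\<^sub>R x)) has_derivative (\<lambda>h. grad f (c *\<^sub>R x) \<bullet> (c *\<^sub>R h))) (at x)"
    by (rule has_derivative_compose[OF _ has_derivative_grad[OF f]]) (auto intro!: derivative_eq_intros)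
  then have "((\<lambda>x. f (c *\<^sub>R x)) has_derivative (\<lambda>h. (c *\<^sub>R grad f (c *\<^sub>R x)) \<bullet> h)) (at x)" by simp
  moreover have "((\<lambda>x. f (c *\<^sub>R x)) has_derivative (\<lambda>h. (c ^ Suc p *\<^sub>R grad f x) \<bullet> h)) (at x)"
    unfolding hom[OF c] by (auto intro!: derivative_eq_intros has_derivative_grad[OF f])
  ultimately have "c * pd i f (c *\<^sub>R x) = c ^ Suc p * pd i f x"
    using pd_eqI by (metis grad_nth real_scaleR_def vector_scaleR_component)
  with c show ?thesis by simp
qed

lemma solid_harmonic_pd:
  assumes "solid_harmonic (Suc p) f"
  shows "solid_harmonic p (pd i f)"
proof -
  note f = solid_harmonicD[OF assms]
  have "(\<Sum>j\<in>UNIV. pd j (pd j (pd i f)) x) = 0" for x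
  proof -
    have "(\<Sum>j\<in>UNIV. pd j (pd j (pd i f)) x) = (\<Sum>j\<in>UNIV. pd i (pd j (pd j f)) x)"
      by (intro sum.cong refl) (metis pd_commute f(1) real_polynomial_function_pd)
    also have "\<dots> = pd i (\<lambda>x. \<Sum>j\<in>UNIV. pd j (pd j f) x) x"
      by (subst pd_sum) (auto intro!: real_polynomial_function_pd f(1))
    finally show ?thesis by (simp add: f(3))
  qed
  then show ?thesis
    unfolding solid_harmonic_def using pd_homogeneous[OF f(1) f(2)] f(1) by auto
qed

lemma solid_harmonic_sum:
  assumes "finite A" "\<And>a. a \<in> A \<Longrightarrow> solid_harmonic p (f a)"
  shows "solid_harmonic p (\<lambda>x. \<Sum>a\<in>A. c a * f a x)"
proof -
  note f = solid_harmonicD[OF assms(2)]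
  have "pd i (pd i (\<lambda>x. \<Sum>a\<in>A. c a * f a x)) x = (\<Sum>a\<in>A. c a * pd i (pd i (f a)) x)" for i x
    using assms(1) f(1)
    by (simp add: pd_sum pd_cmult real_polynomial_function_pd real_polynomial_function.intros)
  then have "(\<Sum>i\<in>UNIV. pd i (pd i (\<lambda>x. \<Sum>a\<in>A. c a * f a x)) x) = (\<Sum>a\<in>A. c a * (\<Sum>i\<in>UNIV. pd i (pd i (f a)) x))" for x
    by (simp add: sum_distrib_left sum.swap[of _ A])
  then show ?thesis
    unfolding solid_harmonic_def using f assms(1)
    by (auto intro!: real_polynomial_function_sum real_polynomial_function.intros(4)
      simp: sum_distrib_left mult.left_commute)
qed

lemma solid_harmonic_directional:
  assumes "solid_harmonic (Suc p) f"
  shows "solid_harmonic p (\<lambda>x. v \<bullet> grad f x)"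
  using solid_harmonic_sum[of UNIV p "\<lambda>i. pd i f" "\<lambda>i. v $ i"] solid_harmonic_pd[OF assms]
  by (simp add: inner_vec_def)

lemma inner_grad_solid_harmonic:
  assumes "solid_harmonic p f"
  shows "x \<bullet> grad f x = p * f x"
  using inner_grad_homogeneous[of f x p] solid_harmonicD[OF assms] by blast

section \<open>Virial identities\<close>

lemma sphere_divergence_vec:
  fixes F :: "'n \<Rightarrow> real ^ 'n \<Rightarrow> real"
  assumes F: "\<And>i y. y \<in> sphere 0 1 \<Longrightarrow> (F i has_derivative (\<lambda>h. g i y \<bullet> h)) (at y)"
    and g: "\<And>i. continuous_on (sphere 0 1) (g i)"
  shows "(LINT y|sphere_measure. (\<Sum>i\<in>UNIV. g i y $ i - y $ i * (y \<bullet> g i y)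
      - (real CARD('n) - 1) * (y $ i * F i y))) = 0"
proof -
  have contF: "continuous_on (sphere 0 1) (F i)" for i
    using F has_derivative_continuous by (blast intro: continuous_at_imp_continuous_on)
  let ?T = "\<lambda>i y. g i y $ i - y $ i * (y \<bullet> g i y) - (real CARD('n) - 1) * (y $ i * F i y)"
  have "(LINT y|sphere_measure. ?T i y) = 0" for i
    using sphere_divergence[of "F i" "g i" "axis i 1"] F g by (simp add: inner_axis')
  moreover have "integrable sphere_measure (?T i)" for i
    by (intro integrable_sphere continuous_intros g contF)
  ultimately show ?thesis by (simp add: Bochner_Integration.integral_sum)
qed

lemma integral_add_mult_eq_0:
  fixes f g :: "'a \<Rightarrow> real"
  assumes "integrable M f" "integrable M g" "(LINT x|M. f x) = 0" "(LINT x|M. g x) = 0"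
  shows "(LINT x|M. f x + c * g x) = 0"
  using assms by simp

text \<open>The derivative is two-sided even at -1 and 1, so that the composition with y -> e
  \<bullet> y is differentiable in the ambient space at the poles e and -e too.\<close>

definition C1_weight :: "(real \<Rightarrow> real) \<Rightarrow> (real \<Rightarrow> real) \<Rightarrow> bool" where
  "C1_weight \<phi> \<phi>' \<longleftrightarrow> (\<forall>t\<in>{-1..1}. (\<phi> has_real_derivative \<phi>' t) (at t)) \<and> continuous_on {-1..1} \<phi>'"

lemma C1_weight_continuous: "C1_weight \<phi> \<phi>' \<Longrightarrow> continuous_on {-1..1} \<phi>"
  by (meson C1_weight_def DERIV_isCont continuous_at_imp_continuous_on)

lemma inner_sphere_bound:
  fixes e y :: "'a::real_inner"
  assumes "norm e = 1" "y \<in> sphere 0 1"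
  shows "e \<bullet> y \<in> {-1..1}"
  using Cauchy_Schwarz_ineq2[of e y] assms by auto

lemma has_derivative_zonal:
  fixes e :: "real ^ 'n"
  assumes "C1_weight \<phi> \<phi>'" "norm e = 1" "y \<in> sphere 0 1"
  shows "((\<lambda>y. \<phi> (e \<bullet> y)) has_derivative (\<lambda>h. (\<phi>' (e \<bullet> y) *\<^sub>R e) \<bullet> h)) (at y)"
proof -
  have "(\<phi> has_real_derivative \<phi>' (e \<bullet> y)) (at (e \<bullet> y))"
    using assms inner_sphere_bound unfolding C1_weight_def by blast
  then have "(\<phi> has_derivative (\<lambda>h. \<phi>' (e \<bullet> y) * h)) (at (e \<bullet> y))"
    by (simp add: has_field_derivative_def)
  moreover have "((\<lambda>y. e \<bullet> y) has_derivative (\<lambda>h. e \<bullet> h)) (at y)"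
    by (auto intro!: derivative_eq_intros)
  ultimately show ?thesis
    using has_derivative_compose[of "\<lambda>y. e \<bullet> y" "\<lambda>h. e \<bullet> h" y UNIV \<phi>] by simp
qed

lemma continuous_on_zonal:
  fixes e :: "'a::real_inner"
  assumes "continuous_on {-1..1} \<phi>" "norm e = 1"
  shows "continuous_on (sphere 0 1) (\<lambda>y. \<phi> (e \<bullet> y))"
  using inner_sphere_bound[OF assms(2)]
  by (intro continuous_on_compose2[OF assms(1)] continuous_intros) auto

text \<open>The algebra behind \<open>virial\<close>. The choice of \<open>psi\<close> reduces all N
  terms to - x f N, and the choice of \<open>eta\<close> cancels the mixed terms P D; after that q
  drops out of the coefficient of P^2 as well.\<close>

lemma virial_algebra:
  fixes x P D N f f1 f2 f3 d q :: real
  defines "psi \<equiv> (1 - x\<^sup>2) * f1 / 2 - (d + 2 * q) / 2 * x * f"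
  defines "psi' \<equiv> - x * f1 + (1 - x\<^sup>2) * f2 / 2 - (d + 2 * q) / 2 * (f + x * f1)"
  defines "xi \<equiv> (1 + d / 2) * x * f1 - (1 - x\<^sup>2) * f2 / 2 + d / 2 * f"
  defines "xi' \<equiv> (1 + d) * f1 + (2 + d / 2) * x * f2 - (1 - x\<^sup>2) * f3 / 2"
  defines "eta \<equiv> xi + (q * (q + d - 1) + q\<^sup>2) * f"
  defines "eta' \<equiv> xi' + (q * (q + d - 1) + q\<^sup>2) * f1"
  shows "f1 * (D\<^sup>2 + q * x * P * D - (1 - x\<^sup>2) * (N + q\<^sup>2 * P\<^sup>2) / 2)
     - (d + 2 * q - 2) * f * (q * P * D + q\<^sup>2 * x * P\<^sup>2 / 2 - x * N / 2)
    + 1 * (psi * N + psi' * P * D - q * (q + d - 1) * psi * P\<^sup>2)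
    + 1 / 2 * (2 * eta * P * D + (1 - x\<^sup>2) * eta' * P\<^sup>2 - d * x * eta * P\<^sup>2)
    = f1 * D\<^sup>2 - x * f * N - (d * x * xi - (1 - x\<^sup>2) * xi') / 2 * P\<^sup>2"
proof -
  have p: "2 * psi = (1 - x\<^sup>2) * f1 - (d + 2 * q) * x * f"
    and p': "2 * psi' = - 2 * x * f1 + (1 - x\<^sup>2) * f2 - (d + 2 * q) * (f + x * f1)"
    and eta: "2 * eta = 2 * xi + 2 * (q * (q + d - 1) + q\<^sup>2) * f"
    and eta': "eta' = xi' + (q * (q + d - 1) + q\<^sup>2) * f1"
    and xi: "2 * xi = (2 + d) * x * f1 - (1 - x\<^sup>2) * f2 + d * f"
    by (simp_all add: psi_def psi'_def xi_def eta_def eta'_def field_simps)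
  \<comment> \<open>Each halved product gets a name, so that after multiplication by 4 only a
    polynomial identity without division remains.\<close>
  define b v w z y where "b = (1 - x\<^sup>2) * (N + q\<^sup>2 * P\<^sup>2) / 2" and "v = q\<^sup>2 * x * P\<^sup>2 / 2"
    and "w = x * N / 2" and "z = 1 / 2 * (2 * eta * P * D + (1 - x\<^sup>2) * eta' * P\<^sup>2 - d * x * eta * P\<^sup>2)"
    and "y = (d * x * xi - (1 - x\<^sup>2) * xi') / 2"
  then have b: "2 * b = (1 - x\<^sup>2) * (N + q\<^sup>2 * P\<^sup>2)" and v: "2 * v = q\<^sup>2 * x * P\<^sup>2"
    and w: "2 * w = x * N" and z: "2 * z = 2 * eta * P * D + (1 - x\<^sup>2) * eta' * P\<^sup>2 - d * x * eta * P\<^sup>2"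
    and y: "2 * y = d * x * xi - (1 - x\<^sup>2) * xi'"
    by simp_all
  have "4 * (f1 * (D\<^sup>2 + q * x * P * D - b) - (d + 2 * q - 2) * f * (q * P * D + v - w)
    + 1 * (psi * N + psi' * P * D - q * (q + d - 1) * psi * P\<^sup>2) + z - (f1 * D\<^sup>2 - x * f * N - y * P\<^sup>2))
    = 4 * f1 * (D\<^sup>2 + q * x * P * D) - 2 * f1 * (2 * b) - (d + 2 * q - 2) * f * (4 * q * P * D + 2 * (2 * v) - 2 * (2 * w))
    + 2 * (2 * psi) * N + 2 * (2 * psi') * P * D - 2 * q * (q + d - 1) * (2 * psi) * P\<^sup>2
    + 2 * (2 * z) - 4 * (f1 * D\<^sup>2 - x * f * N) + 2 * (2 * y) * P\<^sup>2"
    by algebra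
  also have "\<dots> = 0"
    unfolding b v w z y p p' using eta eta' xi by algebra
  finally have "f1 * (D\<^sup>2 + q * x * P * D - b) - (d + 2 * q - 2) * f * (q * P * D + v - w)
    + 1 * (psi * N + psi' * P * D - q * (q + d - 1) * psi * P\<^sup>2) + z = f1 * D\<^sup>2 - x * f * N - y * P\<^sup>2"
    by (simp only: mult_eq_0_iff) simp
  then show ?thesis
    unfolding b_def v_def w_def z_def y_def .
qed

section \<open>Weighted integral identities for one solid harmonic\<close>

context
  fixes P :: "real ^ 'n \<Rightarrow> real" and e :: "real ^ 'n" and m :: nat and q d :: real
  assumes P: "solid_harmonic (Suc m) P" and e: "norm e = 1"
    and q: "q = real (Suc m)" and d: "d = real CARD('n) - 1"
begin

private abbreviation (input) "\<sigma> \<equiv> sphere_measure :: (real ^ 'n) measure"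
private abbreviation (input) t where "t y \<equiv> e \<bullet> y"
text \<open>By Euler's identity the radial component of \<open>grad P\<close> at a unit vector y is
  q P y. Hence D is the derivative of P along the tangential part of e, and N is the squared length
  of the tangential gradient.\<close>

private abbreviation (input) D where "D y \<equiv> e \<bullet> grad P y - q * t y * P y"
private abbreviation (input) N where "N y \<equiv> grad P y \<bullet> grad P y - q\<^sup>2 * (P y)\<^sup>2"
private abbreviation (input) lam where "lam \<equiv> q * (q + d - 1)"

private lemma poly_P: "real_polynomial_function P"
  using P by (rule solid_harmonicD)

private lemma euler: "y \<bullet> grad P y = q * P y"
  using inner_grad_solid_harmonic[OF P] by (simp add: q)

private lemma euler_pd: "y \<bullet> grad (pd i P) y = (q - 1) * pd i P y"
  using inner_grad_solid_harmonic[OF solid_harmonic_pd[OF P]] by (simp add: q)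

private lemma harmonic: "(\<Sum>i\<in>UNIV. pd i (pd i P) y) = 0"
  using P by (rule solid_harmonicD)

private lemma ee: "e \<bullet> e = 1" using e by (simp add: norm_eq_1)

private lemma poly_dir: "real_polynomial_function (\<lambda>x. e \<bullet> grad P x)"
  using solid_harmonicD(1)[OF solid_harmonic_directional[OF P]] .

private lemmas conts = continuous_on_real_polynomial_function[OF poly_P] continuous_on_real_polynomial_function[OF poly_dir]
  continuous_on_real_polynomial_function[OF real_polynomial_function_pd[OF poly_P]]
  continuous_on_grad[OF poly_P] continuous_on_grad[OF poly_dir] continuous_on_grad[OF real_polynomial_function_pd[OF poly_P]]

text \<open>This is \<open>sphere_divergence\<close> in the direction e for \<xi>(t) P^2; it trades
  the mixed term P D for P^2.\<close>

lemma virial_PD: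
  assumes \<xi>: "C1_weight \<xi> \<xi>'"
  shows "(LINT y|\<sigma>. 2 * \<xi> (t y) * P y * D y + (1 - (t y)\<^sup>2) * \<xi>' (t y) * (P y)\<^sup>2 - d * t y * \<xi> (t y) * (P y)\<^sup>2) = 0"
proof -
  let ?g = "\<lambda>y. ((P y)\<^sup>2 * \<xi>' (t y)) *\<^sub>R e + (2 * \<xi> (t y) * P y) *\<^sub>R grad P y"
  have "(LINT y|\<sigma>. e \<bullet> ?g y - t y * (y \<bullet> ?g y) - (real CARD('n) - 1) * (t y * (\<xi> (t y) * (P y)\<^sup>2))) = 0"
  proof (rule sphere_divergence)
    show "((\<lambda>y. \<xi> (t y) * (P y)\<^sup>2) has_derivative (\<lambda>h. ?g y \<bullet> h)) (at y)" if "y \<in> sphere 0 1" for y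
      by (rule derivative_eq_intros has_derivative_zonal[OF \<xi> e that] has_derivative_grad[OF poly_P] refl)+
         (simp add: fun_eq_iff inner_simps power2_eq_square algebra_simps)
    show "continuous_on (sphere 0 1) ?g"
      using \<xi> C1_weight_continuous[OF \<xi>]
      by (intro continuous_intros continuous_on_zonal conts e) (auto simp: C1_weight_def)
  qed
  moreover have "e \<bullet> ?g y - t y * (y \<bullet> ?g y) - (real CARD('n) - 1) * (t y * (\<xi> (t y) * (P y)\<^sup>2))
     = 2 * \<xi> (t y) * P y * D y + (1 - (t y)\<^sup>2) * \<xi>' (t y) * (P y)\<^sup>2 - d * t y * \<xi> (t y) * (P y)\<^sup>2" for y
    by (simp add: inner_add_right ee euler inner_commute[of y e] d power2_eq_square algebra_simps)
  ultimately show ?thesis by simp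
qed

text \<open>Weighted Green identity, from the divergence of the field \<psi>(t) P grad P; it trades
  N for the eigenvalue \<open>lam\<close> times P^2.\<close>

lemma virial_N:
  assumes \<psi>: "C1_weight \<psi> \<psi>'"
  shows "(LINT y|\<sigma>. \<psi> (t y) * N y + \<psi>' (t y) * P y * D y - lam * \<psi> (t y) * (P y)\<^sup>2) = 0"
proof -
  let ?F = "\<lambda>i y. \<psi> (t y) * P y * pd i P y"
  let ?g = "\<lambda>i y. (\<psi>' (t y) * P y * pd i P y) *\<^sub>R e + (\<psi> (t y) * pd i P y) *\<^sub>R grad P y + (\<psi> (t y) * P y) *\<^sub>R grad (pd i P) y"
  have "(LINT y|\<sigma>. (\<Sum>i\<in>UNIV. ?g i y $ i - y $ i * (y \<bullet> ?g i y) - (real CARD('n) - 1) * (y $ i * ?F i y))) = 0"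
  proof (rule sphere_divergence_vec)
    show "(?F i has_derivative (\<lambda>h. ?g i y \<bullet> h)) (at y)" if "y \<in> sphere 0 1" for y i
      by (rule derivative_eq_intros has_derivative_zonal[OF \<psi> e that] has_derivative_grad poly_P real_polynomial_function_pd refl)+
         (simp add: fun_eq_iff inner_simps power2_eq_square algebra_simps)
    show "continuous_on (sphere 0 1) (?g i)" for i
      using \<psi> C1_weight_continuous[OF \<psi>]
      by (intro continuous_intros continuous_on_zonal conts e) (auto simp: C1_weight_def)
  qed
  moreover have "(\<Sum>i\<in>UNIV. ?g i y $ i - y $ i * (y \<bullet> ?g i y) - (real CARD('n) - 1) * (y $ i * ?F i y))
     = \<psi> (t y) * N y + \<psi>' (t y) * P y * D y - lam * \<psi> (t y) * (P y)\<^sup>2" for y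
  proof -
    define c where "c = \<psi>' (t y) * t y * P y + \<psi> (t y) * (2 * q - 1) * P y + d * \<psi> (t y) * P y"
    have "?g i y $ i - y $ i * (y \<bullet> ?g i y) - (real CARD('n) - 1) * (y $ i * ?F i y)
      = \<psi>' (t y) * P y * (e $ i * pd i P y) + \<psi> (t y) * (pd i P y * pd i P y) + \<psi> (t y) * P y * pd i (pd i P) y
        - c * (y $ i * pd i P y)" for i
      by (simp add: inner_add_right euler euler_pd inner_commute[of y e] d c_def algebra_simps)
    then have "(\<Sum>i\<in>UNIV. ?g i y $ i - y $ i * (y \<bullet> ?g i y) - (real CARD('n) - 1) * (y $ i * ?F i y))
      = (\<Sum>i\<in>UNIV. \<psi>' (t y) * P y * (e $ i * pd i P y) + \<psi> (t y) * (pd i P y * pd i P y) + \<psi> (t y) * P y * pd i (pd i P) y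
        - c * (y $ i * pd i P y))"
      by (rule sum.cong[OF refl])
    also have "\<dots>
      = \<psi>' (t y) * P y * (\<Sum>i\<in>UNIV. e $ i * pd i P y) + \<psi> (t y) * (\<Sum>i\<in>UNIV. pd i P y * pd i P y)
        + \<psi> (t y) * P y * (\<Sum>i\<in>UNIV. pd i (pd i P) y) - c * (\<Sum>i\<in>UNIV. y $ i * pd i P y)"
      by (simp add: sum.distrib sum_subtractf sum_distrib_left)
    also have "\<dots> = \<psi>' (t y) * P y * (e \<bullet> grad P y) + \<psi> (t y) * (grad P y \<bullet> grad P y) - c * (q * P y)"
      by (simp add: harmonic inner_vec_def flip: euler)
    finally show ?thesis
      by (simp add: c_def power2_eq_square algebra_simps)
  qed
  ultimately show ?thesis by simp
qed

private lemma grad_directional: "grad (\<lambda>x. e \<bullet> grad P x) y $ i = e \<bullet> grad (pd i P) y"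
proof -
  have "pd i (\<lambda>x. \<Sum>k\<in>UNIV. e $ k * pd k P x) y = (\<Sum>k\<in>UNIV. e $ k * pd i (pd k P) y)"
    using poly_P by (simp add: pd_sum pd_cmult real_polynomial_function_pd real_polynomial_function.intros)
  then show ?thesis by (simp add: inner_vec_def pd_commute[OF poly_P, of i])
qed

private lemma euler_dir: "y \<bullet> grad (\<lambda>x. e \<bullet> grad P x) y = (q - 1) * (e \<bullet> grad P y)"
  using inner_grad_solid_harmonic[OF solid_harmonic_directional[OF P]] by (simp add: q)

text \<open>The Pohozaev identity for the field \<open>\<phi>(t) e\<close>, from the divergence-free stress tensor
  \<open>\<nabla>P \<otimes> \<nabla>P - |\<nabla>P|\<^sup>2 / 2\<close> of the harmonic function \<open>P\<close>.\<close>

lemma virial_DD: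
  assumes \<phi>: "C1_weight \<phi> \<phi>'"
  shows "(LINT y|\<sigma>. \<phi>' (t y) * ((D y)\<^sup>2 + q * t y * P y * D y - (1 - (t y)\<^sup>2) * (N y + q\<^sup>2 * (P y)\<^sup>2) / 2)
     - (d + 2 * q - 2) * \<phi> (t y) * (q * P y * D y + q\<^sup>2 * t y * (P y)\<^sup>2 / 2 - t y * N y / 2)) = 0"
proof -
  let ?w = "\<lambda>y. e \<bullet> grad P y"
  let ?F = "\<lambda>i y. \<phi> (t y) * ?w y * pd i P y"
  let ?g = "\<lambda>i y. (\<phi>' (t y) * ?w y * pd i P y) *\<^sub>R e + (\<phi> (t y) * pd i P y) *\<^sub>R grad ?w y + (\<phi> (t y) * ?w y) *\<^sub>R grad (pd i P) y"
  let ?F2 = "\<lambda>y. \<phi> (t y) * (\<Sum>i\<in>UNIV. (pd i P y)\<^sup>2)"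
  let ?g2 = "\<lambda>y. (\<phi>' (t y) * (\<Sum>i\<in>UNIV. (pd i P y)\<^sup>2)) *\<^sub>R e + \<phi> (t y) *\<^sub>R (\<Sum>i\<in>UNIV. (2 * pd i P y) *\<^sub>R grad (pd i P) y)"
  let ?I1 = "\<lambda>y. (\<Sum>i\<in>UNIV. ?g i y $ i - y $ i * (y \<bullet> ?g i y) - (real CARD('n) - 1) * (y $ i * ?F i y))"
  let ?I2 = "\<lambda>y. e \<bullet> ?g2 y - t y * (y \<bullet> ?g2 y) - (real CARD('n) - 1) * (t y * ?F2 y)"
  have c\<phi>: "continuous_on (sphere 0 1) (\<lambda>y. \<phi> (t y))" "continuous_on (sphere 0 1) (\<lambda>y. \<phi>' (t y))"
    using \<phi> C1_weight_continuous[OF \<phi>]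
    by (auto intro!: continuous_on_zonal e simp: C1_weight_def)
  have cg: "continuous_on (sphere 0 1) (?g i)" for i
    by (intro continuous_intros c\<phi> conts)
  have cg2: "continuous_on (sphere 0 1) ?g2"
    by (intro continuous_intros c\<phi> conts)
  have "(LINT y|\<sigma>. ?I1 y) = 0"
  proof (rule sphere_divergence_vec)
    show "(?F i has_derivative (\<lambda>h. ?g i y \<bullet> h)) (at y)" if "y \<in> sphere 0 1" for y i
      by (rule derivative_eq_intros has_derivative_zonal[OF \<phi> e that] has_derivative_grad[OF poly_dir]
            has_derivative_grad[OF real_polynomial_function_pd[OF poly_P]] refl)+
         (simp add: fun_eq_iff inner_simps power2_eq_square algebra_simps)
  qed (rule cg)
  moreover have "(LINT y|\<sigma>. ?I2 y) = 0"
  proof (rule sphere_divergence)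
    show "(?F2 has_derivative (\<lambda>h. ?g2 y \<bullet> h)) (at y)" if "y \<in> sphere 0 1" for y
      by (rule derivative_eq_intros has_derivative_zonal[OF \<phi> e that]
            has_derivative_grad[OF real_polynomial_function_pd[OF poly_P]] refl)+
         (simp add: fun_eq_iff inner_simps inner_sum_left sum_distrib_left power2_eq_square algebra_simps)
  qed (rule cg2)
  moreover have "integrable \<sigma> ?I1" "integrable \<sigma> ?I2"
    by (intro integrable_sphere continuous_intros cg cg2 c\<phi> conts)+
  ultimately have "(LINT y|\<sigma>. ?I1 y + (- 1 / 2) * ?I2 y) = 0"
    by (intro integral_add_mult_eq_0)
  moreover have "?I1 y + (- 1 / 2) * ?I2 y = \<phi>' (t y) * ((D y)\<^sup>2 + q * t y * P y * D y - (1 - (t y)\<^sup>2) * (N y + q\<^sup>2 * (P y)\<^sup>2) / 2)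
     - (d + 2 * q - 2) * \<phi> (t y) * (q * P y * D y + q\<^sup>2 * t y * (P y)\<^sup>2 / 2 - t y * N y / 2)" for y
  proof -
    define W where "W = ?w y"
    define G where "G = grad P y \<bullet> grad P y"
    \<comment> \<open>These are the second derivatives of P that harmonicity does not remove. They
      enter \<open>?I1\<close> once and \<open>?I2\<close> twice, and the weight -1/2 cancels
      them.\<close>
    define S where "S = (\<Sum>i\<in>UNIV. pd i P y * (e \<bullet> grad (pd i P) y))"
    define c where "c = \<phi>' (t y) * t y * W + \<phi> (t y) * (2 * q - 2) * W + d * \<phi> (t y) * W"
    have G: "(\<Sum>i\<in>UNIV. (pd i P y)\<^sup>2) = G"
      by (simp add: G_def inner_vec_def power2_eq_square)
    have "?g i y $ i - y $ i * (y \<bullet> ?g i y) - (real CARD('n) - 1) * (y $ i * ?F i y)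
      = \<phi>' (t y) * W * (e $ i * pd i P y) + \<phi> (t y) * (pd i P y * (e \<bullet> grad (pd i P) y))
         + \<phi> (t y) * W * pd i (pd i P) y - c * (y $ i * pd i P y)" for i
      using grad_directional[of y i]
      by (simp add: inner_add_right euler_dir euler_pd inner_commute[of y e] d c_def W_def algebra_simps)
    then have "?I1 y = (\<Sum>i\<in>UNIV. \<phi>' (t y) * W * (e $ i * pd i P y) + \<phi> (t y) * (pd i P y * (e \<bullet> grad (pd i P) y))
         + \<phi> (t y) * W * pd i (pd i P) y - c * (y $ i * pd i P y))"
      by (rule sum.cong[OF refl])
    also have "\<dots> = \<phi>' (t y) * W * (\<Sum>i\<in>UNIV. e $ i * pd i P y) + \<phi> (t y) * S
        + \<phi> (t y) * W * (\<Sum>i\<in>UNIV. pd i (pd i P) y) - c * (\<Sum>i\<in>UNIV. y $ i * pd i P y)"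
      by (simp add: sum.distrib sum_subtractf sum_distrib_left S_def)
    also have "\<dots> = \<phi>' (t y) * W * W + \<phi> (t y) * S - c * (q * P y)"
      by (simp add: harmonic inner_vec_def W_def flip: euler)
    finally have I1: "?I1 y = \<phi>' (t y) * W * W + \<phi> (t y) * S - c * (q * P y)" .
    have e2: "e \<bullet> ?g2 y = \<phi>' (t y) * G + \<phi> (t y) * (2 * S)"
      by (simp add: G inner_add_right ee inner_sum_right S_def sum_distrib_left mult.assoc)
    have y2: "y \<bullet> ?g2 y = \<phi>' (t y) * G * t y + \<phi> (t y) * ((2 * q - 2) * G)"
    proof -
      have "(\<Sum>i\<in>UNIV. 2 * pd i P y * (y \<bullet> grad (pd i P) y)) = (\<Sum>i\<in>UNIV. (2 * q - 2) * (pd i P y * pd i P y))"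
        by (intro sum.cong refl) (simp add: euler_pd algebra_simps)
      also have "\<dots> = (2 * q - 2) * G"
        by (simp add: G_def inner_vec_def sum_distrib_left)
      finally have "(\<Sum>i\<in>UNIV. 2 * pd i P y * (y \<bullet> grad (pd i P) y)) = (2 * q - 2) * G" .
      then show ?thesis by (simp add: G inner_add_right inner_sum_right inner_commute[of y e])
    qed
    have D: "D y = W - q * t y * P y" and N: "N y = G - q\<^sup>2 * (P y)\<^sup>2"
      by (simp_all add: W_def G_def)
    show ?thesis
      unfolding I1 e2 y2 unfolding G D N
      by (simp add: c_def d power2_eq_square field_simps)
  qed
  ultimately show ?thesis by (simp only:)
qed

text \<open>All occurrences of \<open>q\<close> cancel: this is
  \<open>\<integral> Hess \<Phi> (\<nabla>u, \<nabla>u) = 1/4 \<integral> \<Delta>\<^sup>2\<Phi> u\<^sup>2\<close> for \<open>\<Phi>' = \<phi>\<close>.\<close>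

lemma virial:
  assumes \<phi>: "C1_weight \<phi> \<phi>1" "C1_weight \<phi>1 \<phi>2" "C1_weight \<phi>2 \<phi>3"
  defines "\<xi> \<equiv> \<lambda>x. (1 + d / 2) * x * \<phi>1 x - (1 - x\<^sup>2) * \<phi>2 x / 2 + d / 2 * \<phi> x"
  defines "\<xi>' \<equiv> \<lambda>x. (1 + d) * \<phi>1 x + (2 + d / 2) * x * \<phi>2 x - (1 - x\<^sup>2) * \<phi>3 x / 2"
  shows "(LINT y|\<sigma>. \<phi>1 (t y) * (D y)\<^sup>2 - t y * \<phi> (t y) * N y
     - (d * t y * \<xi> (t y) - (1 - (t y)\<^sup>2) * \<xi>' (t y)) / 2 * (P y)\<^sup>2) = 0"
proof -
  define \<psi> where "\<psi> x = (1 - x\<^sup>2) * \<phi>1 x / 2 - (d + 2 * q) / 2 * x * \<phi> x" for x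
  define \<psi>' where "\<psi>' x = - x * \<phi>1 x + (1 - x\<^sup>2) * \<phi>2 x / 2 - (d + 2 * q) / 2 * (\<phi> x + x * \<phi>1 x)" for x
  define \<eta> where "\<eta> x = \<xi> x + (q * (q + d - 1) + q\<^sup>2) * \<phi> x" for x
  define \<eta>' where "\<eta>' x = \<xi>' x + (q * (q + d - 1) + q\<^sup>2) * \<phi>1 x" for x
  have der: "(\<phi> has_real_derivative \<phi>1 x) (at x)" "(\<phi>1 has_real_derivative \<phi>2 x) (at x)"
    "(\<phi>2 has_real_derivative \<phi>3 x) (at x)" if "x \<in> {-1..1}" for x
    using \<phi> that unfolding C1_weight_def by auto
  have cont: "continuous_on {-1..1} \<phi>" "continuous_on {-1..1} \<phi>1" "continuous_on {-1..1} \<phi>2" "continuous_on {-1..1} \<phi>3"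
    using \<phi>(1,2,3)[THEN C1_weight_continuous] \<phi>(3) by (auto simp: C1_weight_def)
  have \<psi>: "C1_weight \<psi> \<psi>'"
    unfolding C1_weight_def
  proof (intro conjI ballI)
    fix x :: real assume x: "x \<in> {-1..1}"
    show "(\<psi> has_real_derivative \<psi>' x) (at x)"
      unfolding \<psi>_def by (auto intro!: derivative_eq_intros der[OF x] simp: \<psi>'_def field_simps power2_eq_square)
  next
    show "continuous_on {-1..1} \<psi>'"
      unfolding \<psi>'_def by (intro continuous_intros cont) auto
  qed
  have \<eta>: "C1_weight \<eta> \<eta>'"
    unfolding C1_weight_def
  proof (intro conjI ballI)
    fix x :: real assume x: "x \<in> {-1..1}"
    show "(\<eta> has_real_derivative \<eta>' x) (at x)"
      unfolding \<eta>_def \<xi>_def by (auto intro!: derivative_eq_intros der[OF x] simp: \<eta>'_def \<xi>'_def field_simps power2_eq_square)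
  next
    show "continuous_on {-1..1} \<eta>'"
      unfolding \<eta>'_def \<xi>'_def by (intro continuous_intros cont) auto
  qed
  note c = continuous_on_zonal[OF C1_weight_continuous[OF \<phi>(1)] e] continuous_on_zonal[OF C1_weight_continuous[OF \<phi>(2)] e]
    continuous_on_zonal[OF C1_weight_continuous[OF \<psi>] e] continuous_on_zonal[OF C1_weight_continuous[OF \<eta>] e]
  have c': "continuous_on (sphere 0 1) (\<lambda>y. \<psi>' (t y))" "continuous_on (sphere 0 1) (\<lambda>y. \<eta>' (t y))"
    using \<psi> \<eta> by (auto simp: C1_weight_def intro!: continuous_on_zonal e)
  let ?A = "\<lambda>y. \<phi>1 (t y) * ((D y)\<^sup>2 + q * t y * P y * D y - (1 - (t y)\<^sup>2) * (N y + q\<^sup>2 * (P y)\<^sup>2) / 2)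
     - (d + 2 * q - 2) * \<phi> (t y) * (q * P y * D y + q\<^sup>2 * t y * (P y)\<^sup>2 / 2 - t y * N y / 2)"
  let ?B = "\<lambda>y. \<psi> (t y) * N y + \<psi>' (t y) * P y * D y - lam * \<psi> (t y) * (P y)\<^sup>2"
  let ?C = "\<lambda>y. 2 * \<eta> (t y) * P y * D y + (1 - (t y)\<^sup>2) * \<eta>' (t y) * (P y)\<^sup>2 - d * t y * \<eta> (t y) * (P y)\<^sup>2"
  have "integrable \<sigma> ?A" "integrable \<sigma> ?B" "integrable \<sigma> ?C"
    by (auto intro!: integrable_sphere continuous_intros c c' conts)
  then have "(LINT y|\<sigma>. ?A y + 1 * ?B y + 1 / 2 * ?C y) = 0"
    by (intro integral_add_mult_eq_0 virial_DD[OF \<phi>(1)] virial_N[OF \<psi>] virial_PD[OF \<eta>]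
        Bochner_Integration.integrable_add integrable_mult_right)
  moreover have "?A y + 1 * ?B y + 1 / 2 * ?C y = \<phi>1 (t y) * (D y)\<^sup>2 - t y * \<phi> (t y) * N y
     - (d * t y * \<xi> (t y) - (1 - (t y)\<^sup>2) * \<xi>' (t y)) / 2 * (P y)\<^sup>2" for y
    unfolding \<psi>_def \<psi>'_def \<eta>_def \<eta>'_def \<xi>_def \<xi>'_def by (rule virial_algebra)
  ultimately show ?thesis by (simp only:)
qed

end

section \<open>Mass in polar caps\<close>

text \<open>Cauchy-Schwarz for the components of e and g orthogonal to y.\<close>

lemma tangential_Cauchy_Schwarz:
  fixes e y g :: "'a::real_inner"
  assumes e: "norm e = 1" and y: "norm y = 1" and g: "y \<bullet> g = c"
  shows "(e \<bullet> g - c * (e \<bullet> y))\<^sup>2 \<le> (1 - (e \<bullet> y)\<^sup>2) * (g \<bullet> g - c\<^sup>2)"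
    and "0 \<le> g \<bullet> g - c\<^sup>2"
proof -
  have ee: "e \<bullet> e = 1" "y \<bullet> y = 1" using e y by (simp_all add: norm_eq_1)
  let ?a = "e - (e \<bullet> y) *\<^sub>R y" and ?b = "g - c *\<^sub>R y"
  have "?a \<bullet> ?b = e \<bullet> g - c * (e \<bullet> y)" "?a \<bullet> ?a = 1 - (e \<bullet> y)\<^sup>2" and b: "?b \<bullet> ?b = g \<bullet> g - c\<^sup>2"
    using ee g by (simp_all add: inner_diff_left inner_diff_right inner_commute[of y e] inner_commute[of g y] power2_eq_square algebra_simps)
  then show "(e \<bullet> g - c * (e \<bullet> y))\<^sup>2 \<le> (1 - (e \<bullet> y)\<^sup>2) * (g \<bullet> g - c\<^sup>2)"
    using Cauchy_Schwarz_ineq[of ?a ?b] by simp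
  show "0 \<le> g \<bullet> g - c\<^sup>2"
    using inner_ge_zero[of ?b] b by simp
qed

section \<open>The multiplier and its derivatives\<close>

context
  fixes \<epsilon> :: real
  assumes \<epsilon>: "0 < \<epsilon>" "\<epsilon> \<le> 1"
begin

text \<open>The multiplier is \<open>\<Phi>(t) = sqrt (\<epsilon>\<^sup>2 + 1 - t\<^sup>2)\<close>; the weight is \<open>1 / \<Phi>\<close>, so that \<open>\<Phi>'\<close> is \<open>- t\<close> times
  the weight and all higher derivatives are polynomials in \<open>t\<close> and the weight.\<close>

definition cap_weight :: "real \<Rightarrow> real" where
  "cap_weight t = 1 / sqrt (1 + \<epsilon>\<^sup>2 - t\<^sup>2)"

private abbreviation (input) "X \<equiv> cap_weight"
private lemmas X_def = cap_weight_def

private lemma X_rel: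
  assumes "t \<in> {-1..1}"
  shows "(\<epsilon>\<^sup>2 + (1 - t\<^sup>2)) * (X t)\<^sup>2 = 1" "0 < X t" "t\<^sup>2 \<le> 1"
proof -
  show t: "t\<^sup>2 \<le> 1" using assms by (auto simp: abs_square_le_1)
  then have "0 < 1 + \<epsilon>\<^sup>2 - t\<^sup>2" using \<epsilon> by (smt (verit) zero_less_power)
  then show "(\<epsilon>\<^sup>2 + (1 - t\<^sup>2)) * (X t)\<^sup>2 = 1" "0 < X t"
    by (auto simp: X_def power_divide)
qed

private lemma X_deriv:
  assumes "t \<in> {-1..1}"
  shows "(X has_real_derivative t * X t ^ 3) (at t)"
proof -
  have p: "0 < 1 + \<epsilon>\<^sup>2 - t\<^sup>2" using X_rel[OF assms] \<epsilon> by (smt (verit) zero_less_power)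
  define s where "s = sqrt (1 + \<epsilon>\<^sup>2 - t\<^sup>2)"
  have s: "s > 0" "s * s = 1 + \<epsilon>\<^sup>2 - t\<^sup>2" using p by (simp_all add: s_def)
  show ?thesis
    unfolding X_def[abs_def] using p s
    by (auto intro!: derivative_eq_intros simp: X_def[symmetric] s_def[symmetric] X_def field_simps power2_eq_square power3_eq_cube)
qed

lemma cap_weight_continuous: "continuous_on {-1..1} X"
  using X_deriv by (meson DERIV_isCont continuous_at_imp_continuous_on)

text \<open>Everything follows from X' = t X^3; the first derivative simplifies through
  (\<epsilon>^2 + 1 - t^2) X^2 = 1. The last two weights serve to convert the gradient term into a
  mass term: \<epsilon>^2 X^3 - 3 is the lower bound found in
  \<open>virial_weight_lower\<close>.\<close>

private lemma X_weights:
  shows "C1_weight (\<lambda>t. - t * X t) (\<lambda>t. - (1 + \<epsilon>\<^sup>2) * X t ^ 3)"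
    "C1_weight (\<lambda>t. - (1 + \<epsilon>\<^sup>2) * X t ^ 3) (\<lambda>t. - 3 * (1 + \<epsilon>\<^sup>2) * t * X t ^ 5)"
    "C1_weight (\<lambda>t. - 3 * (1 + \<epsilon>\<^sup>2) * t * X t ^ 5) (\<lambda>t. - 3 * (1 + \<epsilon>\<^sup>2) * X t ^ 5 - 15 * (1 + \<epsilon>\<^sup>2) * t\<^sup>2 * X t ^ 7)"
    "C1_weight (\<lambda>t. \<epsilon>\<^sup>2 * X t ^ 3 - 3) (\<lambda>t. 3 * \<epsilon>\<^sup>2 * t * X t ^ 5)"
    "C1_weight (\<lambda>t. 3 * \<epsilon>\<^sup>2 * t * X t ^ 5) (\<lambda>t. 3 * \<epsilon>\<^sup>2 * X t ^ 5 + 15 * \<epsilon>\<^sup>2 * t\<^sup>2 * X t ^ 7)"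
proof -
  have eq: "- X t - t * (t * X t ^ 3) = - (1 + \<epsilon>\<^sup>2) * X t ^ 3" if "t \<in> {-1..1}" for t
  proof -
    have "X t = ((\<epsilon>\<^sup>2 + (1 - t\<^sup>2)) * (X t)\<^sup>2) * X t" using X_rel[OF that] by simp
    then show ?thesis by algebra
  qed
  show "C1_weight (\<lambda>t. - t * X t) (\<lambda>t. - (1 + \<epsilon>\<^sup>2) * X t ^ 3)"
    unfolding C1_weight_def
  proof (intro conjI ballI)
    fix t :: real assume t: "t \<in> {-1..1}"
    show "((\<lambda>t. - t * X t) has_real_derivative - (1 + \<epsilon>\<^sup>2) * X t ^ 3) (at t)"
      using eq[OF t] by (auto intro!: derivative_eq_intros X_deriv[OF t] simp: algebra_simps)
  qed (intro continuous_intros cap_weight_continuous)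
  show "C1_weight (\<lambda>t. - (1 + \<epsilon>\<^sup>2) * X t ^ 3) (\<lambda>t. - 3 * (1 + \<epsilon>\<^sup>2) * t * X t ^ 5)"
    "C1_weight (\<lambda>t. - 3 * (1 + \<epsilon>\<^sup>2) * t * X t ^ 5) (\<lambda>t. - 3 * (1 + \<epsilon>\<^sup>2) * X t ^ 5 - 15 * (1 + \<epsilon>\<^sup>2) * t\<^sup>2 * X t ^ 7)"
    "C1_weight (\<lambda>t. \<epsilon>\<^sup>2 * X t ^ 3 - 3) (\<lambda>t. 3 * \<epsilon>\<^sup>2 * t * X t ^ 5)"
    "C1_weight (\<lambda>t. 3 * \<epsilon>\<^sup>2 * t * X t ^ 5) (\<lambda>t. 3 * \<epsilon>\<^sup>2 * X t ^ 5 + 15 * \<epsilon>\<^sup>2 * t\<^sup>2 * X t ^ 7)"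
    unfolding C1_weight_def
    by (auto intro!: derivative_eq_intros X_deriv continuous_intros cap_weight_continuous simp: eval_nat_numeral algebra_simps)
qed

private lemma X_bounds:
  assumes t: "t \<in> {-1..1}"
  shows "(1 - t\<^sup>2) * (X t)\<^sup>2 \<le> 1" "\<epsilon>\<^sup>2 * (X t)\<^sup>2 \<le> 1" "1 \<le> 2 * (X t)\<^sup>2"
    "0 \<le> (1 - t\<^sup>2)" "1 - t\<^sup>2 \<le> 1" "\<bar>t\<bar> \<le> 1"
proof -
  note r = X_rel[OF t]
  show "0 \<le> (1 - t\<^sup>2)" "1 - t\<^sup>2 \<le> 1" "\<bar>t\<bar> \<le> 1" using r t by auto
  have nn: "0 \<le> (1 - t\<^sup>2) * (X t)\<^sup>2" "0 \<le> \<epsilon>\<^sup>2 * (X t)\<^sup>2" using r by auto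
  then show "(1 - t\<^sup>2) * (X t)\<^sup>2 \<le> 1" "\<epsilon>\<^sup>2 * (X t)\<^sup>2 \<le> 1"
    using r(1) unfolding distrib_right by linarith+
  have "\<epsilon>\<^sup>2 \<le> 1" using \<epsilon> by (simp add: power_le_one)
  then have "\<epsilon>\<^sup>2 + (1 - t\<^sup>2) \<le> 2" by (smt (verit) zero_le_power2)
  then have "(\<epsilon>\<^sup>2 + (1 - t\<^sup>2)) * (X t)\<^sup>2 \<le> 2 * (X t)\<^sup>2"
    by (intro mult_right_mono) auto
  then show "1 \<le> 2 * (X t)\<^sup>2" using r(1) by simp
qed

text \<open>Each term is at most a constant times X^3: the powers X^5 and X^7 come with factors 1 -
  t^2 or \<epsilon>^2, each of which absorbs X^2, and X itself is at most 2 X^3 because \<epsilon>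
  \<le> 1. The right-hand side collects the individual bounds, with 13/2 d rounded up to 7
  d.\<close>

lemma virial_error_bound:
  fixes d t :: real
  assumes t: "t \<in> {-1..1}" and d: "0 \<le> d"
  defines "\<phi> \<equiv> - t * X t" and "\<phi>1 \<equiv> - (1 + \<epsilon>\<^sup>2) * X t ^ 3" and "\<phi>2 \<equiv> - 3 * (1 + \<epsilon>\<^sup>2) * t * X t ^ 5"
    and "\<phi>3 \<equiv> - 3 * (1 + \<epsilon>\<^sup>2) * X t ^ 5 - 15 * (1 + \<epsilon>\<^sup>2) * t\<^sup>2 * X t ^ 7"
    and "\<psi>1 \<equiv> 3 * \<epsilon>\<^sup>2 * t * X t ^ 5" and "\<psi>2 \<equiv> 3 * \<epsilon>\<^sup>2 * X t ^ 5 + 15 * \<epsilon>\<^sup>2 * t\<^sup>2 * X t ^ 7"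
  shows "(d * t * ((1 + d / 2) * t * \<phi>1 - (1 - t\<^sup>2) * \<phi>2 / 2 + d / 2 * \<phi>)
      - (1 - t\<^sup>2) * ((1 + d) * \<phi>1 + (2 + d / 2) * t * \<phi>2 - (1 - t\<^sup>2) * \<phi>3 / 2)) / 2
      + (d * t * \<psi>1 - (1 - t\<^sup>2) * \<psi>2) / 2 \<le> (d\<^sup>2 + 7 * d + 25) * X t ^ 3"
proof -
  note r = X_rel[OF t] and b = X_bounds[OF t]
  define s where "s = 1 - t\<^sup>2"
  have s: "0 \<le> s" "s \<le> 1" and sX: "s * (X t)\<^sup>2 \<le> 1" using b by (auto simp: s_def)
  have a: "0 < 1 + \<epsilon>\<^sup>2" "1 + \<epsilon>\<^sup>2 \<le> 2" "\<epsilon>\<^sup>2 \<le> 1" using \<epsilon> by (auto simp: power_le_one add_pos_nonneg)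
  define Z where "Z = X t ^ 3"
  have Z: "Z > 0" using r by (simp add: Z_def)
  have X5: "X t ^ 5 = (X t)\<^sup>2 * Z" and X7: "X t ^ 7 = (X t)\<^sup>2 * (X t)\<^sup>2 * Z" and X1: "X t \<le> 2 * Z"
    using mult_right_mono[OF b(3), of "X t"] r by (simp_all add: Z_def eval_nat_numeral algebra_simps)
  have t1: "\<bar>t * u\<bar> \<le> \<bar>u\<bar>" for u using b(6) by (simp add: abs_mult mult_left_le_one_le)
  have tt: "t\<^sup>2 \<le> 1" "0 \<le> t\<^sup>2" using r by auto
  have p0: "\<bar>\<phi>\<bar> \<le> 2 * Z"
    using t1[of "X t"] X1 r by (simp add: \<phi>_def)
  have p1: "\<bar>\<phi>1\<bar> \<le> 2 * Z"
    using a Z mult_right_mono[OF a(2), of Z] by (simp add: \<phi>1_def Z_def[symmetric] abs_mult)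
  have sZ: "0 \<le> s * (X t)\<^sup>2 * Z" "s * (X t)\<^sup>2 * Z \<le> Z"
    using sX Z s by (auto simp: mult_left_le_one_le)
  have ssZ: "0 \<le> s * (X t)\<^sup>2 * (s * (X t)\<^sup>2 * Z)" "s * (X t)\<^sup>2 * (s * (X t)\<^sup>2 * Z) \<le> Z"
    using mult_mono[OF sX sZ(2)] sZ(1) s Z by auto
  have eZ: "0 \<le> \<epsilon>\<^sup>2 * (X t)\<^sup>2 * Z" "\<epsilon>\<^sup>2 * (X t)\<^sup>2 * Z \<le> Z"
    using b(2) Z by (auto simp: mult_left_le_one_le)
  have esZ: "0 \<le> s * (X t)\<^sup>2 * (\<epsilon>\<^sup>2 * (X t)\<^sup>2 * Z)" "s * (X t)\<^sup>2 * (\<epsilon>\<^sup>2 * (X t)\<^sup>2 * Z) \<le> Z"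
    using mult_mono[OF sX eZ(2)] eZ(1) s Z by auto
  have p2: "\<bar>s * \<phi>2\<bar> \<le> 6 * Z"
  proof -
    have "\<bar>s * \<phi>2\<bar> = \<bar>t * (3 * (1 + \<epsilon>\<^sup>2) * (s * (X t)\<^sup>2 * Z))\<bar>"
    proof -
      have "s * \<phi>2 = - (t * (3 * (1 + \<epsilon>\<^sup>2) * (s * (X t)\<^sup>2 * Z)))"
        unfolding \<phi>2_def X5 by algebra
      then show ?thesis by (simp only: abs_minus_cancel)
    qed
    also have "\<dots> \<le> \<bar>3 * (1 + \<epsilon>\<^sup>2) * (s * (X t)\<^sup>2 * Z)\<bar>" by (rule t1)
    also have "\<dots> = 3 * ((1 + \<epsilon>\<^sup>2) * (s * (X t)\<^sup>2 * Z))" using a sZ by (subst abs_of_nonneg) (auto simp: mult.assoc)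
    also have "\<dots> \<le> 3 * (2 * Z)" using a sZ Z by (intro mult_left_mono mult_mono) auto
    finally show ?thesis by simp
  qed
  have p3: "\<bar>s * (s * \<phi>3)\<bar> \<le> 36 * Z"
  proof -
    have "\<bar>s * (s * \<phi>3)\<bar> = (1 + \<epsilon>\<^sup>2) * (3 * (s * (s * (X t)\<^sup>2 * Z)) + 15 * (t\<^sup>2 * (s * (X t)\<^sup>2 * (s * (X t)\<^sup>2 * Z))))"
    proof -
      have "s * (s * \<phi>3) = - ((1 + \<epsilon>\<^sup>2) * (3 * (s * (s * (X t)\<^sup>2 * Z)) + 15 * (t\<^sup>2 * (s * (X t)\<^sup>2 * (s * (X t)\<^sup>2 * Z)))))"
        unfolding \<phi>3_def X5 X7 by algebra
      then show ?thesis using a sZ ssZ s tt by simp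
    qed
    also have "\<dots> \<le> 2 * (3 * (1 * Z) + 15 * (1 * Z))"
      using a sZ ssZ s tt Z by (intro mult_mono add_mono mult_left_mono) auto
    finally show ?thesis by simp
  qed
  have q1: "\<bar>\<psi>1\<bar> \<le> 3 * Z"
    using t1[of "3 * (\<epsilon>\<^sup>2 * (X t)\<^sup>2 * Z)"] eZ by (simp add: \<psi>1_def X5 mult_ac abs_mult)
  have q2: "\<bar>s * \<psi>2\<bar> \<le> 18 * Z"
  proof -
    have "s * \<psi>2 = 3 * (s * (\<epsilon>\<^sup>2 * (X t)\<^sup>2 * Z)) + 15 * (t\<^sup>2 * (s * (X t)\<^sup>2 * (\<epsilon>\<^sup>2 * (X t)\<^sup>2 * Z)))"
      unfolding \<psi>2_def X5 X7 by algebra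
    moreover have "\<dots> \<le> 3 * (1 * Z) + 15 * (1 * Z)"
      using eZ esZ s tt Z by (intro add_mono mult_left_mono mult_mono) auto
    moreover have "0 \<le> \<dots>" using Z by simp
    moreover have "0 \<le> 3 * (s * (\<epsilon>\<^sup>2 * (X t)\<^sup>2 * Z)) + 15 * (t\<^sup>2 * (s * (X t)\<^sup>2 * (\<epsilon>\<^sup>2 * (X t)\<^sup>2 * Z)))"
      using eZ esZ s tt Z by (intro add_nonneg_nonneg mult_nonneg_nonneg) auto
    ultimately show ?thesis by simp
  qed
  have sp1: "\<bar>s * \<phi>1\<bar> \<le> 2 * Z"
    using mult_mono[OF s(2) p1] s Z by (simp add: abs_mult)
  define \<xi> where "\<xi> = (1 + d / 2) * (t * \<phi>1) - (s * \<phi>2) / 2 + d / 2 * \<phi>"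
  have \<xi>: "\<bar>\<xi>\<bar> \<le> (5 + 2 * d) * Z"
  proof -
    have "\<bar>\<xi>\<bar> \<le> (1 + d / 2) * \<bar>t * \<phi>1\<bar> + \<bar>s * \<phi>2\<bar> / 2 + d / 2 * \<bar>\<phi>\<bar>"
    proof -
      have "0 \<le> 1 + d / 2" "0 \<le> d / 2" using d by auto
      then have "\<bar>(1 + d / 2) * (t * \<phi>1)\<bar> = (1 + d / 2) * \<bar>t * \<phi>1\<bar>" "\<bar>d / 2 * \<phi>\<bar> = d / 2 * \<bar>\<phi>\<bar>"
        by (simp_all only: abs_mult abs_of_nonneg)
      moreover have "\<bar>a - b / 2 + c\<bar> \<le> \<bar>a\<bar> + \<bar>b\<bar> / 2 + \<bar>c\<bar>" for a b c :: real by linarith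
      ultimately show ?thesis unfolding \<xi>_def by metis
    qed
    also have "\<dots> \<le> (1 + d / 2) * (2 * Z) + 6 * Z / 2 + d / 2 * (2 * Z)"
      using d p0 p1 p2 order_trans[OF t1 p1] by (intro add_mono mult_left_mono divide_right_mono) auto
    finally show ?thesis by (simp add: algebra_simps)
  qed
  have dt: "d * (t * \<xi>) \<le> d * ((5 + 2 * d) * Z)"
    using d order_trans[OF t1 \<xi>] by (intro mult_left_mono) auto
  have c1: "(1 + d) * (- (s * \<phi>1)) \<le> (1 + d) * (2 * Z)"
    using d sp1 by (intro mult_left_mono) auto
  have c2: "(2 + d / 2) * (- (t * (s * \<phi>2))) \<le> (2 + d / 2) * (6 * Z)"
    using d order_trans[OF t1 p2] by (intro mult_left_mono) auto
  have c3: "s * (s * \<phi>3) \<le> 36 * Z" using p3 by simp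
  have c4: "d * (t * \<psi>1) \<le> d * (3 * Z)"
    using d order_trans[OF t1 q1] by (intro mult_left_mono) auto
  have c5: "- (s * \<psi>2) \<le> 18 * Z" using q2 by simp
  have "(d * t * ((1 + d / 2) * t * \<phi>1 - (1 - t\<^sup>2) * \<phi>2 / 2 + d / 2 * \<phi>)
      - (1 - t\<^sup>2) * ((1 + d) * \<phi>1 + (2 + d / 2) * t * \<phi>2 - (1 - t\<^sup>2) * \<phi>3 / 2)) / 2
      + (d * t * \<psi>1 - (1 - t\<^sup>2) * \<psi>2) / 2
    = (d * (t * \<xi>) + (1 + d) * (- (s * \<phi>1)) + (2 + d / 2) * (- (t * (s * \<phi>2))) + s * (s * \<phi>3) / 2 + d * (t * \<psi>1) + - (s * \<psi>2)) / 2"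
    unfolding \<xi>_def s_def[symmetric] by (simp add: field_simps)
  also have "\<dots> \<le> (d * ((5 + 2 * d) * Z) + (1 + d) * (2 * Z) + (2 + d / 2) * (6 * Z) + 36 * Z / 2 + d * (3 * Z) + 18 * Z) / 2"
    using dt c1 c2 c3 c4 c5 by (intro divide_right_mono add_mono) auto
  also have "\<dots> = (d\<^sup>2 + 13 / 2 * d + 25) * Z"
    by (simp add: field_simps power2_eq_square)
  also have "\<dots> \<le> (d\<^sup>2 + 7 * d + 25) * Z"
    using d Z by (intro mult_right_mono) auto
  finally show ?thesis unfolding Z_def .
qed

text \<open>Here D stands for the square of the directional derivative. Its negative coefficient is
  worst when the gradient points along the meridian, D = s N with s = 1 - t^2. With X =
  (\<epsilon>^2 + s) X^3 the coefficient of N then becomes \<epsilon>^2 X^3 - 2 \<epsilon>^2 s X^3 -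
  s^2 X^3, and the two subtracted terms are at most 2 and 1.\<close>

lemma virial_weight_lower:
  assumes t: "t \<in> {-1..1}" and D: "D \<le> (1 - t\<^sup>2) * N" and N: "0 \<le> N"
  shows "(\<epsilon>\<^sup>2 * X t ^ 3 - 3) * N \<le> - (1 + \<epsilon>\<^sup>2) * X t ^ 3 * D - t * (- t * X t) * N"
proof -
  note r = X_rel[OF t] and b = X_bounds[OF t]
  define s where "s = 1 - t\<^sup>2"
  have s: "0 \<le> s" "s \<le> 1" and sX: "s * (X t)\<^sup>2 \<le> 1" and t2: "t\<^sup>2 = 1 - s" using b by (auto simp: s_def)
  have X: "X t = (\<epsilon>\<^sup>2 + s) * X t ^ 3"
    using r by (simp add: s_def eval_nat_numeral)
  have sXX: "s * X t \<le> 1"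
  proof -
    have "(s * X t)\<^sup>2 \<le> 1" using mult_mono[OF s(2) sX] s by (simp add: power2_eq_square mult_ac)
    then show ?thesis using r s by (simp add: abs_square_le_1)
  qed
  have b1: "\<epsilon>\<^sup>2 * s * X t ^ 3 \<le> 1"
  proof -
    have "\<epsilon>\<^sup>2 * s * X t ^ 3 = (\<epsilon>\<^sup>2 * (X t)\<^sup>2) * (s * X t)" by (simp add: eval_nat_numeral)
    also have "\<dots> \<le> 1 * 1" using b(2) sXX r s by (intro mult_mono) auto
    finally show ?thesis by simp
  qed
  have b2: "s * s * X t ^ 3 \<le> 1"
  proof -
    have "s * s * X t ^ 3 = (s * (X t)\<^sup>2) * (s * X t)" by (simp add: eval_nat_numeral)
    also have "\<dots> \<le> 1 * 1" using sX sXX r s by (intro mult_mono) auto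
    finally show ?thesis by simp
  qed
  have "(1 + \<epsilon>\<^sup>2) * X t ^ 3 * D \<le> (1 + \<epsilon>\<^sup>2) * X t ^ 3 * (s * N)"
    using D r by (intro mult_left_mono) (auto simp: s_def)
  moreover have "t * (- t * X t) * N = - ((1 - s) * ((\<epsilon>\<^sup>2 + s) * X t ^ 3) * N)"
    using X t2 by (simp add: power2_eq_square mult_ac)
  moreover have "(1 - s) * ((\<epsilon>\<^sup>2 + s) * X t ^ 3) * N - (1 + \<epsilon>\<^sup>2) * X t ^ 3 * (s * N)
      = (\<epsilon>\<^sup>2 * X t ^ 3 - 2 * (\<epsilon>\<^sup>2 * s * X t ^ 3) - s * s * X t ^ 3) * N"
    by (simp add: algebra_simps)
  moreover have "(\<epsilon>\<^sup>2 * X t ^ 3 - 3) * N \<le> (\<epsilon>\<^sup>2 * X t ^ 3 - 2 * (\<epsilon>\<^sup>2 * s * X t ^ 3) - s * s * X t ^ 3) * N"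
    using b1 b2 N by (intro mult_right_mono) auto
  ultimately show ?thesis by (simp add: algebra_simps)
qed

text \<open>By the virial identity the squared gradient, weighted with at least \<epsilon>^2 X^3 -
  3, is controlled by a zero-order error. \<open>virial_N\<close> with this same weight turns it
  into \<open>lam\<close> times P^2, and K makes the error at most half of lam \<epsilon>^2 X^3 P^2.
  What remains compares lam/2 times the weighted mass with 3 lam times the mass, whence the factor
  6.\<close>

lemma weighted_mass_bound:
  fixes P :: "real ^ 'n \<Rightarrow> real"
  assumes P: "solid_harmonic (Suc m) P" and e: "norm e = 1" and d: "d = real CARD('n) - 1" "1 \<le> d"
    and K: "2 * (d\<^sup>2 + 7 * d + 25) \<le> (real (Suc m))\<^sup>2 * \<epsilon>\<^sup>2"
  shows "(LINT y|sphere_measure. \<epsilon>\<^sup>2 * X (e \<bullet> y) ^ 3 * (P y)\<^sup>2) \<le> 6 * (LINT y|sphere_measure. (P y)\<^sup>2)"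
proof -
  define q where "q = real (Suc m)"
  define lam where "lam = q * (q + d - 1)"
  let ?t = "\<lambda>y. e \<bullet> y"
  let ?D = "\<lambda>y. e \<bullet> grad P y - q * ?t y * P y"
  let ?N = "\<lambda>y. grad P y \<bullet> grad P y - q\<^sup>2 * (P y)\<^sup>2"
  define M where "M t = (d * t * ((1 + d / 2) * t * (- (1 + \<epsilon>\<^sup>2) * X t ^ 3) - (1 - t\<^sup>2) * (- 3 * (1 + \<epsilon>\<^sup>2) * t * X t ^ 5) / 2 + d / 2 * (- t * X t))
      - (1 - t\<^sup>2) * ((1 + d) * (- (1 + \<epsilon>\<^sup>2) * X t ^ 3) + (2 + d / 2) * t * (- 3 * (1 + \<epsilon>\<^sup>2) * t * X t ^ 5)
          - (1 - t\<^sup>2) * (- 3 * (1 + \<epsilon>\<^sup>2) * X t ^ 5 - 15 * (1 + \<epsilon>\<^sup>2) * t\<^sup>2 * X t ^ 7) / 2)) / 2" for t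
  define \<psi>1 where "\<psi>1 t = 3 * \<epsilon>\<^sup>2 * t * X t ^ 5" for t
  define \<psi>2 where "\<psi>2 t = 3 * \<epsilon>\<^sup>2 * X t ^ 5 + 15 * \<epsilon>\<^sup>2 * t\<^sup>2 * X t ^ 7" for t
  have q: "q \<ge> 1" "lam > 0" "q\<^sup>2 \<le> lam"
    using d by (auto simp: q_def lam_def power2_eq_square intro!: mult_pos_pos mult_left_mono)
  have Xe: "continuous_on (sphere 0 1) (\<lambda>y. X (e \<bullet> y))"
    by (rule continuous_on_zonal[OF cap_weight_continuous e])
  have poly: "real_polynomial_function P" using P by (rule solid_harmonicD)
  note conts = continuous_on_real_polynomial_function[OF poly] continuous_on_grad[OF poly] Xe
  have I1: "(LINT y|sphere_measure. - (1 + \<epsilon>\<^sup>2) * X (?t y) ^ 3 * (?D y)\<^sup>2 - ?t y * (- ?t y * X (?t y)) * ?N y - M (?t y) * (P y)\<^sup>2) = 0"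
    unfolding M_def by (rule virial[OF P e q_def d(1) X_weights(1-3)])
  have I2: "(LINT y|sphere_measure. (\<epsilon>\<^sup>2 * X (?t y) ^ 3 - 3) * ?N y + \<psi>1 (?t y) * P y * ?D y - lam * (\<epsilon>\<^sup>2 * X (?t y) ^ 3 - 3) * (P y)\<^sup>2) = 0"
    unfolding lam_def \<psi>1_def by (rule virial_N[OF P e q_def d(1) X_weights(4)])
  have I3: "(LINT y|sphere_measure. 2 * \<psi>1 (?t y) * P y * ?D y + (1 - (?t y)\<^sup>2) * \<psi>2 (?t y) * (P y)\<^sup>2 - d * ?t y * \<psi>1 (?t y) * (P y)\<^sup>2) = 0"
    unfolding \<psi>2_def \<psi>1_def by (rule virial_PD[OF P e q_def d(1) X_weights(5)])
  let ?A = "\<lambda>y. - (1 + \<epsilon>\<^sup>2) * X (?t y) ^ 3 * (?D y)\<^sup>2 - ?t y * (- ?t y * X (?t y)) * ?N y - M (?t y) * (P y)\<^sup>2"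
  let ?B = "\<lambda>y. (\<epsilon>\<^sup>2 * X (?t y) ^ 3 - 3) * ?N y + \<psi>1 (?t y) * P y * ?D y - lam * (\<epsilon>\<^sup>2 * X (?t y) ^ 3 - 3) * (P y)\<^sup>2"
  let ?C = "\<lambda>y. 2 * \<psi>1 (?t y) * P y * ?D y + (1 - (?t y)\<^sup>2) * \<psi>2 (?t y) * (P y)\<^sup>2 - d * ?t y * \<psi>1 (?t y) * (P y)\<^sup>2"
  have intA: "integrable sphere_measure ?A"
    unfolding M_def by (auto intro!: integrable_sphere continuous_intros conts)
  have intB: "integrable sphere_measure ?B"
    unfolding \<psi>1_def by (auto intro!: integrable_sphere continuous_intros conts)
  have intC: "integrable sphere_measure ?C"
    unfolding \<psi>1_def \<psi>2_def by (auto intro!: integrable_sphere continuous_intros conts)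
  \<comment> \<open>The weight -1 exchanges N for mass, and the weight 1/2 cancels the mixed term P
    D that \<open>?B\<close> brings in.\<close>
  have "(LINT y|sphere_measure. ?A y + (- 1) * ?B y + 1 / 2 * ?C y) = 0"
    by (intro integral_add_mult_eq_0 I1 I2 I3 intA intB intC
        Bochner_Integration.integrable_add integrable_mult_right)
  moreover have pw: "lam / 2 * (\<epsilon>\<^sup>2 * X (?t y) ^ 3 * (P y)\<^sup>2) - 3 * lam * (P y)\<^sup>2 \<le> ?A y + (- 1) * ?B y + 1 / 2 * ?C y"
    if y: "y \<in> sphere 0 1" for y
  proof -
    have t: "?t y \<in> {-1..1}" by (rule inner_sphere_bound[OF e y])
    have eu: "y \<bullet> grad P y = q * P y"
      using inner_grad_solid_harmonic[OF P] by (simp add: q_def)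
    have CS: "(?D y)\<^sup>2 \<le> (1 - (?t y)\<^sup>2) * ?N y" "0 \<le> ?N y"
      using tangential_Cauchy_Schwarz[OF e _ eu] y by (simp_all add: power_mult_distrib mult_ac)
    have "(\<epsilon>\<^sup>2 * X (?t y) ^ 3 - 3) * ?N y \<le> - (1 + \<epsilon>\<^sup>2) * X (?t y) ^ 3 * (?D y)\<^sup>2 - ?t y * (- ?t y * X (?t y)) * ?N y"
      by (rule virial_weight_lower[OF t CS])
    moreover have "(M (?t y) + (d * ?t y * \<psi>1 (?t y) - (1 - (?t y)\<^sup>2) * \<psi>2 (?t y)) / 2) * (P y)\<^sup>2
        \<le> lam / 2 * (\<epsilon>\<^sup>2 * X (?t y) ^ 3) * (P y)\<^sup>2"
    proof (rule mult_right_mono)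
      have "M (?t y) + (d * ?t y * \<psi>1 (?t y) - (1 - (?t y)\<^sup>2) * \<psi>2 (?t y)) / 2 \<le> (d\<^sup>2 + 7 * d + 25) * X (?t y) ^ 3"
        unfolding M_def \<psi>1_def \<psi>2_def using d by (intro virial_error_bound[OF t]) auto
      also have "\<dots> \<le> (lam / 2 * \<epsilon>\<^sup>2) * X (?t y) ^ 3"
        using K q(3) X_rel(2)[OF t] mult_right_mono[OF q(3), of "\<epsilon>\<^sup>2"]
        by (intro mult_right_mono) (auto simp: q_def)
      finally show "M (?t y) + (d * ?t y * \<psi>1 (?t y) - (1 - (?t y)\<^sup>2) * \<psi>2 (?t y)) / 2 \<le> lam / 2 * (\<epsilon>\<^sup>2 * X (?t y) ^ 3)"
        by (simp add: mult.assoc)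
    qed simp
    moreover have "?A y + (- 1) * ?B y + 1 / 2 * ?C y =
      (- (1 + \<epsilon>\<^sup>2) * X (?t y) ^ 3 * (?D y)\<^sup>2 - ?t y * (- ?t y * X (?t y)) * ?N y - (\<epsilon>\<^sup>2 * X (?t y) ^ 3 - 3) * ?N y)
      + lam * (\<epsilon>\<^sup>2 * X (?t y) ^ 3) * (P y)\<^sup>2 - 3 * lam * (P y)\<^sup>2
      - (M (?t y) + (d * ?t y * \<psi>1 (?t y) - (1 - (?t y)\<^sup>2) * \<psi>2 (?t y)) / 2) * (P y)\<^sup>2"
      by (simp add: field_simps)
    moreover have "lam / 2 * (F * p) - 3 * lam * p \<le> (R - a) + lam * F * p - 3 * lam * p - E * p"
      if "a \<le> R" "E * p \<le> lam / 2 * F * p" for F p R a E :: real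
      using that by (simp add: algebra_simps)
    ultimately show ?thesis by (simp only:)
  qed
  moreover have "(LINT y|sphere_measure. lam / 2 * (\<epsilon>\<^sup>2 * X (?t y) ^ 3 * (P y)\<^sup>2) - 3 * lam * (P y)\<^sup>2)
      \<le> (LINT y|sphere_measure. ?A y + (- 1) * ?B y + 1 / 2 * ?C y)"
  proof (rule integral_mono)
    show "integrable sphere_measure (\<lambda>y. ?A y + (- 1) * ?B y + 1 / 2 * ?C y)"
      by (intro intA intB intC Bochner_Integration.integrable_add integrable_mult_right)
  qed (use pw in \<open>auto intro!: integrable_sphere continuous_intros conts\<close>)
  ultimately have "(LINT y|sphere_measure. lam / 2 * (\<epsilon>\<^sup>2 * X (?t y) ^ 3 * (P y)\<^sup>2) - 3 * lam * (P y)\<^sup>2) \<le> 0"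
    by (simp only:)
  moreover have "integrable sphere_measure (\<lambda>y. \<epsilon>\<^sup>2 * X (?t y) ^ 3 * (P y)\<^sup>2)" "integrable sphere_measure (\<lambda>y. (P y)\<^sup>2)"
    by (intro integrable_sphere continuous_intros conts)+
  ultimately have "lam * (LINT y|sphere_measure. \<epsilon>\<^sup>2 * X (?t y) ^ 3 * (P y)\<^sup>2) \<le> lam * (6 * (LINT y|sphere_measure. (P y)\<^sup>2))"
    by simp
  then show ?thesis using q(2) by simp
qed

lemma cap_weight_pos: "t \<in> {-1..1} \<Longrightarrow> 0 < X t"
  by (rule X_rel)

lemma cap_weight_lower:
  assumes "t \<in> {-1..1}" "1 - t\<^sup>2 \<le> \<epsilon>\<^sup>2"
  shows "1 \<le> 3 * \<epsilon> * (\<epsilon>\<^sup>2 * X t ^ 3)"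
proof -
  have "(\<epsilon>\<^sup>2 + (1 - t\<^sup>2)) * (X t)\<^sup>2 \<le> (2 * \<epsilon>\<^sup>2) * (X t)\<^sup>2"
    using assms by (intro mult_right_mono) auto
  then have u2: "1 / 2 \<le> (\<epsilon> * X t)\<^sup>2" using X_rel[OF assms(1)] by (simp add: power_mult_distrib)
  \<comment> \<open>7/10 is a rational lower bound for 1 / sqrt 2; half of it exceeds 1/3, hence the
    factor 3 of the statement.\<close>
  have u: "7 / 10 \<le> \<epsilon> * X t"
  proof (rule ccontr)
    assume "\<not> ?thesis"
    then have "(\<epsilon> * X t)\<^sup>2 \<le> (7 / 10)\<^sup>2"
      using X_rel[OF assms(1)] \<epsilon> by (intro power_mono) auto
    with u2 show False by (simp add: power2_eq_square)
  qed
  have "7 / 10 * (1 / 2) \<le> (\<epsilon> * X t) * (\<epsilon> * X t)\<^sup>2"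
    using u u2 by (intro mult_mono) auto
  then show ?thesis by (simp add: eval_nat_numeral mult_ac)
qed

end

lemma measurable_sphere_borel:
  fixes f :: "real ^ 'n \<Rightarrow> 'b::topological_space"
  assumes "f \<in> borel_measurable borel"
  shows "f \<in> borel_measurable sphere_measure"
  using measurable_restrict_space1[OF assms, of "sphere 0 1"]
  by (simp cong: measurable_cong_sets add: sets_sphere_measure)

text \<open>The weighted bound is applied with \<epsilon> = \<kappa> r. The factor \<kappa> secures
  its hypothesis from q r \<ge> 1, and 18 is the product of its 6 with the 3 of
  \<open>cap_weight_lower\<close>. If \<kappa> r > 1, the right-hand side is at least the whole
  mass.\<close>

lemma polar_cap_mass:
  fixes P :: "real ^ 'n \<Rightarrow> real"
  assumes P: "solid_harmonic (Suc m) P" and e: "norm e = 1" and d: "d = real CARD('n) - 1" "1 \<le> d"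
    and r: "1 \<le> real (Suc m) * r"
  shows "(LINT y|sphere_measure. indicator {y. 1 - (e \<bullet> y)\<^sup>2 \<le> r\<^sup>2} y * (P y)\<^sup>2)
    \<le> 18 * (2 * (d\<^sup>2 + 7 * d + 25)) * r * (LINT y|sphere_measure. (P y)\<^sup>2)"
proof -
  define \<kappa> where "\<kappa> = 2 * (d\<^sup>2 + 7 * d + 25)"
  have \<kappa>: "\<kappa> \<ge> 1" using d by (simp add: \<kappa>_def)
  have rp: "r > 0" using r by (smt (verit) mult_nonneg_nonpos of_nat_0_le_iff)
  have poly: "real_polynomial_function P" using P by (rule solid_harmonicD)
  have int: "integrable sphere_measure (\<lambda>y. (P y)\<^sup>2)"
    by (intro integrable_sphere continuous_intros continuous_on_real_polynomial_function poly)
  have I0: "0 \<le> (LINT y|sphere_measure. (P y)\<^sup>2)" by simp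
  let ?S = "{y :: real ^ 'n. 1 - (e \<bullet> y)\<^sup>2 \<le> r\<^sup>2}"
  have "closed ?S" by (intro closed_Collect_le continuous_intros)
  then have "indicator ?S \<in> borel_measurable (sphere_measure :: (real ^ 'n) measure)"
    by (intro measurable_sphere_borel borel_measurable_indicator borel_closed)
  then have "(\<lambda>y. indicator ?S y * (P y)\<^sup>2) \<in> borel_measurable sphere_measure"
    by (intro borel_measurable_times borel_measurable_integrable[OF int])
  then have intS: "integrable sphere_measure (\<lambda>y. indicator ?S y * (P y)\<^sup>2)"
    by (rule Bochner_Integration.integrable_bound[OF int]) (auto simp: indicator_def)
  show ?thesis
  proof (cases "\<kappa> * r \<le> 1")
    case True
    have \<epsilon>: "0 < \<kappa> * r" "\<kappa> * r \<le> 1" using True \<kappa> rp by auto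
    let ?X = "\<lambda>t. cap_weight (\<kappa> * r) t"
    have "\<kappa> \<le> (real (Suc m))\<^sup>2 * (\<kappa> * r)\<^sup>2"
    proof -
      have "1 * 1 \<le> \<kappa> * (real (Suc m) * r)\<^sup>2"
        using \<kappa> one_le_power[OF r] by (intro mult_mono) auto
      then have "\<kappa> * 1 \<le> \<kappa> * (\<kappa> * (real (Suc m) * r)\<^sup>2)"
        using \<kappa> by (intro mult_left_mono) auto
      then show ?thesis by (simp add: power2_eq_square mult_ac)
    qed
    then have W: "(LINT y|sphere_measure. (\<kappa> * r)\<^sup>2 * ?X (e \<bullet> y) ^ 3 * (P y)\<^sup>2) \<le> 6 * (LINT y|sphere_measure. (P y)\<^sup>2)"
      unfolding \<kappa>_def by (rule weighted_mass_bound[OF \<epsilon>[unfolded \<kappa>_def] P e d])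
    have intX: "integrable sphere_measure (\<lambda>y. (\<kappa> * r)\<^sup>2 * ?X (e \<bullet> y) ^ 3 * (P y)\<^sup>2)"
      by (intro integrable_sphere continuous_intros continuous_on_zonal[OF cap_weight_continuous[OF \<epsilon>] e]
          continuous_on_real_polynomial_function poly)
    have "(LINT y|sphere_measure. indicator ?S y * (P y)\<^sup>2)
        \<le> (LINT y|sphere_measure. 3 * (\<kappa> * r) * ((\<kappa> * r)\<^sup>2 * ?X (e \<bullet> y) ^ 3 * (P y)\<^sup>2))"
    proof (rule integral_mono[OF intS])
      show "integrable sphere_measure (\<lambda>y. 3 * (\<kappa> * r) * ((\<kappa> * r)\<^sup>2 * ?X (e \<bullet> y) ^ 3 * (P y)\<^sup>2))"
        using intX by (rule integrable_mult_right)
      fix y :: "real ^ 'n" assume "y \<in> space sphere_measure"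
      then have t: "e \<bullet> y \<in> {-1..1}" by (intro inner_sphere_bound[OF e]) simp
      have "1 * r \<le> \<kappa> * r" using \<kappa> rp by (intro mult_right_mono) auto
      then have rr: "r\<^sup>2 \<le> (\<kappa> * r)\<^sup>2" using rp by (intro power_mono) auto
      have "0 \<le> 3 * (\<kappa> * r) * ((\<kappa> * r)\<^sup>2 * ?X (e \<bullet> y) ^ 3)"
        using cap_weight_pos[OF \<epsilon> t] \<kappa> rp by (intro mult_nonneg_nonneg) auto
      then have "indicator ?S y \<le> 3 * (\<kappa> * r) * ((\<kappa> * r)\<^sup>2 * ?X (e \<bullet> y) ^ 3)"
        using cap_weight_lower[OF \<epsilon> t] rr by (auto simp: indicator_def)
      then have "indicator ?S y * (P y)\<^sup>2 \<le> 3 * (\<kappa> * r) * ((\<kappa> * r)\<^sup>2 * ?X (e \<bullet> y) ^ 3) * (P y)\<^sup>2"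
        by (rule mult_right_mono) simp
      then show "indicator ?S y * (P y)\<^sup>2 \<le> 3 * (\<kappa> * r) * ((\<kappa> * r)\<^sup>2 * ?X (e \<bullet> y) ^ 3 * (P y)\<^sup>2)"
        by (simp only: mult.assoc)
    qed
    also have "\<dots> = 3 * (\<kappa> * r) * (LINT y|sphere_measure. (\<kappa> * r)\<^sup>2 * ?X (e \<bullet> y) ^ 3 * (P y)\<^sup>2)"
      by (rule integral_mult_right_zero)
    also have "\<dots> \<le> 3 * (\<kappa> * r) * (6 * (LINT y|sphere_measure. (P y)\<^sup>2))"
      using \<epsilon> by (intro mult_left_mono W) auto
    also have "\<dots> = 18 * \<kappa> * r * (LINT y|sphere_measure. (P y)\<^sup>2)" by simp
    finally show ?thesis unfolding \<kappa>_def .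
  next
    case False
    have "(LINT y|sphere_measure. indicator ?S y * (P y)\<^sup>2) \<le> (LINT y|sphere_measure. (P y)\<^sup>2)"
      by (intro integral_mono intS int) (auto simp: indicator_def)
    also have "\<dots> \<le> (18 * \<kappa> * r) * (LINT y|sphere_measure. (P y)\<^sup>2)"
      using False I0 mult_right_mono[of 1 "18 * \<kappa> * r"] by simp
    finally show ?thesis by (simp add: \<kappa>_def mult_ac)
  qed
qed

section \<open>Zonal harmonics\<close>

lemma solid_harmonic_0_const:
  fixes H :: "real ^ 'n \<Rightarrow> real"
  assumes "solid_harmonic 0 H"
  shows "H x = H 0"
proof -
  have c: "continuous_on UNIV H"
    by (rule continuous_on_real_polynomial_function[OF solid_harmonicD(1)[OF assms]])
  have "(\<lambda>k. H ((1 / real (Suc k)) *\<^sub>R x)) \<longlonglongrightarrow> H (0 *\<^sub>R x)"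
  proof (rule continuous_on_tendsto_compose[OF c])
    show "(\<lambda>k. (1 / real (Suc k)) *\<^sub>R x) \<longlonglongrightarrow> 0 *\<^sub>R x"
      using LIMSEQ_inverse_real_of_nat by (intro tendsto_intros) (simp add: inverse_eq_divide)
  qed auto
  moreover have "H ((1 / real (Suc k)) *\<^sub>R x) = H x" for k
    using solid_harmonicD(2)[OF assms] by simp
  ultimately show ?thesis by (simp add: LIMSEQ_const_iff)
qed

text \<open>The spherical Laplacian of H, obtained as the tangential divergence of grad H, is minus
  the eigenvalue times H and has integral zero.\<close>

lemma integral_solid_harmonic_0:
  fixes H :: "real ^ 'n \<Rightarrow> real"
  assumes H: "solid_harmonic (Suc p) H" and n: "CARD('n) \<ge> 2"
  shows "(LINT y|sphere_measure. H y) = 0"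
proof -
  have poly: "real_polynomial_function H" using H by (rule solid_harmonicD)
  have "(LINT y|sphere_measure. (\<Sum>i\<in>UNIV. grad (pd i H) y $ i - y $ i * (y \<bullet> grad (pd i H) y)
      - (real CARD('n) - 1) * (y $ i * pd i H y))) = 0"
    by (intro sphere_divergence_vec has_derivative_grad continuous_on_grad real_polynomial_function_pd poly)
  moreover have "(\<Sum>i\<in>UNIV. grad (pd i H) y $ i - y $ i * (y \<bullet> grad (pd i H) y)
      - (real CARD('n) - 1) * (y $ i * pd i H y)) = - ((real p + real CARD('n) - 1) * Suc p) * H y" for y
  proof -
    have "grad (pd i H) y $ i - y $ i * (y \<bullet> grad (pd i H) y) - (real CARD('n) - 1) * (y $ i * pd i H y)
        = pd i (pd i H) y - (real p + real CARD('n) - 1) * (y $ i * pd i H y)" for i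
      using inner_grad_solid_harmonic[OF solid_harmonic_pd[OF H], of y i] by (simp add: algebra_simps)
    then have "(\<Sum>i\<in>UNIV. grad (pd i H) y $ i - y $ i * (y \<bullet> grad (pd i H) y) - (real CARD('n) - 1) * (y $ i * pd i H y))
        = (\<Sum>i\<in>UNIV. pd i (pd i H) y - (real p + real CARD('n) - 1) * (y $ i * pd i H y))"
      by (rule sum.cong[OF refl])
    also have "\<dots> = - ((real p + real CARD('n) - 1) * (\<Sum>i\<in>UNIV. y $ i * pd i H y))"
      by (simp add: sum_subtractf sum_distrib_left solid_harmonicD(3)[OF H])
    also have "(\<Sum>i\<in>UNIV. y $ i * pd i H y) = Suc p * H y"
      using inner_grad_solid_harmonic[OF H, of y] by (simp add: inner_vec_def)
    finally show ?thesis by simp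
  qed
  ultimately have "(LINT y|sphere_measure. - ((real p + real CARD('n) - 1) * Suc p) * H y) = 0"
    by (simp only:)
  then have "- ((real p + real CARD('n) - 1) * Suc p) * (LINT y|sphere_measure. H y) = 0"
    by (simp only: integral_mult_right_zero)
  moreover have "real p + real CARD('n) - 1 > 0" using n by linarith
  ultimately show ?thesis by simp
qed

text \<open>This is \<open>sphere_divergence\<close> in the direction x for (x \<bullet> y)^j H, and
  it serves as a recursion for moments. At j = 0 the truncated exponent j - 1 carries the factor
  0.\<close>

lemma integral_power_solid_harmonic:
  fixes H :: "real ^ 'n \<Rightarrow> real"
  assumes H: "solid_harmonic p H" and x: "norm x = 1"
  shows "(LINT y|sphere_measure. j * ((x \<bullet> y) ^ (j - 1) * H y) + (x \<bullet> y) ^ j * (x \<bullet> grad H y)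
    - (real CARD('n) - 1 + j + p) * ((x \<bullet> y) ^ Suc j * H y)) = 0"
proof -
  have poly: "real_polynomial_function H" using H by (rule solid_harmonicD)
  have xx: "x \<bullet> x = 1" using x by (simp add: norm_eq_1)
  note conts = continuous_on_real_polynomial_function[OF poly] continuous_on_grad[OF poly]
  let ?g = "\<lambda>y. (j * (x \<bullet> y) ^ (j - 1) * H y) *\<^sub>R x + (x \<bullet> y) ^ j *\<^sub>R grad H y"
  have "(LINT y|sphere_measure. x \<bullet> ?g y - (x \<bullet> y) * (y \<bullet> ?g y) - (real CARD('n) - 1) * ((x \<bullet> y) * ((x \<bullet> y) ^ j * H y))) = 0"
  proof (rule sphere_divergence)
    show "((\<lambda>y. (x \<bullet> y) ^ j * H y) has_derivative (\<lambda>h. ?g y \<bullet> h)) (at y)" for y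
      by (rule derivative_eq_intros has_derivative_grad[OF poly] refl)+
         (simp add: fun_eq_iff inner_simps algebra_simps)
  qed (intro continuous_intros conts)
  moreover have "x \<bullet> ?g y - (x \<bullet> y) * (y \<bullet> ?g y) - (real CARD('n) - 1) * ((x \<bullet> y) * ((x \<bullet> y) ^ j * H y))
    = j * ((x \<bullet> y) ^ (j - 1) * H y) + (x \<bullet> y) ^ j * (x \<bullet> grad H y)
    - (real CARD('n) - 1 + j + p) * ((x \<bullet> y) ^ Suc j * H y)" for y
    using inner_grad_solid_harmonic[OF H, of y]
    by (cases j) (simp_all add: inner_add_right xx inner_commute[of y x] algebra_simps)
  ultimately show ?thesis by simp
qed

text \<open>Funk-Hecke constant of the power t^p on harmonics of degree p; s is the area of the
  sphere and d its dimension.\<close>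

fun moment_const :: "real \<Rightarrow> real \<Rightarrow> nat \<Rightarrow> real" where
  "moment_const s d 0 = s"
| "moment_const s d (Suc p) = Suc p * moment_const s d p / (d + 2 * p + 1)"

lemma moment_const_nonneg: "0 \<le> s \<Longrightarrow> 0 \<le> d \<Longrightarrow> 0 \<le> moment_const s d p"
  by (induction p) auto

lemma moment_const_pos: "0 < s \<Longrightarrow> 0 \<le> d \<Longrightarrow> 0 < moment_const s d p"
  by (induction p) (auto intro!: divide_pos_pos mult_pos_pos)

text \<open>The recursion lowers exponent and degree together, replacing H by its derivative along
  x, which is again a solid harmonic. The other term has exponent k - 2 < p and vanishes by
  induction. On the diagonal k = p, Euler's identity turns x \<bullet> grad H x back into p H
  x.\<close>

lemma moment_solid_harmonic:
  fixes H :: "real ^ 'n \<Rightarrow> real"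
  assumes H: "solid_harmonic p H" and x: "norm x = 1" and n: "CARD('n) \<ge> 2"
  shows "k < p \<Longrightarrow> (LINT y|sphere_measure. (x \<bullet> y) ^ k * H y) = 0"
    and "k = p \<Longrightarrow> (LINT y|sphere_measure. (x \<bullet> y) ^ k * H y)
      = moment_const (measure (sphere_measure :: (real ^ 'n) measure) (sphere 0 1)) (real CARD('n) - 1) p * H x"
proof -
  let ?s = "measure (sphere_measure :: (real ^ 'n) measure) (sphere 0 1)"
  let ?I = "\<lambda>k H. (LINT y|sphere_measure. (x \<bullet> y) ^ k * H y)"
  have "(k < p \<longrightarrow> ?I k H = 0) \<and> (k = p \<longrightarrow> ?I k H = moment_const ?s (real CARD('n) - 1) p * H x)"
    using H
  proof (induction k arbitrary: p H rule: less_induct)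
    case (less k)
    show ?case
    proof (cases k)
      case 0
      show ?thesis
      proof (cases p)
        case p: 0
        have "H y = H x" for y
          using solid_harmonic_0_const less.prems p by metis
        then have "?I 0 H = (LINT y|(sphere_measure :: (real ^ 'n) measure). H x)"
          by (intro Bochner_Integration.integral_cong refl) (metis mult_1 power_0)
        also have "\<dots> = ?s * H x" by simp
        finally show ?thesis using 0 p by simp
      next
        case (Suc p')
        then show ?thesis
          using 0 less.prems integral_solid_harmonic_0[of p' H] n by simp
      qed
    next
      case k: (Suc j)
      show ?thesis
      proof (cases "p < k")
        case True
        then show ?thesis by simp
      next
        case False
        then obtain p' where p: "p = Suc p'" "j \<le> p'" using k by (cases p) auto
        have poly: "real_polynomial_function H" using less.prems by (rule solid_harmonicD)
        note conts = continuous_on_real_polynomial_function[OF poly] continuous_on_grad[OF poly]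
        have dH: "solid_harmonic p' (\<lambda>y. x \<bullet> grad H y)"
          using less.prems p by (auto intro: solid_harmonic_directional)
        have int: "integrable sphere_measure (\<lambda>y. (x \<bullet> y) ^ i * H y)"
          "integrable sphere_measure (\<lambda>y. (x \<bullet> y) ^ i * (x \<bullet> grad H y))" for i
          by (intro integrable_sphere continuous_intros conts)+
        have "real j * ?I (j - 1) H + ?I j (\<lambda>y. x \<bullet> grad H y) - (real CARD('n) - 1 + j + p) * ?I (Suc j) H = 0"
          using integral_power_solid_harmonic[OF less.prems x, of j] int
          by (simp del: power_Suc)
        moreover have "real j * ?I (j - 1) H = 0"
          using less.IH[of "j - 1" p H] less.prems k p by (cases j) auto
        ultimately have "(real CARD('n) - 1 + j + p) * ?I (Suc j) H = ?I j (\<lambda>y. x \<bullet> grad H y)"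
          by linarith
        then have rec: "(real CARD('n) - 1 + j + p) * ?I k H = ?I j (\<lambda>y. x \<bullet> grad H y)"
          using k by (simp only:)
        have IH: "(j < p' \<longrightarrow> ?I j (\<lambda>y. x \<bullet> grad H y) = 0) \<and> (j = p' \<longrightarrow>
            ?I j (\<lambda>y. x \<bullet> grad H y) = moment_const ?s (real CARD('n) - 1) p' * (x \<bullet> grad H x))"
          using less.IH[OF _ dH, of j] k by simp
        have pos: "real CARD('n) - 1 + j + p > 0" using n p by simp
        show ?thesis
        proof (intro conjI impI)
          assume "k < p"
          then show "?I k H = 0" using IH rec pos k p by auto
        next
          assume "k = p"
          then have "(real CARD('n) - 1 + j + p) * ?I k H
              = moment_const ?s (real CARD('n) - 1) p' * (p * H x)"
            using IH rec k p inner_grad_solid_harmonic[OF less.prems, of x] by auto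
          then have "?I k H = moment_const ?s (real CARD('n) - 1) p' * (p * H x) / (real CARD('n) - 1 + j + p)"
            using pos by (simp add: field_simps)
          then show "?I k H = moment_const ?s (real CARD('n) - 1) p * H x"
            using \<open>k = p\<close> k p by (simp add: mult_ac add_ac)
        qed
      qed
    qed
  qed
  then show "k < p \<Longrightarrow> ?I k H = 0" "k = p \<Longrightarrow> ?I k H = moment_const ?s (real CARD('n) - 1) p * H x"
    by auto
qed

section \<open>The zonal polynomial and its reproducing property\<close>

fun gegenbauer_coeff :: "real \<Rightarrow> nat \<Rightarrow> nat \<Rightarrow> real" where
  "gegenbauer_coeff n p 0 = 1"
| "gegenbauer_coeff n p (Suc k) =
    - gegenbauer_coeff n p k * ((real p - 2 * k) * (real p - 2 * k - 1)) / (2 * real (Suc k) * (2 * real p - 2 * real k + n - 4))"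

lemma gegenbauer_coeff_rec:
  assumes "2 * Suc k \<le> p" "n > 0"
  shows "gegenbauer_coeff n p k * ((real p - 2 * k) * (real p - 2 * k - 1))
     + gegenbauer_coeff n p (Suc k) * (2 * real (Suc k) * (2 * real p - 2 * real (Suc k) + n - 2)) = 0"
proof -
  have "real (2 * Suc k) \<le> real p" using assms(1) by (rule of_nat_mono)
  then have pos: "2 * real p - 2 * real k + n - 4 > 0" using assms(2) by simp
  have e: "2 * real p - 2 * real (Suc k) + n - 2 = 2 * real p - 2 * real k + n - 4" by simp
  show ?thesis
    unfolding e using pos by (simp del: of_nat_Suc)
qed

text \<open>One telescoping serves both the harmonicity of \<open>zonal\<close> and the differential
  equation of \<open>gegenbauer\<close>. The first term at k cancels the second at k + 1; the second
  vanishes at k = 0, and the first at the last index, where p - 2k is 0 or 1.\<close>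

lemma gegenbauer_telescope:
  fixes a b :: "nat \<Rightarrow> real"
  assumes n: "n > 0" and ab: "\<And>k. 2 * Suc k \<le> p \<Longrightarrow> b (Suc k) = a k"
  shows "(\<Sum>k\<le>p div 2. gegenbauer_coeff n p k * ((real p - 2 * k) * (real p - 2 * k - 1)) * a k
     + gegenbauer_coeff n p k * (2 * real k * (2 * real p - 2 * real k + n - 2)) * b k) = 0"
proof -
  let ?A = "\<lambda>k. gegenbauer_coeff n p k * ((real p - 2 * k) * (real p - 2 * k - 1)) * a k"
  let ?B = "\<lambda>k. gegenbauer_coeff n p k * (2 * real k * (2 * real p - 2 * real k + n - 2)) * b k"
  have "(\<Sum>k\<le>K. ?A k + ?B k) = ?A K" if "K \<le> p div 2" for K
    using that
  proof (induction K)
    case (Suc K)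
    then have K: "2 * Suc K \<le> p" by auto
    have "?A K + ?B (Suc K) = 0"
      using arg_cong[OF gegenbauer_coeff_rec[OF K n], of "\<lambda>z. z * a K"] ab[OF K]
      by (simp only: distrib_right mult_zero_left)
    then show ?case using Suc by (simp only: sum.atMost_Suc)
  qed simp
  moreover have "?A (p div 2) = 0"
  proof -
    have "p = 2 * (p div 2) \<or> p = 2 * (p div 2) + 1" by linarith
    then have "real p = 2 * real (p div 2) \<or> real p = 2 * real (p div 2) + 1"
      by (metis of_nat_1 of_nat_add of_nat_mult of_nat_numeral)
    then show ?thesis by auto
  qed
  ultimately show ?thesis by simp
qed

text \<open>Up to a factor, the Gegenbauer polynomial of index (n - 2) / 2. It is normalised by its
  leading coefficient 1 and not by its value at 1, so that the reproducing factor of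
  \<open>zonal\<close> is exactly \<open>moment_const\<close>.\<close>

definition gegenbauer :: "real \<Rightarrow> nat \<Rightarrow> real \<Rightarrow> real" where
  "gegenbauer n p t = (\<Sum>k\<le>p div 2. gegenbauer_coeff n p k * t ^ (p - 2 * k))"

text \<open>The powers of y \<bullet> y equal 1 on the sphere and make every term homogeneous of
  degree p in y. The pole x is meant to be a unit vector and is not homogenised.\<close>

definition zonal :: "nat \<Rightarrow> real ^ 'n \<Rightarrow> real ^ 'n \<Rightarrow> real" where
  "zonal p x y = (\<Sum>k\<le>p div 2. gegenbauer_coeff (real CARD('n)) p k * ((x \<bullet> y) ^ (p - 2 * k) * (y \<bullet> y) ^ k))"

lemma zonal_sphere: "norm y = 1 \<Longrightarrow> zonal p x y = gegenbauer (real CARD('n)) p (x \<bullet> y)"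
  for x y :: "real ^ 'n"
  by (simp add: zonal_def gegenbauer_def norm_eq_1)

lemma pd_zonal_monomial:
  fixes x :: "real ^ 'n"
  shows "pd i (\<lambda>y. (x \<bullet> y) ^ m * (y \<bullet> y) ^ k)
    = (\<lambda>y. m * (x $ i * ((x \<bullet> y) ^ (m - 1) * (y \<bullet> y) ^ k)) + 2 * k * (y $ i * ((x \<bullet> y) ^ m * (y \<bullet> y) ^ (k - 1))))"
proof -
  have "((\<lambda>y. (x \<bullet> y) ^ m * (y \<bullet> y) ^ k) has_derivative
     (\<lambda>h. ((m * (x \<bullet> y) ^ (m - 1) * (y \<bullet> y) ^ k) *\<^sub>R x + (2 * k * (x \<bullet> y) ^ m * (y \<bullet> y) ^ (k - 1)) *\<^sub>R y) \<bullet> h)) (at y)" for y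
    by (rule derivative_eq_intros refl)+
       (simp add: fun_eq_iff inner_add_left inner_commute algebra_simps)
  from pd_eqI[OF this] show ?thesis
    by (simp add: fun_eq_iff mult_ac)
qed

lemma polynomial_zonal_monomial:
  "real_polynomial_function (\<lambda>y :: real ^ 'n. (x \<bullet> y) ^ m * (y \<bullet> y) ^ k)"
proof -
  have l: "real_polynomial_function (\<lambda>y :: real ^ 'n. v \<bullet> y)" for v
    by (intro real_polynomial_function.intros bounded_linear_inner_right)
  have "real_polynomial_function (\<lambda>y :: real ^ 'n. \<Sum>i\<in>UNIV. (axis i 1 \<bullet> y) * (axis i 1 \<bullet> y))"
    by (intro real_polynomial_function_sum real_polynomial_function.intros(4) l finite)
  moreover have "(\<Sum>i\<in>UNIV. (axis i 1 \<bullet> y) * (axis i 1 \<bullet> y)) = y \<bullet> y" for y :: "real ^ 'n"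
    by (simp add: inner_axis' inner_vec_def[of y y])
  ultimately have "real_polynomial_function (\<lambda>y :: real ^ 'n. y \<bullet> y)" by simp
  with l show ?thesis
    by (intro real_polynomial_function.intros(4) real_polynomial_function_power)
qed

lemma sum_inner_quadratic:
  fixes x y :: "real ^ 'n"
  shows "(\<Sum>i\<in>UNIV. a * (x $ i * x $ i) + b * (x $ i * y $ i) + c + e * (y $ i * y $ i))
    = a * (x \<bullet> x) + b * (x \<bullet> y) + real CARD('n) * c + e * (y \<bullet> y)"
  by (simp add: sum.distrib sum_distrib_left[symmetric] inner_vec_def)

lemma laplacian_zonal_monomial:
  fixes x :: "real ^ 'n"
  assumes x: "norm x = 1"
  shows "(\<Sum>i\<in>UNIV. pd i (pd i (\<lambda>y. (x \<bullet> y) ^ m * (y \<bullet> y) ^ k)) y)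
    = real m * (real m - 1) * ((x \<bullet> y) ^ (m - 2) * (y \<bullet> y) ^ k)
    + 2 * k * (2 * real k - 2 + real CARD('n) + 2 * m) * ((x \<bullet> y) ^ m * (y \<bullet> y) ^ (k - 1))"
proof -
  have xx: "x \<bullet> x = 1" using x by (simp add: norm_eq_1)
  have yi: "pd i (\<lambda>y. y $ i) = (\<lambda>y. 1)" "real_polynomial_function (\<lambda>y :: real ^ 'n. y $ i)" for i :: 'n
    by (simp_all add: pd_linear[OF bounded_linear_vec_nth] bounded_linear_vec_nth real_polynomial_function.intros)
  let ?f = "\<lambda>m k y. (x \<bullet> y) ^ m * (y \<bullet> y) ^ k"
  note poly = polynomial_zonal_monomial[of x]
  \<comment> \<open>Truncated subtraction is harmless because the factor m or k vanishes wherever it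
    truncates.\<close>
  have mk: "real m * real (m - 1) = real m * (real m - 1)" "real k * real (k - 1) = real k * (real k - 1)"
    by (cases m; simp) (cases k; simp)
  have gen: "real m * (xi * (real (m - 1) * (xi * A) + 2 * real k * (yi * B)))
      + 2 * real k * (yi * (real m * (xi * B) + 2 * real (k - 1) * (yi * C)) + D)
      = real m * (real m - 1) * A * (xi * xi) + 4 * real m * real k * B * (xi * yi) + 2 * real k * D
      + 4 * (real k * (real k - 1)) * C * (yi * yi)" for xi yi A B C D :: real
    using mk by algebra
  have "pd i (pd i (?f m k)) y = real m * (real m - 1) * ?f (m - 2) k y * (x $ i * x $ i)
     + 4 * real m * real k * ?f (m - 1) (k - 1) y * (x $ i * y $ i) + 2 * k * ?f m (k - 1) y
     + 4 * (real k * (real k - 1)) * ?f m (k - 2) y * (y $ i * y $ i)" for i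
  proof -
    have "pd i (pd i (?f m k)) y = m * (x $ i * pd i (?f (m - 1) k) y)
       + 2 * k * (y $ i * pd i (?f m (k - 1)) y + ?f m (k - 1) y)"
      unfolding pd_zonal_monomial[of i x m k]
      by (simp add: pd_add pd_cmult pd_mult poly yi real_polynomial_function.intros)
    also have "\<dots> = real m * (real m - 1) * ?f (m - 2) k y * (x $ i * x $ i)
     + 4 * real m * real k * ?f (m - 1) (k - 1) y * (x $ i * y $ i) + 2 * k * ?f m (k - 1) y
     + 4 * (real k * (real k - 1)) * ?f m (k - 2) y * (y $ i * y $ i)"
      unfolding pd_zonal_monomial of_nat_mult of_nat_numeral diff_diff_left one_add_one
      by (rule gen)
    finally show ?thesis .
  qed
  then have "(\<Sum>i\<in>UNIV. pd i (pd i (?f m k)) y) = (\<Sum>i\<in>UNIV. real m * (real m - 1) * ?f (m - 2) k y * (x $ i * x $ i)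
     + 4 * real m * real k * ?f (m - 1) (k - 1) y * (x $ i * y $ i) + 2 * k * ?f m (k - 1) y
     + 4 * (real k * (real k - 1)) * ?f m (k - 2) y * (y $ i * y $ i))" by (rule sum.cong[OF refl])
  also have "\<dots> = real m * (real m - 1) * ?f (m - 2) k y * (x \<bullet> x)
     + 4 * real m * real k * ?f (m - 1) (k - 1) y * (x \<bullet> y) + real CARD('n) * (2 * k * ?f m (k - 1) y)
     + 4 * (real k * (real k - 1)) * ?f m (k - 2) y * (y \<bullet> y)"
    by (rule sum_inner_quadratic)
  also have "4 * (real k * (real k - 1)) * ?f m (k - 2) y * (y \<bullet> y) = 4 * (real k * (real k - 1)) * ?f m (k - 1) y"
    by (cases k; cases "k - 1") auto
  also have "4 * real m * real k * ?f (m - 1) (k - 1) y * (x \<bullet> y) = 4 * real m * real k * ?f m (k - 1) y"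
    by (cases m) auto
  finally have lap: "(\<Sum>i\<in>UNIV. pd i (pd i (?f m k)) y) = real m * (real m - 1) * ?f (m - 2) k y * (x \<bullet> x)
     + 4 * real m * real k * ?f m (k - 1) y + real CARD('n) * (2 * k * ?f m (k - 1) y)
     + 4 * (real k * (real k - 1)) * ?f m (k - 1) y" .
  have fin: "A * 1 + 4 * M * K * F + N * (2 * K * F) + 4 * (K * (K - 1)) * F = A + 2 * K * (2 * K - 2 + N + 2 * M) * F"
    for A M K F N :: real by algebra
  show ?thesis
    unfolding lap xx of_nat_mult of_nat_numeral by (rule fin)
qed

lemma solid_harmonic_zonal:
  fixes x :: "real ^ 'n"
  assumes x: "norm x = 1"
  shows "solid_harmonic p (zonal p x)"
proof -
  let ?n = "real CARD('n)"
  let ?f = "\<lambda>k y. (x \<bullet> y) ^ (p - 2 * k) * (y \<bullet> y) ^ k"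
  note poly = polynomial_zonal_monomial[of x]
  have z: "zonal p x = (\<lambda>y. \<Sum>k\<in>{..p div 2}. gegenbauer_coeff ?n p k * ?f k y)"
    by (simp add: zonal_def fun_eq_iff)
  have pz: "real_polynomial_function (zonal p x)"
    unfolding z by (intro real_polynomial_function_sum real_polynomial_function.intros(2,4) poly finite_atMost)
  have "zonal p x (c *\<^sub>R y) = c ^ p * zonal p x y" if "c > 0" for c y
  proof -
    have "?f k (c *\<^sub>R y) = c ^ p * ?f k y" if "k \<le> p div 2" for k
    proof -
      have p: "p = (p - 2 * k) + 2 * k" using that by linarith
      have "?f k (c *\<^sub>R y) = c ^ (p - 2 * k) * (c * c) ^ k * ?f k y"
        by (simp add: power_mult_distrib mult_ac)
      also have "c ^ (p - 2 * k) * (c * c) ^ k = c ^ p"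
        by (metis p power_add power_mult power2_eq_square)
      finally show ?thesis .
    qed
    then have "(\<Sum>k\<le>p div 2. gegenbauer_coeff ?n p k * ?f k (c *\<^sub>R y))
        = (\<Sum>k\<le>p div 2. c ^ p * (gegenbauer_coeff ?n p k * ?f k y))"
      by (intro sum.cong refl) (simp only: atMost_iff mult.left_commute)
    then show ?thesis unfolding zonal_def sum_distrib_left .
  qed
  moreover have "(\<Sum>i\<in>UNIV. pd i (pd i (zonal p x)) y) = 0" for y
  proof -
    have 1: "pd i (pd i (zonal p x)) y = (\<Sum>k\<le>p div 2. gegenbauer_coeff ?n p k * pd i (pd i (?f k)) y)" for i
      unfolding z
      by (simp add: pd_sum pd_cmult poly real_polynomial_function_pd real_polynomial_function.intros(2,4))
    have "(\<Sum>i\<in>UNIV. pd i (pd i (zonal p x)) y)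
        = (\<Sum>k\<le>p div 2. gegenbauer_coeff ?n p k * (\<Sum>i\<in>UNIV. pd i (pd i (?f k)) y))"
      unfolding 1 sum_distrib_left by (rule sum.swap)
    also have "\<dots> = (\<Sum>k\<le>p div 2.
        gegenbauer_coeff ?n p k * ((real p - 2 * k) * (real p - 2 * k - 1)) * ((x \<bullet> y) ^ (p - 2 * k - 2) * (y \<bullet> y) ^ k)
        + gegenbauer_coeff ?n p k * (2 * real k * (2 * real p - 2 * real k + ?n - 2)) * ((x \<bullet> y) ^ (p - 2 * k) * (y \<bullet> y) ^ (k - 1)))"
    proof (rule sum.cong[OF refl])
      fix k assume "k \<in> {..p div 2}"
      then have r: "real (p - 2 * k) = real p - 2 * real k" by (simp add: of_nat_diff)
      show "gegenbauer_coeff ?n p k * (\<Sum>i\<in>UNIV. pd i (pd i (?f k)) y)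
        = gegenbauer_coeff ?n p k * ((real p - 2 * k) * (real p - 2 * k - 1)) * ((x \<bullet> y) ^ (p - 2 * k - 2) * (y \<bullet> y) ^ k)
        + gegenbauer_coeff ?n p k * (2 * real k * (2 * real p - 2 * real k + ?n - 2)) * ((x \<bullet> y) ^ (p - 2 * k) * (y \<bullet> y) ^ (k - 1))"
        unfolding laplacian_zonal_monomial[OF x] r of_nat_mult of_nat_numeral by algebra
    qed
    also have "\<dots> = 0"
      by (rule gegenbauer_telescope) (simp_all add: algebra_simps)
    finally show ?thesis .
  qed
  ultimately show ?thesis using pz by (auto simp: solid_harmonic_def)
qed

text \<open>All powers of x \<bullet> y below the p-th integrate to zero against H; only the leading
  term, with coefficient 1, contributes.\<close>

lemma zonal_reproducing:
  fixes H :: "real ^ 'n \<Rightarrow> real"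
  assumes H: "solid_harmonic p H" and x: "norm x = 1" and n: "CARD('n) \<ge> 2"
  shows "(LINT y|sphere_measure. zonal p x y * H y)
    = moment_const (measure (sphere_measure :: (real ^ 'n) measure) (sphere 0 1)) (real CARD('n) - 1) p * H x"
proof -
  have poly: "real_polynomial_function H" using H by (rule solid_harmonicD)
  let ?n = "real CARD('n)"
  have "(LINT y|sphere_measure. zonal p x y * H y)
      = (LINT y|sphere_measure. (\<Sum>k\<le>p div 2. gegenbauer_coeff ?n p k * ((x \<bullet> y) ^ (p - 2 * k) * H y)))"
    by (intro Bochner_Integration.integral_cong refl)
       (simp add: zonal_sphere gegenbauer_def sum_distrib_right mult.assoc)
  also have "\<dots> = (\<Sum>k\<le>p div 2. gegenbauer_coeff ?n p k * (LINT y|sphere_measure. (x \<bullet> y) ^ (p - 2 * k) * H y))"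
    by (subst Bochner_Integration.integral_sum)
       (auto intro!: integrable_sphere continuous_intros continuous_on_real_polynomial_function[OF poly])
  also have "\<dots> = (\<Sum>k\<in>{0}. gegenbauer_coeff ?n p k * (LINT y|sphere_measure. (x \<bullet> y) ^ (p - 2 * k) * H y))"
  proof (rule sum.mono_neutral_right)
    show "\<forall>k\<in>{..p div 2} - {0}. gegenbauer_coeff ?n p k * (LINT y|sphere_measure. (x \<bullet> y) ^ (p - 2 * k) * H y) = 0"
    proof
      fix k assume "k \<in> {..p div 2} - {0}"
      then have "p - 2 * k < p" by auto
      then show "gegenbauer_coeff ?n p k * (LINT y|sphere_measure. (x \<bullet> y) ^ (p - 2 * k) * H y) = 0"
        using moment_solid_harmonic(1)[OF H x n] by simp
    qed
  qed auto
  finally show ?thesis using moment_solid_harmonic(2)[OF H x n refl] by simp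
qed

section \<open>Decay of Gegenbauer polynomials\<close>

definition gegenbauer_deriv :: "real \<Rightarrow> nat \<Rightarrow> real \<Rightarrow> real" where
  "gegenbauer_deriv n p t = (\<Sum>k\<le>p div 2. gegenbauer_coeff n p k * (real (p - 2 * k) * t ^ (p - 2 * k - 1)))"

definition gegenbauer_deriv2 :: "real \<Rightarrow> nat \<Rightarrow> real \<Rightarrow> real" where
  "gegenbauer_deriv2 n p t = (\<Sum>k\<le>p div 2. gegenbauer_coeff n p k *
     (real (p - 2 * k) * (real (p - 2 * k - 1) * t ^ (p - 2 * k - 2))))"

lemma has_derivative_gegenbauer:
  "(gegenbauer n p has_real_derivative gegenbauer_deriv n p t) (at t)"
proof -
  have "((\<lambda>t. \<Sum>k\<le>p div 2. gegenbauer_coeff n p k * t ^ (p - 2 * k)) has_real_derivative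
     (\<Sum>k\<le>p div 2. gegenbauer_coeff n p k * (real (p - 2 * k) * t ^ (p - 2 * k - 1)))) (at t)"
    by (intro DERIV_sum DERIV_cmult DERIV_pow[unfolded One_nat_def[symmetric]])
  then show ?thesis by (simp only: gegenbauer_def[abs_def] gegenbauer_deriv_def)
qed

lemma has_derivative_gegenbauer_deriv:
  "(gegenbauer_deriv n p has_real_derivative gegenbauer_deriv2 n p t) (at t)"
proof -
  have "((\<lambda>t. t ^ (m - 1)) has_real_derivative (real (m - 1) * t ^ (m - 2))) (at t)" for m
    using DERIV_pow[of "m - 1" t] by (simp add: numeral_2_eq_2)
  then have "((\<lambda>t. \<Sum>k\<le>p div 2. gegenbauer_coeff n p k * (real (p - 2 * k) * t ^ (p - 2 * k - 1))) has_real_derivative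
     (\<Sum>k\<le>p div 2. gegenbauer_coeff n p k * (real (p - 2 * k) * (real (p - 2 * k - 1) * t ^ (p - 2 * k - 2))))) (at t)"
    by (intro DERIV_sum DERIV_cmult)
  then show ?thesis by (simp only: gegenbauer_deriv_def[abs_def] gegenbauer_deriv2_def)
qed

lemma gegenbauer_ode:
  assumes "n > 0"
  shows "(1 - t\<^sup>2) * gegenbauer_deriv2 n p t - (n - 1) * t * gegenbauer_deriv n p t
     + p * (p + n - 2) * gegenbauer n p t = 0"
proof -
  have "(1 - t\<^sup>2) * gegenbauer_deriv2 n p t - (n - 1) * t * gegenbauer_deriv n p t
     + p * (p + n - 2) * gegenbauer n p t
    = (\<Sum>k\<le>p div 2. gegenbauer_coeff n p k * ((real p - 2 * k) * (real p - 2 * k - 1)) * t ^ (p - 2 * k - 2)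
     + gegenbauer_coeff n p k * (2 * real k * (2 * real p - 2 * real k + n - 2)) * t ^ (p - 2 * k))"
    unfolding gegenbauer_def gegenbauer_deriv_def gegenbauer_deriv2_def sum_distrib_left
      sum_subtractf[symmetric] sum.distrib[symmetric]
  proof (rule sum.cong[OF refl])
    fix k assume k: "k \<in> {..p div 2}"
    define m where "m = p - 2 * k"
    have m: "real m = real p - 2 * real k" using k by (simp add: m_def of_nat_diff)
    have t1: "real m * (t * t ^ (m - 1)) = real m * t ^ m" by (cases m) auto
    have m1: "real m * real (m - 1) = real m * (real m - 1)" by (cases m) auto
    have t2: "real m * (real m - 1) * (t\<^sup>2 * t ^ (m - 2)) = real m * (real m - 1) * t ^ m"
    proof (cases "m \<le> 1")
      case True
      then have "m = 0 \<or> m = 1" by auto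
      then show ?thesis by auto
    next
      case False
      then have "m = 2 + (m - 2)" by simp
      then have "t ^ m = t\<^sup>2 * t ^ (m - 2)" by (metis power_add)
      then show ?thesis by simp
    qed
    define A B C c where "A = t ^ (m - 2)" and "B = t ^ (m - 1)" and "C = t ^ m" and "c = gegenbauer_coeff n p k"
    have "(1 - t\<^sup>2) * (c * (real m * (real (m - 1) * A))) - (n - 1) * t * (c * (real m * B)) + p * (p + n - 2) * (c * C)
        = c * ((real p - 2 * k) * (real p - 2 * k - 1)) * A + c * (2 * real k * (2 * real p - 2 * real k + n - 2)) * C"
      using t1 t2 m1 unfolding A_def[symmetric] B_def[symmetric] C_def[symmetric] m of_nat_mult of_nat_numeral by algebra
    then show "(1 - t\<^sup>2) * (gegenbauer_coeff n p k * (real (p - 2 * k) * (real (p - 2 * k - 1) * t ^ (p - 2 * k - 2))))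
        - (n - 1) * t * (gegenbauer_coeff n p k * (real (p - 2 * k) * t ^ (p - 2 * k - 1)))
        + p * (p + n - 2) * (gegenbauer_coeff n p k * t ^ (p - 2 * k))
      = gegenbauer_coeff n p k * ((real p - 2 * k) * (real p - 2 * k - 1)) * t ^ (p - 2 * k - 2)
        + gegenbauer_coeff n p k * (2 * real k * (2 * real p - 2 * real k + n - 2)) * t ^ (p - 2 * k)"
      unfolding A_def B_def C_def c_def m_def .
  qed
  also have "\<dots> = 0"
    by (rule gegenbauer_telescope[OF assms]) simp
  finally show ?thesis .
qed

lemma abs_gegenbauer_minus: "\<bar>gegenbauer n p (- t)\<bar> = \<bar>gegenbauer n p t\<bar>"
proof -
  have "(- t) ^ (p - 2 * k) = (- 1) ^ p * t ^ (p - 2 * k)" if "k \<le> p div 2" for k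
  proof -
    have "p = (p - 2 * k) + 2 * k" using that by linarith
    then have "(- 1 :: real) ^ p = (- 1) ^ (p - 2 * k)"
      by (metis mult.right_neutral power_add power_minus1_even)
    then show ?thesis by (simp only: power_minus[of t])
  qed
  then have "gegenbauer n p (- t) = (- 1) ^ p * gegenbauer n p t"
    unfolding gegenbauer_def sum_distrib_left by (intro sum.cong refl) (simp add: mult_ac)
  then show ?thesis by (simp add: abs_mult)
qed

section \<open>Energies for the Gegenbauer equation\<close>

context
  fixes n :: real and p N :: nat
  assumes N: "n = real N + 2" "N \<ge> 1" and p: "p \<ge> 1"
begin

private abbreviation (input) "G \<equiv> gegenbauer n p"
private abbreviation (input) "G' \<equiv> gegenbauer_deriv n p"
private abbreviation (input) "G'' \<equiv> gegenbauer_deriv2 n p"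
private definition "eigenvalue = real p * (real p + n - 2)"
private definition "\<nu> = real N / 2"
private definition "\<kappa> = real p + \<nu>"

private lemma ode: "(1 - t\<^sup>2) * G'' t = (n - 1) * t * G' t - eigenvalue * G t"
  unfolding eigenvalue_def using gegenbauer_ode[of n t p] N by (simp add: algebra_simps)

private lemma eigenvalue_pos: "eigenvalue > 0"
  unfolding eigenvalue_def using p N by (auto intro!: mult_pos_pos)

private lemma kappa: "\<kappa>\<^sup>2 = eigenvalue + \<nu>\<^sup>2" "real p \<le> \<kappa>" "0 < \<kappa>" "0 \<le> \<nu>"
  unfolding \<kappa>_def \<nu>_def eigenvalue_def using p N by (auto simp: power2_eq_square field_simps)

text \<open>Sonin's argument: by the differential equation the derivative of the left-hand side is 2
  (n - 2) t G'^2, nonnegative for t \<ge> 0, and at t = 1 the G' term drops out.\<close>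

lemma gegenbauer_energy:
  assumes t: "t \<in> {0..1}"
  shows "(1 - t\<^sup>2) * (G' t)\<^sup>2 + eigenvalue * (G t)\<^sup>2 \<le> eigenvalue * (G 1)\<^sup>2"
proof -
  let ?E = "\<lambda>t. (1 - t\<^sup>2) * (G' t)\<^sup>2 + eigenvalue * (G t)\<^sup>2"
  have "?E t \<le> ?E 1"
  proof (rule DERIV_nonneg_imp_nondecreasing[where f = ?E])
    show "t \<le> 1" using t by simp
    fix x assume x: "t \<le> x" "x \<le> 1"
    have "(?E has_real_derivative - (2 * x) * (G' x)\<^sup>2 + 2 * G' x * ((1 - x\<^sup>2) * G'' x) + 2 * eigenvalue * G x * G' x) (at x)"
      by (auto intro!: derivative_eq_intros has_derivative_gegenbauer has_derivative_gegenbauer_deriv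
          simp: algebra_simps power2_eq_square)
    moreover have "- (2 * x) * (G' x)\<^sup>2 + 2 * G' x * ((1 - x\<^sup>2) * G'' x) + 2 * eigenvalue * G x * G' x = 2 * (n - 2) * x * (G' x)\<^sup>2"
      unfolding ode by algebra
    moreover have "0 \<le> 2 * (n - 2) * x * (G' x)\<^sup>2" using N x t by auto
    ultimately show "\<exists>y. (?E has_real_derivative y) (at x) \<and> 0 \<le> y" by auto
  qed
  then show ?thesis by simp
qed

lemma abs_gegenbauer_le_1:
  assumes t: "t \<in> {-1..1}"
  shows "\<bar>G t\<bar> \<le> \<bar>G 1\<bar>"
proof -
  have *: "\<bar>G t\<bar> \<le> \<bar>G 1\<bar>" if t: "t \<in> {0..1}" for t
  proof -
    have "0 \<le> (1 - t\<^sup>2) * (G' t)\<^sup>2" using t by (auto simp: power_le_one)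
    then have "eigenvalue * (G t)\<^sup>2 \<le> eigenvalue * (G 1)\<^sup>2" using gegenbauer_energy[OF t] by linarith
    then have "(G t)\<^sup>2 \<le> (G 1)\<^sup>2" using eigenvalue_pos by simp
    then show ?thesis by (simp add: abs_le_square_iff)
  qed
  show ?thesis
  proof (cases "0 \<le> t")
    case True
    then show ?thesis using *[of t] t by auto
  next
    case False
    then show ?thesis using *[of "- t"] t abs_gegenbauer_minus[of n p t] by auto
  qed
qed

text \<open>With \<open>u = sin\<^sup>\<nu> g\<close> the energy below is \<open>u'\<^sup>2 + \<kappa>\<^sup>2 u\<^sup>2\<close>, where \<open>u'' + (\<kappa>\<^sup>2 + (\<nu> - \<nu>\<^sup>2) / sin\<^sup>2) u = 0\<close>;
  its logarithmic derivative is at most \<open>A / sin\<^sup>2\<close>, the derivative of \<open>- A cot\<close>.\<close>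

private definition "g \<theta> = G (cos \<theta>)"
private definition "g' \<theta> = - sin \<theta> * G' (cos \<theta>)"
text \<open>The derivative of sin^\<nu> g is sin^\<nu> v. Since 2 \<nu> = N, the energy carries the
  integer power N of the sine.\<close>

private definition "v \<theta> = \<nu> * (cos \<theta> / sin \<theta>) * g \<theta> + g' \<theta>"
private definition "E \<theta> = sin \<theta> ^ N * ((v \<theta>)\<^sup>2 + \<kappa>\<^sup>2 * (g \<theta>)\<^sup>2)"
private definition "A = \<bar>\<nu>\<^sup>2 - \<nu>\<bar> / \<kappa>"

private lemma deriv_g: "(g has_real_derivative g' \<theta>) (at \<theta>)"
  unfolding g_def[abs_def] g'_def
  using DERIV_chain2[OF has_derivative_gegenbauer DERIV_cos, of n p \<theta>] by (simp add: mult.commute)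

private lemma deriv_g':
  assumes "sin \<theta> > 0"
  shows "(g' has_real_derivative - 2 * \<nu> * (cos \<theta> / sin \<theta>) * g' \<theta> - eigenvalue * g \<theta>) (at \<theta>)"
proof -
  have "((\<lambda>\<theta>. G' (cos \<theta>)) has_real_derivative G'' (cos \<theta>) * - sin \<theta>) (at \<theta>)"
    by (rule DERIV_chain2[OF has_derivative_gegenbauer_deriv DERIV_cos])
  then have "(g' has_real_derivative - cos \<theta> * G' (cos \<theta>) + (sin \<theta>)\<^sup>2 * G'' (cos \<theta>)) (at \<theta>)"
    unfolding g'_def[abs_def] by (auto intro!: derivative_eq_intros simp: power2_eq_square)
  then have "(g' has_real_derivative - cos \<theta> * G' (cos \<theta>) + (1 - (cos \<theta>)\<^sup>2) * G'' (cos \<theta>)) (at \<theta>)"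
    by (simp only: sin_squared_eq)
  moreover have "- cos \<theta> * G' (cos \<theta>) + (1 - (cos \<theta>)\<^sup>2) * G'' (cos \<theta>)
      = - 2 * \<nu> * (cos \<theta> / sin \<theta>) * g' \<theta> - eigenvalue * g \<theta>"
  proof -
    have n: "n - 1 = 2 * \<nu> + 1" by (simp add: \<nu>_def N(1))
    show ?thesis unfolding ode n g_def g'_def using assms by (simp add: field_simps)
  qed
  ultimately show ?thesis by simp
qed

private lemma deriv_cot:
  assumes "sin \<theta> > 0"
  shows "((\<lambda>\<theta>. cos \<theta> / sin \<theta>) has_real_derivative - (1 / (sin \<theta>)\<^sup>2)) (at \<theta>)"
proof -
  have "((\<lambda>\<theta>. cos \<theta> / sin \<theta>) has_real_derivative ((- sin \<theta>) * sin \<theta> - cos \<theta> * cos \<theta>) / (sin \<theta> * sin \<theta>)) (at \<theta>)"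
    using assms by (intro DERIV_divide DERIV_cos DERIV_sin) auto
  moreover have "(- sin \<theta>) * sin \<theta> - cos \<theta> * cos \<theta> = -1"
    using sin_cos_squared_add[of \<theta>] by (simp add: power2_eq_square)
  ultimately show ?thesis by (simp add: power2_eq_square)
qed

text \<open>The value \<kappa>^2 = eigenvalue + \<nu>^2 is the one for which everything cancels
  except the potential (\<nu>^2 - \<nu>) / sin^2, the departure from a harmonic oscillator.\<close>

private lemma deriv_E:
  assumes s: "sin \<theta> > 0"
  shows "(E has_real_derivative sin \<theta> ^ N * (2 * v \<theta> * g \<theta> * ((\<nu>\<^sup>2 - \<nu>) / (sin \<theta>)\<^sup>2))) (at \<theta>)"
proof -
  define r where "r = cos \<theta> / sin \<theta>"
  define w where "w = 1 / (sin \<theta>)\<^sup>2"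
  have wr: "w = 1 + r\<^sup>2"
    using s sin_cos_squared_add[of \<theta>] by (simp add: w_def r_def field_simps)
  have sN: "((\<lambda>\<theta>. sin \<theta> ^ N) has_real_derivative 2 * \<nu> * r * sin \<theta> ^ N) (at \<theta>)"
  proof -
    have "real N * (sin \<theta> ^ (N - 1) * cos \<theta>) = 2 * \<nu> * r * sin \<theta> ^ N"
      unfolding \<nu>_def r_def using s N(2) by (cases N) auto
    then show ?thesis using DERIV_fun_pow[OF DERIV_sin[of \<theta>], of N] by (simp add: mult.assoc)
  qed
  have dv: "(v has_real_derivative \<nu> * (- w) * g \<theta> + \<nu> * r * g' \<theta> + (- 2 * \<nu> * r * g' \<theta> - eigenvalue * g \<theta>)) (at \<theta>)"
  proof -
    have "((\<lambda>\<theta>. \<nu> * (cos \<theta> / sin \<theta>) * g \<theta> + g' \<theta>) has_real_derivative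
        (\<nu> * - (1 / (sin \<theta>)\<^sup>2)) * g \<theta> + g' \<theta> * (\<nu> * (cos \<theta> / sin \<theta>))
        + (- 2 * \<nu> * (cos \<theta> / sin \<theta>) * g' \<theta> - eigenvalue * g \<theta>)) (at \<theta>)"
      by (intro DERIV_add DERIV_mult DERIV_cmult deriv_cot[OF s] deriv_g deriv_g'[OF s])
    then show ?thesis
      unfolding v_def[abs_def] r_def w_def by (simp only: mult.commute[of "g' \<theta>"])
  qed
  have "(E has_real_derivative 2 * \<nu> * r * sin \<theta> ^ N * ((v \<theta>)\<^sup>2 + \<kappa>\<^sup>2 * (g \<theta>)\<^sup>2)
     + (2 * v \<theta> * (\<nu> * (- w) * g \<theta> + \<nu> * r * g' \<theta> + (- 2 * \<nu> * r * g' \<theta> - eigenvalue * g \<theta>)) + \<kappa>\<^sup>2 * (2 * g \<theta> * g' \<theta>)) * sin \<theta> ^ N) (at \<theta>)"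
    unfolding E_def[abs_def]
    by (rule derivative_eq_intros sN dv deriv_g refl)+ (simp add: algebra_simps)
  moreover have "2 * \<nu> * r * sin \<theta> ^ N * ((v \<theta>)\<^sup>2 + \<kappa>\<^sup>2 * (g \<theta>)\<^sup>2)
     + (2 * v \<theta> * (\<nu> * (- w) * g \<theta> + \<nu> * r * g' \<theta> + (- 2 * \<nu> * r * g' \<theta> - eigenvalue * g \<theta>)) + \<kappa>\<^sup>2 * (2 * g \<theta> * g' \<theta>)) * sin \<theta> ^ N
     = sin \<theta> ^ N * (2 * v \<theta> * g \<theta> * ((\<nu>\<^sup>2 - \<nu>) * w))"
  proof -
    have vr: "v \<theta> = \<nu> * r * g \<theta> + g' \<theta>" by (simp add: v_def r_def)
    define S where "S = sin \<theta> ^ N"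
    show ?thesis
      unfolding S_def[symmetric] using vr wr kappa(1) by algebra
  qed
  ultimately show ?thesis by (simp add: w_def)
qed

text \<open>Gronwall's argument: 2 |v g| \<le> (v^2 + \<kappa>^2 g^2) / \<kappa> gives E' \<le> A E
  / sin^2, and the exponential of A cot compensates exactly this growth.\<close>

private lemma E_decay:
  assumes "0 < a" "a \<le> b" "b < pi"
  shows "E b * exp (A * (cos b / sin b)) \<le> E a * exp (A * (cos a / sin a))"
proof (rule DERIV_nonpos_imp_nonincreasing[where f = "\<lambda>\<theta>. E \<theta> * exp (A * (cos \<theta> / sin \<theta>))", OF assms(2)])
  fix \<theta> assume "a \<le> \<theta>" "\<theta> \<le> b"
  then have s: "sin \<theta> > 0" using assms by (intro sin_gt_zero) auto
  have D: "((\<lambda>\<theta>. E \<theta> * exp (A * (cos \<theta> / sin \<theta>))) has_real_derivative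
     (sin \<theta> ^ N * (2 * v \<theta> * g \<theta> * ((\<nu>\<^sup>2 - \<nu>) / (sin \<theta>)\<^sup>2)) - E \<theta> * A * (1 / (sin \<theta>)\<^sup>2)) * exp (A * (cos \<theta> / sin \<theta>))) (at \<theta>)"
    by (rule derivative_eq_intros deriv_E[OF s] deriv_cot[OF s] refl)+ (simp add: algebra_simps)
  have "2 * v \<theta> * g \<theta> * (\<nu>\<^sup>2 - \<nu>) \<le> \<bar>2 * v \<theta> * g \<theta>\<bar> * \<bar>\<nu>\<^sup>2 - \<nu>\<bar>"
    by (metis abs_ge_self abs_mult)
  also have "\<bar>2 * v \<theta> * g \<theta>\<bar> \<le> ((v \<theta>)\<^sup>2 + \<kappa>\<^sup>2 * (g \<theta>)\<^sup>2) / \<kappa>"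
  proof -
    have "0 \<le> (\<bar>v \<theta>\<bar> - \<kappa> * \<bar>g \<theta>\<bar>)\<^sup>2" by simp
    then have "\<bar>2 * v \<theta> * g \<theta>\<bar> * \<kappa> \<le> (v \<theta>)\<^sup>2 + \<kappa>\<^sup>2 * (g \<theta>)\<^sup>2"
      by (simp add: power2_diff power_mult_distrib abs_mult mult_ac)
    then show ?thesis using kappa(3) by (simp add: pos_le_divide_eq)
  qed
  finally have "2 * v \<theta> * g \<theta> * (\<nu>\<^sup>2 - \<nu>) \<le> ((v \<theta>)\<^sup>2 + \<kappa>\<^sup>2 * (g \<theta>)\<^sup>2) * A"
    by (simp add: A_def mult_right_mono)
  then have "sin \<theta> ^ N * (2 * v \<theta> * g \<theta> * (\<nu>\<^sup>2 - \<nu>)) / (sin \<theta>)\<^sup>2 \<le> sin \<theta> ^ N * (((v \<theta>)\<^sup>2 + \<kappa>\<^sup>2 * (g \<theta>)\<^sup>2) * A) / (sin \<theta>)\<^sup>2"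
    using s by (intro divide_right_mono mult_left_mono) auto
  then have "sin \<theta> ^ N * (2 * v \<theta> * g \<theta> * ((\<nu>\<^sup>2 - \<nu>) / (sin \<theta>)\<^sup>2)) - E \<theta> * A * (1 / (sin \<theta>)\<^sup>2) \<le> 0"
    by (simp add: E_def mult_ac)
  then have "(sin \<theta> ^ N * (2 * v \<theta> * g \<theta> * ((\<nu>\<^sup>2 - \<nu>) / (sin \<theta>)\<^sup>2)) - E \<theta> * A * (1 / (sin \<theta>)\<^sup>2))
      * exp (A * (cos \<theta> / sin \<theta>)) \<le> 0"
    by (intro mult_nonpos_nonneg) auto
  then show "\<exists>y. ((\<lambda>\<theta>. E \<theta> * exp (A * (cos \<theta> / sin \<theta>))) has_real_derivative y) (at \<theta>) \<and> y \<le> 0"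
    using D by blast
qed

text \<open>The energy E is propagated from an angle \<theta>0 of size 1/p, where
  \<open>gegenbauer_energy\<close> bounds it by the value at the pole, out to \<theta>; negative t
  follow by parity. In the constant, 2 \<mu>^2 + 2 comes from v^2 and 1 from \<kappa>^2 g^2.\<close>

lemma gegenbauer_decay:
  assumes t: "t \<in> {-1..1}" and ps: "1 \<le> real p * sqrt (1 - t\<^sup>2)"
  defines "\<mu> \<equiv> real N / 2"
  shows "(G t)\<^sup>2 * (real p * sqrt (1 - t\<^sup>2)) ^ N \<le> exp \<bar>\<mu>\<^sup>2 - \<mu>\<bar> * (2 * \<mu>\<^sup>2 + 3) * (G 1)\<^sup>2"
proof -
  have main: "(G t)\<^sup>2 * (real p * sqrt (1 - t\<^sup>2)) ^ N \<le> exp \<bar>\<nu>\<^sup>2 - \<nu>\<bar> * (2 * \<nu>\<^sup>2 + 3) * (G 1)\<^sup>2"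
    if t: "t \<in> {0..1}" and ps: "1 \<le> real p * sqrt (1 - t\<^sup>2)" for t
  proof -
    define \<theta> where "\<theta> = arccos t"
    \<comment> \<open>This choice gives cot \<theta>0 = p, so that the Gronwall factor exp (A p)
      stays below exp |\<nu>^2 - \<nu>| for every p.\<close>
    define \<theta>0 where "\<theta>0 = arctan (1 / real p)"
    have th: "cos \<theta> = t" "sin \<theta> = sqrt (1 - t\<^sup>2)" "0 \<le> \<theta>" "\<theta> \<le> pi / 2"
      using t arccos_le_pi2[of t] arccos_lbound[of t] by (simp_all add: \<theta>_def cos_arccos sin_arccos)
    have th0: "0 < \<theta>0" "\<theta>0 < pi / 2" "tan \<theta>0 = 1 / real p"
      using p arctan_ubound[of "1 / real p"] by (simp_all add: \<theta>0_def tan_arctan)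
    have s0: "sin \<theta>0 > 0" "cos \<theta>0 > 0" using th0 by (auto intro!: sin_gt_zero cos_gt_zero)
    have cot0: "cos \<theta>0 / sin \<theta>0 = real p"
      using th0(3) s0 p by (simp add: tan_def field_simps)
    have sp0: "real p * sin \<theta>0 \<le> 1"
    proof -
      have "real p * sin \<theta>0 = cos \<theta>0" using cot0 s0 by (simp add: field_simps)
      then show ?thesis by simp
    qed
    have "sin \<theta>0 < sin \<theta>"
    proof -
      have "real p * sin \<theta>0 < 1"
      proof -
        have "real p * sin \<theta>0 = cos \<theta>0" using cot0 s0 by (simp add: field_simps)
        moreover have "cos \<theta>0 < 1" using th0 cos_monotone_0_pi[of 0 \<theta>0] pi_gt_zero by simp
        ultimately show ?thesis by simp
      qed
      also have "1 \<le> real p * sin \<theta>" using ps th by simp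
      finally show ?thesis using p by simp
    qed
    then have le: "\<theta>0 \<le> \<theta>"
      using sin_monotone_2pi_le[of \<theta> \<theta>0] th th0 by (smt (verit) pi_gt_zero)
    have spos: "sin \<theta> > 0" using le th0 th by (intro sin_gt_zero) auto
    have cpos: "cos \<theta> / sin \<theta> \<ge> 0" using spos th t by auto
    have Apos: "A \<ge> 0" using kappa by (simp add: A_def)
    have E0: "E \<theta>0 \<le> sin \<theta>0 ^ N * ((2 * \<nu>\<^sup>2 + 3) * \<kappa>\<^sup>2 * (G 1)\<^sup>2)"
    proof -
      have c01: "cos \<theta>0 \<in> {0..1}" using s0 by auto
      have en: "(g' \<theta>0)\<^sup>2 + eigenvalue * (g \<theta>0)\<^sup>2 \<le> eigenvalue * (G 1)\<^sup>2"
        using gegenbauer_energy[OF c01] by (simp add: g_def g'_def power_mult_distrib sin_squared_eq)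
      have gG: "(g \<theta>0)\<^sup>2 \<le> (G 1)\<^sup>2"
        using abs_gegenbauer_le_1[of "cos \<theta>0"] c01 by (simp add: g_def abs_le_square_iff)
      have lk: "eigenvalue \<le> \<kappa>\<^sup>2" "(real p)\<^sup>2 \<le> \<kappa>\<^sup>2" using power_mono[OF kappa(2), of 2] by (simp_all add: kappa(1))
      have g'k: "(g' \<theta>0)\<^sup>2 \<le> \<kappa>\<^sup>2 * (G 1)\<^sup>2"
      proof -
        have "0 \<le> eigenvalue * (g \<theta>0)\<^sup>2" using eigenvalue_pos by simp
        then have "(g' \<theta>0)\<^sup>2 \<le> eigenvalue * (G 1)\<^sup>2" using en by linarith
        also have "\<dots> \<le> \<kappa>\<^sup>2 * (G 1)\<^sup>2" using lk by (intro mult_right_mono) auto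
        finally show ?thesis .
      qed
      have pg: "(real p * g \<theta>0)\<^sup>2 \<le> \<kappa>\<^sup>2 * (G 1)\<^sup>2"
        unfolding power_mult_distrib using lk gG by (intro mult_mono) auto
      have "(v \<theta>0)\<^sup>2 = (\<nu> * (real p * g \<theta>0) + g' \<theta>0)\<^sup>2" unfolding v_def cot0 by (simp add: mult_ac)
      also have "\<dots> \<le> 2 * \<nu>\<^sup>2 * (real p * g \<theta>0)\<^sup>2 + 2 * (g' \<theta>0)\<^sup>2"
      proof -
        have "0 \<le> (\<nu> * (real p * g \<theta>0) - g' \<theta>0)\<^sup>2" by simp
        then show ?thesis by (simp add: power2_eq_square algebra_simps)
      qed
      also have "\<dots> \<le> 2 * \<nu>\<^sup>2 * (\<kappa>\<^sup>2 * (G 1)\<^sup>2) + 2 * (\<kappa>\<^sup>2 * (G 1)\<^sup>2)"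
        using pg g'k by (intro add_mono mult_left_mono) auto
      finally have "(v \<theta>0)\<^sup>2 + \<kappa>\<^sup>2 * (g \<theta>0)\<^sup>2 \<le> (2 * \<nu>\<^sup>2 + 3) * \<kappa>\<^sup>2 * (G 1)\<^sup>2"
        using mult_left_mono[OF gG, of "\<kappa>\<^sup>2"] by (simp add: algebra_simps)
      then show ?thesis unfolding E_def using s0 by (intro mult_left_mono) auto
    qed
    have "sin \<theta> ^ N * (\<kappa>\<^sup>2 * (g \<theta>)\<^sup>2) \<le> E \<theta>"
      unfolding E_def using spos by (intro mult_left_mono) auto
    also have "\<dots> \<le> E \<theta> * exp (A * (cos \<theta> / sin \<theta>))"
    proof -
      have "0 \<le> E \<theta>" unfolding E_def using spos by auto
      moreover have "0 \<le> A * (cos \<theta> / sin \<theta>)" using Apos cpos by (rule mult_nonneg_nonneg)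
      ultimately show ?thesis by (metis mult.right_neutral mult_left_mono one_le_exp_iff)
    qed
    also have "\<dots> \<le> E \<theta>0 * exp (A * real p)"
      using E_decay[OF th0(1) le] th cot0 pi_gt_zero by simp
    also have "\<dots> \<le> sin \<theta>0 ^ N * ((2 * \<nu>\<^sup>2 + 3) * \<kappa>\<^sup>2 * (G 1)\<^sup>2) * exp \<bar>\<nu>\<^sup>2 - \<nu>\<bar>"
    proof (intro mult_mono E0)
      have "\<bar>\<nu>\<^sup>2 - \<nu>\<bar> * (real p / \<kappa>) \<le> \<bar>\<nu>\<^sup>2 - \<nu>\<bar> * 1"
        using kappa by (intro mult_left_mono) auto
      then show "exp (A * real p) \<le> exp \<bar>\<nu>\<^sup>2 - \<nu>\<bar>" by (simp add: A_def)
    qed (use s0 in auto)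
    finally have "\<kappa>\<^sup>2 * (sin \<theta> ^ N * (g \<theta>)\<^sup>2) \<le> \<kappa>\<^sup>2 * (sin \<theta>0 ^ N * (exp \<bar>\<nu>\<^sup>2 - \<nu>\<bar> * (2 * \<nu>\<^sup>2 + 3) * (G 1)\<^sup>2))"
      by (simp add: mult_ac)
    then have b: "sin \<theta> ^ N * (g \<theta>)\<^sup>2 \<le> sin \<theta>0 ^ N * (exp \<bar>\<nu>\<^sup>2 - \<nu>\<bar> * (2 * \<nu>\<^sup>2 + 3) * (G 1)\<^sup>2)"
      using kappa(3) by simp
    have "(G t)\<^sup>2 * (real p * sqrt (1 - t\<^sup>2)) ^ N = real p ^ N * (sin \<theta> ^ N * (g \<theta>)\<^sup>2)"
      by (simp add: g_def th power_mult_distrib)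
    also have "\<dots> \<le> real p ^ N * (sin \<theta>0 ^ N * (exp \<bar>\<nu>\<^sup>2 - \<nu>\<bar> * (2 * \<nu>\<^sup>2 + 3) * (G 1)\<^sup>2))"
      by (intro mult_left_mono b) auto
    also have "\<dots> = (real p * sin \<theta>0) ^ N * (exp \<bar>\<nu>\<^sup>2 - \<nu>\<bar> * (2 * \<nu>\<^sup>2 + 3) * (G 1)\<^sup>2)"
      by (simp add: power_mult_distrib)
    also have "\<dots> \<le> 1 * (exp \<bar>\<nu>\<^sup>2 - \<nu>\<bar> * (2 * \<nu>\<^sup>2 + 3) * (G 1)\<^sup>2)"
      using sp0 s0 p by (intro mult_right_mono power_le_one mult_nonneg_nonneg) auto
    finally show ?thesis by simp
  qed
  have "(G \<bar>t\<bar>)\<^sup>2 = (G t)\<^sup>2"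
    using abs_gegenbauer_minus[of n p t] by (auto simp: abs_if power2_eq_iff split: if_splits)
  then show ?thesis
    using main[of "\<bar>t\<bar>"] t ps unfolding \<nu>_def \<mu>_def by auto
qed

text \<open>The energy bounds the angular derivative by sqrt eigenvalue times |G 1|; the hypothesis
  then keeps the change of G between the pole and \<theta> below half of |G 1|.\<close>

lemma gegenbauer_near_pole:
  assumes \<theta>: "0 \<le> \<theta>" "\<theta> \<le> 1" "4 * \<theta>\<^sup>2 * (real p * (real p + n - 2)) \<le> 1"
  shows "(G 1)\<^sup>2 \<le> 4 * (G (cos \<theta>))\<^sup>2"
proof (cases "\<theta> = 0")
  case False
  then have pos: "0 < \<theta>" using \<theta> by simp
  obtain z where z: "0 < z" "z < \<theta>" "g \<theta> - g 0 = (\<theta> - 0) * g' z"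
    using MVT2[OF pos, of g g'] deriv_g by blast
  have c01: "cos z \<in> {0..1}" using z \<theta> pi_gt3 by (auto intro!: cos_ge_zero)
  have "0 \<le> eigenvalue * (g z)\<^sup>2" using eigenvalue_pos by simp
  then have "(g' z)\<^sup>2 \<le> eigenvalue * (G 1)\<^sup>2"
    using gegenbauer_energy[OF c01] by (simp add: g_def g'_def power_mult_distrib sin_squared_eq)
  then have "4 * \<theta>\<^sup>2 * (g' z)\<^sup>2 \<le> 4 * \<theta>\<^sup>2 * (eigenvalue * (G 1)\<^sup>2)" by (intro mult_left_mono) auto
  also have "\<dots> = (4 * \<theta>\<^sup>2 * eigenvalue) * (G 1)\<^sup>2" by simp
  also have "\<dots> \<le> 1 * (G 1)\<^sup>2" using \<theta> by (intro mult_right_mono) (auto simp: eigenvalue_def)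
  finally have "(2 * (g \<theta> - g 0))\<^sup>2 \<le> (G 1)\<^sup>2" using z by (simp add: power_mult_distrib)
  then have "\<bar>2 * (g \<theta> - G 1)\<bar> \<le> \<bar>G 1\<bar>" by (simp add: abs_le_square_iff g_def)
  then have "\<bar>G 1\<bar> \<le> \<bar>2 * g \<theta>\<bar>" by (smt (verit))
  then have "(G 1)\<^sup>2 \<le> (2 * g \<theta>)\<^sup>2" by (simp only: abs_le_square_iff)
  then show ?thesis by (simp add: g_def power_mult_distrib)
qed simp

end

section \<open>Restriction to a measure with square density\<close>

lemma measurable_sphere_pair:
  fixes k :: "real ^ 'n \<Rightarrow> real ^ 'n \<Rightarrow> real"
  assumes "continuous_on (sphere 0 1 \<times> sphere 0 1) (\<lambda>z. k (fst z) (snd z))"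
  shows "(\<lambda>z. k (fst z) (snd z)) \<in> borel_measurable (sphere_measure \<Otimes>\<^sub>M sphere_measure)"
proof -
  let ?S = "sphere 0 1 :: (real ^ 'n) set"
  have id: "(\<lambda>x. x) \<in> borel_measurable (sphere_measure :: (real ^ 'n) measure)"
    by (rule measurable_sphere) (rule continuous_on_id)
  have "(\<lambda>z. (fst z, snd z)) \<in> sphere_measure \<Otimes>\<^sub>M sphere_measure \<rightarrow>\<^sub>M (borel \<Otimes>\<^sub>M borel :: ((real ^ 'n) \<times> (real ^ 'n)) measure)"
    by (intro measurable_Pair measurable_compose[OF measurable_fst id] measurable_compose[OF measurable_snd id])
  then have "(\<lambda>z. z) \<in> sphere_measure \<Otimes>\<^sub>M sphere_measure \<rightarrow>\<^sub>M (borel :: ((real ^ 'n) \<times> (real ^ 'n)) measure)"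
    by (simp add: borel_prod)
  then have "(\<lambda>z. z) \<in> sphere_measure \<Otimes>\<^sub>M sphere_measure \<rightarrow>\<^sub>M restrict_space borel (?S \<times> ?S)"
    by (intro measurable_restrict_space2) (auto simp: space_pair_measure)
  from measurable_compose[OF this borel_measurable_continuous_on_restrict[OF assms]] show ?thesis .
qed

lemma bounded_sphere_pair:
  fixes k :: "real ^ 'n \<Rightarrow> real ^ 'n \<Rightarrow> real"
  assumes "continuous_on (sphere 0 1 \<times> sphere 0 1) (\<lambda>z. k (fst z) (snd z))"
  obtains B where "\<And>x y. x \<in> sphere 0 1 \<Longrightarrow> y \<in> sphere 0 1 \<Longrightarrow> \<bar>k x y\<bar> \<le> B"
proof -
  have "compact ((\<lambda>z. k (fst z) (snd z)) ` (sphere 0 1 \<times> sphere 0 1))"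
    by (intro compact_continuous_image assms compact_Times) auto
  then have "bounded ((\<lambda>z. k (fst z) (snd z)) ` (sphere 0 1 \<times> sphere 0 1))"
    by (rule compact_imp_bounded)
  then obtain B where "\<And>z. z \<in> sphere 0 1 \<times> sphere 0 1 \<Longrightarrow> norm (k (fst z) (snd z)) \<le> B"
    unfolding bounded_iff by blast
  then show ?thesis using that[of B] by (metis fst_conv mem_Sigma_iff real_norm_def snd_conv)
qed

lemma sphere_Fubini:
  fixes k :: "real ^ 'n \<Rightarrow> real ^ 'n \<Rightarrow> real"
  assumes k: "continuous_on (sphere 0 1 \<times> sphere 0 1) (\<lambda>z. k (fst z) (snd z))"
  shows "(LINT x|sphere_measure. LINT y|sphere_measure. k x y) = (LINT y|sphere_measure. LINT x|sphere_measure. k x y)"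
proof -
  interpret pair_sigma_finite "sphere_measure :: (real ^ 'n) measure" "sphere_measure :: (real ^ 'n) measure" ..
  interpret P: finite_measure "(sphere_measure :: (real ^ 'n) measure) \<Otimes>\<^sub>M (sphere_measure :: (real ^ 'n) measure)"
    by (intro finite_measure_pair_measure finite_measure_sphere_measure)
  obtain B where B: "\<And>x y. x \<in> sphere 0 1 \<Longrightarrow> y \<in> sphere 0 1 \<Longrightarrow> \<bar>k x y\<bar> \<le> B"
    using bounded_sphere_pair[OF k] by blast
  have "integrable (sphere_measure \<Otimes>\<^sub>M sphere_measure) (\<lambda>z. k (fst z) (snd z))"
    by (rule P.integrable_const_bound[where B = B])
       (auto intro!: AE_I2 measurable_sphere_pair k simp: space_pair_measure B)
  then have "integrable (sphere_measure \<Otimes>\<^sub>M sphere_measure) (\<lambda>(x, y). k x y)"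
    by (simp add: case_prod_beta')
  from Fubini_integral[OF this] show ?thesis by simp
qed

lemma continuous_on_sphere_integral:
  fixes k :: "real ^ 'n \<Rightarrow> real ^ 'n \<Rightarrow> real"
  assumes k: "continuous_on (sphere 0 1 \<times> sphere 0 1) (\<lambda>z. k (fst z) (snd z))"
  shows "continuous_on (sphere 0 1) (\<lambda>y. LINT x|sphere_measure. k x y)"
  unfolding continuous_on_sequentially comp_def
proof (intro allI ballI impI, elim conjE)
  fix u :: "nat \<Rightarrow> real ^ 'n" and y
  assume y: "y \<in> sphere 0 1" and u: "\<forall>n. u n \<in> sphere 0 1" "u \<longlonglongrightarrow> y"
  obtain B where B: "\<And>x y. x \<in> sphere 0 1 \<Longrightarrow> y \<in> sphere 0 1 \<Longrightarrow> \<bar>k x y\<bar> \<le> B"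
    using bounded_sphere_pair[OF k] by blast
  have cx: "continuous_on (sphere 0 1) (\<lambda>x. k x y)" if "y \<in> sphere 0 1" for y
    using continuous_on_compose2[OF k continuous_on_Pair[OF continuous_on_id continuous_on_const], of y "sphere 0 1"] that by (simp add: image_subset_iff)
  have cy: "continuous_on (sphere 0 1) (\<lambda>y. k x y)" if "x \<in> sphere 0 1" for x
    using continuous_on_compose2[OF k continuous_on_Pair[OF continuous_on_const continuous_on_id], of x "sphere 0 1"] that by (simp add: image_subset_iff)
  show "(\<lambda>n. LINT x|sphere_measure. k x (u n)) \<longlonglongrightarrow> (LINT x|sphere_measure. k x y)"
  proof (rule integral_dominated_convergence[where w = "\<lambda>_. B"])
    show "AE x in sphere_measure. (\<lambda>n. k x (u n)) \<longlonglongrightarrow> k x y"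
      using continuous_on_tendsto_compose[OF cy u(2) y] u(1) by (auto intro!: AE_I2)
  qed (use u y B in \<open>auto intro!: AE_I2 measurable_sphere cx\<close>)
qed

lemma continuous_on_zonal_pair:
  assumes "continuous_on A f" "continuous_on A g"
  shows "continuous_on A (\<lambda>z. zonal p (f z) (g z))"
  unfolding zonal_def by (intro continuous_intros assms)

lemma zonal_commute:
  fixes x y :: "real ^ 'n"
  shows "norm x = 1 \<Longrightarrow> norm y = 1 \<Longrightarrow> zonal p x y = zonal p y x"
  by (simp add: zonal_sphere inner_commute)

text \<open>Schur's test for \<open>T T\<^sup>*\<close>, where \<open>T\<close> restricts harmonics of degree \<open>p\<close> to \<open>L\<^sup>2(Q\<^sup>2 d\<sigma>)\<close>;
  the kernel of \<open>T T\<^sup>*\<close> is \<open>zonal / M\<close>.\<close>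

lemma restriction_bound:
  fixes P Q :: "real ^ 'n \<Rightarrow> real"
  assumes P: "solid_harmonic p P" and Q: "continuous_on (sphere 0 1) Q" and n: "CARD('n) \<ge> 2"
    and M: "M = moment_const (measure (sphere_measure :: (real ^ 'n) measure) (sphere 0 1)) (real CARD('n) - 1) p"
    and S: "S > 0" "\<And>x. x \<in> sphere 0 1 \<Longrightarrow> (LINT y|sphere_measure. \<bar>zonal p x y\<bar> * (Q y)\<^sup>2) \<le> S"
  shows "M * (LINT x|sphere_measure. (P x)\<^sup>2 * (Q x)\<^sup>2) \<le> S * (LINT x|sphere_measure. (P x)\<^sup>2)"
proof -
  let ?\<sigma> = "sphere_measure :: (real ^ 'n) measure"
  let ?S = "sphere 0 1 :: (real ^ 'n) set"
  have poly: "real_polynomial_function P" using P by (rule solid_harmonicD)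
  have cP: "continuous_on ?S P" by (rule continuous_on_real_polynomial_function[OF poly])
  define W where "W x = P x * (Q x)\<^sup>2" for x
  have cW: "continuous_on ?S W" unfolding W_def[abs_def] by (intro continuous_intros cP Q)
  have c1: "continuous_on (?S \<times> ?S) (\<lambda>z. f (fst z))" and c2: "continuous_on (?S \<times> ?S) (\<lambda>z. f (snd z))"
    if "continuous_on ?S f" for f :: "real ^ 'n \<Rightarrow> real"
    by (auto intro!: continuous_on_compose2[OF that] continuous_intros)
  note zc = continuous_on_zonal_pair[of "?S \<times> ?S" fst snd] continuous_on_zonal_pair[of "?S \<times> ?S" snd fst]
  have z1: "continuous_on ?S (\<lambda>y. zonal p x y)" and z2: "continuous_on ?S (\<lambda>y. zonal p y x)" for x
    by (intro continuous_on_zonal_pair continuous_intros)+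
  \<comment> \<open>F / M is the orthogonal projection of W to the harmonics of degree p. Below,
    \<open>MA\<close> tests it against P, \<open>MF\<close> says that projecting again changes
    nothing, and \<open>FF\<close> computes its norm.\<close>
  define F where "F y = (LINT x|?\<sigma>. zonal p x y * W x)" for y
  have cF: "continuous_on ?S F"
    unfolding F_def[abs_def]
    by (intro continuous_on_sphere_integral continuous_on_mult zc c1 cW continuous_on_fst continuous_on_snd continuous_on_id)
  define A where "A = (LINT x|?\<sigma>. (P x)\<^sup>2 * (Q x)\<^sup>2)"
  have repr: "(LINT y|?\<sigma>. zonal p x y * P y) = M * P x" if "x \<in> ?S" for x
    using zonal_reproducing[OF P _ n, of x] that by (simp add: M)
  have MA: "M * A = (LINT y|?\<sigma>. P y * F y)"
  proof -
    have "M * A = (LINT x|?\<sigma>. M * ((P x)\<^sup>2 * (Q x)\<^sup>2))" by (simp add: A_def)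
    also have "\<dots> = (LINT x|?\<sigma>. (LINT y|?\<sigma>. zonal p x y * W x * P y))"
    proof (intro Bochner_Integration.integral_cong refl)
      fix x assume "x \<in> space ?\<sigma>"
      then have "(LINT y|?\<sigma>. W x * (zonal p x y * P y)) = W x * (M * P x)"
        using repr[of x] by simp
      moreover have "(LINT y|?\<sigma>. zonal p x y * W x * P y) = (LINT y|?\<sigma>. W x * (zonal p x y * P y))"
        by (simp add: mult_ac)
      ultimately show "M * ((P x)\<^sup>2 * (Q x)\<^sup>2) = (LINT y|?\<sigma>. zonal p x y * W x * P y)"
        by (simp add: W_def power2_eq_square mult_ac)
    qed
    also have "\<dots> = (LINT y|?\<sigma>. (LINT x|?\<sigma>. zonal p x y * W x * P y))"
      by (intro sphere_Fubini continuous_on_mult zc c1 c2 cW cP continuous_on_fst continuous_on_snd continuous_on_id)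
    also have "\<dots> = (LINT y|?\<sigma>. P y * F y)"
      by (simp add: F_def mult.commute)
    finally show ?thesis .
  qed
  have MF: "(LINT y|?\<sigma>. zonal p x y * F y) = M * F x" if x: "x \<in> ?S" for x
  proof -
    have "(LINT y|?\<sigma>. zonal p x y * F y) = (LINT y|?\<sigma>. (LINT x'|?\<sigma>. zonal p x y * (zonal p x' y * W x')))"
      by (simp add: F_def)
    also have "\<dots> = (LINT x'|?\<sigma>. (LINT y|?\<sigma>. zonal p x y * (zonal p x' y * W x')))"
      by (intro sphere_Fubini continuous_on_mult zc c1 c2 cW z1 continuous_on_fst continuous_on_snd continuous_on_id)
    also have "\<dots> = (LINT x'|?\<sigma>. M * (zonal p x' x * W x'))"
    proof (intro Bochner_Integration.integral_cong refl)
      fix x' assume x': "x' \<in> space ?\<sigma>"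
      have "(LINT y|?\<sigma>. zonal p x y * zonal p x' y * W x') = (M * zonal p x' x) * W x'"
        using zonal_reproducing[OF solid_harmonic_zonal _ n, of x' x p] x x' by (simp add: M)
      then show "(LINT y|?\<sigma>. zonal p x y * (zonal p x' y * W x')) = M * (zonal p x' x * W x')"
        by (simp add: mult.assoc)
    qed
    also have "\<dots> = M * F x" by (simp add: F_def)
    finally show ?thesis .
  qed
  have FF: "(LINT y|?\<sigma>. (F y)\<^sup>2) = M * (LINT x|?\<sigma>. W x * F x)"
  proof -
    have "(LINT y|?\<sigma>. (F y)\<^sup>2) = (LINT y|?\<sigma>. (LINT x|?\<sigma>. F y * (zonal p x y * W x)))"
      by (simp add: F_def power2_eq_square)
    also have "\<dots> = (LINT x|?\<sigma>. (LINT y|?\<sigma>. F y * (zonal p x y * W x)))"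
      by (intro sphere_Fubini continuous_on_mult zc c1 c2 cW cF continuous_on_fst continuous_on_snd continuous_on_id)
    also have "\<dots> = (LINT x|?\<sigma>. M * (W x * F x))"
    proof (intro Bochner_Integration.integral_cong refl)
      fix x assume x: "x \<in> space ?\<sigma>"
      have "(LINT y|?\<sigma>. W x * (zonal p x y * F y)) = W x * (M * F x)" using MF[of x] x by simp
      then show "(LINT y|?\<sigma>. F y * (zonal p x y * W x)) = M * (W x * F x)" by (simp add: mult_ac)
    qed
    finally show ?thesis by simp
  qed
  have WF: "(LINT x|?\<sigma>. W x * F x) \<le> S * A"
  proof -
    \<comment> \<open>Schur's test by symmetry: |P x P x'| \<le> (P x^2 + P x'^2) / 2 splits the
      double integral into two halves, equal by Fubini, in which S bounds the inner
      integral.\<close>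
    define k where "k x x' = (P x)\<^sup>2 * (Q x)\<^sup>2 * (\<bar>zonal p x x'\<bar> * (Q x')\<^sup>2)" for x x'
    have kc: "continuous_on (?S \<times> ?S) (\<lambda>z. k (fst z) (snd z))" "continuous_on (?S \<times> ?S) (\<lambda>z. k (snd z) (fst z))"
      unfolding k_def
      by (intro continuous_on_mult continuous_on_power continuous_on_rabs zc c1 c2 cP Q continuous_on_fst continuous_on_snd continuous_on_id)+
    have k1: "(LINT x|?\<sigma>. LINT x'|?\<sigma>. k x x') \<le> S * A"
    proof -
      have "(LINT x|?\<sigma>. LINT x'|?\<sigma>. k x x') \<le> (LINT x|?\<sigma>. S * ((P x)\<^sup>2 * (Q x)\<^sup>2))"
      proof (rule integral_mono)
        show "integrable ?\<sigma> (\<lambda>x. LINT x'|?\<sigma>. k x x')"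
          by (intro integrable_sphere continuous_on_sphere_integral kc)
        show "integrable ?\<sigma> (\<lambda>x. S * ((P x)\<^sup>2 * (Q x)\<^sup>2))"
          by (intro integrable_sphere continuous_intros cP Q)
        fix x assume "x \<in> space ?\<sigma>"
        then have "(P x)\<^sup>2 * (Q x)\<^sup>2 * (LINT y|?\<sigma>. \<bar>zonal p x y\<bar> * (Q y)\<^sup>2) \<le> (P x)\<^sup>2 * (Q x)\<^sup>2 * S"
          using S(2)[of x] by (intro mult_left_mono) auto
        then show "(LINT x'|?\<sigma>. k x x') \<le> S * ((P x)\<^sup>2 * (Q x)\<^sup>2)"
          unfolding k_def integral_mult_right_zero by (simp only: mult.commute[of S])
      qed
      then show ?thesis by (simp add: A_def)
    qed
    have k2: "(LINT x|?\<sigma>. LINT x'|?\<sigma>. k x' x) = (LINT x|?\<sigma>. LINT x'|?\<sigma>. k x x')"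
      by (rule sphere_Fubini[OF kc(2)])
    have "(LINT x|?\<sigma>. W x * F x) \<le> (LINT x|?\<sigma>. ((LINT x'|?\<sigma>. k x x') + (LINT x'|?\<sigma>. k x' x)) / 2)"
    proof (rule integral_mono)
      show "integrable ?\<sigma> (\<lambda>x. W x * F x)" by (intro integrable_sphere continuous_intros cW cF)
      show "integrable ?\<sigma> (\<lambda>x. ((LINT x'|?\<sigma>. k x x') + (LINT x'|?\<sigma>. k x' x)) / 2)"
        by (auto intro!: integrable_sphere continuous_on_divide continuous_on_add continuous_on_sphere_integral kc)
      fix x assume x: "x \<in> space ?\<sigma>"
      have ck: "continuous_on ?S (k x)" "continuous_on ?S (\<lambda>x'. k x' x)"
        unfolding k_def by (intro continuous_intros cP Q z1 z2)+
      have "W x * F x = (LINT x'|?\<sigma>. W x * (zonal p x' x * W x'))" by (simp add: F_def)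
      also have "\<dots> \<le> (LINT x'|?\<sigma>. (k x x' + k x' x) / 2)"
      proof (rule integral_mono)
        show "integrable ?\<sigma> (\<lambda>x'. W x * (zonal p x' x * W x'))"
          by (intro integrable_sphere continuous_intros cW z2)
        show "integrable ?\<sigma> (\<lambda>x'. (k x x' + k x' x) / 2)"
          by (auto intro!: integrable_sphere continuous_on_divide continuous_on_add ck)
        fix x' assume x': "x' \<in> space ?\<sigma>"
        let ?c = "(Q x)\<^sup>2 * (Q x')\<^sup>2 * \<bar>zonal p x x'\<bar>"
        have zz: "zonal p x' x = zonal p x x'" using x x' by (intro zonal_commute) auto
        have "W x * (zonal p x' x * W x') = (Q x)\<^sup>2 * (Q x')\<^sup>2 * (zonal p x x' * (P x * P x'))"
          by (simp add: W_def zz mult_ac)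
        also have "\<dots> \<le> (Q x)\<^sup>2 * (Q x')\<^sup>2 * (\<bar>zonal p x x'\<bar> * (((P x)\<^sup>2 + (P x')\<^sup>2) / 2))"
        proof (rule mult_left_mono)
          have "zonal p x x' * (P x * P x') \<le> \<bar>zonal p x x'\<bar> * \<bar>P x * P x'\<bar>"
            by (metis abs_ge_self abs_mult)
          also have "\<dots> \<le> \<bar>zonal p x x'\<bar> * (((P x)\<^sup>2 + (P x')\<^sup>2) / 2)"
          proof (rule mult_left_mono)
            have "0 \<le> (\<bar>P x\<bar> - \<bar>P x'\<bar>)\<^sup>2" by simp
            then show "\<bar>P x * P x'\<bar> \<le> ((P x)\<^sup>2 + (P x')\<^sup>2) / 2"
              by (simp add: power2_diff abs_mult)
          qed simp
          finally show "zonal p x x' * (P x * P x') \<le> \<bar>zonal p x x'\<bar> * (((P x)\<^sup>2 + (P x')\<^sup>2) / 2)" .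
        qed simp
        also have "\<dots> = (k x x' + k x' x) / 2"
          by (simp add: k_def zz field_simps)
        finally show "W x * (zonal p x' x * W x') \<le> (k x x' + k x' x) / 2" .
      qed
      also have "\<dots> = ((LINT x'|?\<sigma>. k x x') + (LINT x'|?\<sigma>. k x' x)) / 2"
        using integrable_sphere[OF ck(1)] integrable_sphere[OF ck(2)] by simp
      finally show "W x * F x \<le> ((LINT x'|?\<sigma>. k x x') + (LINT x'|?\<sigma>. k x' x)) / 2" .
    qed
    also have "\<dots> = ((LINT x|?\<sigma>. LINT x'|?\<sigma>. k x x') + (LINT x|?\<sigma>. LINT x'|?\<sigma>. k x' x)) / 2"
    proof -
      have "integrable ?\<sigma> (\<lambda>x. LINT x'|?\<sigma>. k x x')" "integrable ?\<sigma> (\<lambda>x. LINT x'|?\<sigma>. k x' x)"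
        by (intro integrable_sphere continuous_on_sphere_integral kc)+
      then show ?thesis by simp
    qed
    also have "\<dots> \<le> S * A" using k1 k2 by simp
    finally show ?thesis .
  qed
  have M0: "0 \<le> M" unfolding M using n by (intro moment_const_nonneg) auto
  \<comment> \<open>Expanding this square takes the place of Cauchy-Schwarz: the middle term
    contributes -2 M A / S and the last one at most M A / S.\<close>
  have "0 \<le> (LINT y|?\<sigma>. (P y - (1 / S) * F y)\<^sup>2)" by simp
  also have "(\<lambda>y. (P y - (1 / S) * F y)\<^sup>2) = (\<lambda>y. (P y)\<^sup>2 - (2 / S) * (P y * F y) + (1 / S)\<^sup>2 * (F y)\<^sup>2)"
    by (simp add: fun_eq_iff power2_eq_square algebra_simps)
  also have "(LINT y|?\<sigma>. (P y)\<^sup>2 - (2 / S) * (P y * F y) + (1 / S)\<^sup>2 * (F y)\<^sup>2)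
      = (LINT y|?\<sigma>. (P y)\<^sup>2) - (2 / S) * (M * A) + (1 / S)\<^sup>2 * (M * (LINT x|?\<sigma>. W x * F x))"
  proof -
    have i: "integrable ?\<sigma> (\<lambda>y. (P y)\<^sup>2)" "integrable ?\<sigma> (\<lambda>y. P y * F y)" "integrable ?\<sigma> (\<lambda>y. (F y)\<^sup>2)"
      by (intro integrable_sphere continuous_intros cP cF)+
    then show ?thesis by (simp add: MA FF)
  qed
  also have "\<dots> \<le> (LINT y|?\<sigma>. (P y)\<^sup>2) - (2 / S) * (M * A) + (1 / S)\<^sup>2 * (M * (S * A))"
    using WF M0 by (intro add_mono mult_left_mono) auto
  also have "\<dots> = (LINT y|?\<sigma>. (P y)\<^sup>2) - M * A / S"
    using S(1) by (simp add: power2_eq_square field_simps)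
  finally show ?thesis using S(1) by (simp add: A_def field_simps)
qed

section \<open>The value of the zonal harmonic at its pole\<close>

text \<open>The cone over the two caps of radius s contains about 1/s disjoint balls of radius s/4
  strung along the axis e, each of volume comparable to s^n.\<close>

lemma cap_measure_lower:
  fixes e :: "real ^ 'n"
  assumes e: "norm e = 1" and s: "0 < s" "s \<le> 1"
  shows "real CARD('n) * unit_ball_vol (real CARD('n)) / (2 * s) * (s / 4) ^ CARD('n)
    \<le> measure (sphere_measure :: (real ^ 'n) measure) (sphere 0 1 \<inter> {y. 1 - (e \<bullet> y)\<^sup>2 \<le> s\<^sup>2})"
proof -
  define \<delta> where "\<delta> = s / 4"
  have d: "0 < \<delta>" "\<delta> \<le> 1 / 4" using s by (auto simp: \<delta>_def)
  define K where "K = nat \<lfloor>1 / s\<rfloor>"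
  have x1: "1 \<le> 1 / s" using s by simp
  have K: "real K \<le> 1 / s" "1 / (2 * s) \<le> real K"
  proof -
    have "0 \<le> \<lfloor>1 / s\<rfloor>" using s by simp
    then have r: "real K = of_int \<lfloor>1 / s\<rfloor>" by (simp add: K_def)
    show "real K \<le> 1 / s" unfolding r by simp
    have "1 \<le> \<lfloor>1 / s\<rfloor>" using x1 by (simp add: le_floor_iff)
    then have "1 \<le> real K" unfolding r by linarith
    moreover have "1 / s < real K + 1" unfolding r by linarith
    ultimately show "1 / (2 * s) \<le> real K" by (simp add: field_simps)
  qed
  let ?A = "sphere 0 1 \<inter> {y :: real ^ 'n. 1 - (e \<bullet> y)\<^sup>2 \<le> s\<^sup>2}"
  let ?C = "{r *\<^sub>R x |r x. 0 < r \<and> r < 1 \<and> x \<in> ?A}"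
  let ?C' = "{z. z \<noteq> 0 \<and> norm z < 1 \<and> (norm z)\<^sup>2 - (e \<bullet> z)\<^sup>2 \<le> s\<^sup>2 * (norm z)\<^sup>2}"
  \<comment> \<open>The spacing 2 \<delta> makes the balls disjoint, and K \<le> 1/s keeps them
    inside the unit ball. Starting at distance 1/2 keeps all points at norm at least 1/4, where a
    distance below \<delta> = s/4 from the axis lies within the cone.\<close>
  define c where "c k = (1 / 2 + 2 * \<delta> * real k) *\<^sub>R e" for k
  have C: "?C' \<subseteq> ?C"
  proof
    fix z assume z: "z \<in> ?C'"
    define y where "y = z /\<^sub>R norm z"
    have "(1 - (e \<bullet> y)\<^sup>2) * (norm z)\<^sup>2 \<le> s\<^sup>2 * (norm z)\<^sup>2"
      using z by (simp add: y_def power_divide algebra_simps) (simp add: field_simps power2_eq_square)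
    then have "1 - (e \<bullet> y)\<^sup>2 \<le> s\<^sup>2" using z by simp
    then have "y \<in> ?A" using z by (simp add: y_def)
    moreover have "z = norm z *\<^sub>R y" using z by (simp add: y_def)
    ultimately show "z \<in> ?C"
      using z by (intro CollectI exI[of _ "norm z"] exI[of _ y]) auto
  qed
  have "?C \<subseteq> ?C'"
  proof
    fix z assume "z \<in> ?C"
    then obtain r x where z: "z = r *\<^sub>R x" "0 < r" "r < 1" and x: "norm x = 1" "1 - (e \<bullet> x)\<^sup>2 \<le> s\<^sup>2" by auto
    have "r\<^sup>2 * (1 - (e \<bullet> x)\<^sup>2) \<le> r\<^sup>2 * s\<^sup>2" using x by (intro mult_left_mono) auto
    then have "(norm z)\<^sup>2 - (e \<bullet> z)\<^sup>2 \<le> s\<^sup>2 * (norm z)\<^sup>2"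
      using z x by (simp add: power_mult_distrib right_diff_distrib mult.commute)
    moreover have "z \<noteq> 0" "norm z < 1" using z x by auto
    ultimately show "z \<in> ?C'" by simp
  qed
  with C have CC: "?C = ?C'" by blast
  have Cm: "?C \<in> sets lborel" unfolding CC by measurable
  have sub: "(\<Union>k<K. ball (c k) \<delta>) \<subseteq> ?C"
    unfolding CC
  proof
    fix z assume "z \<in> (\<Union>k<K. ball (c k) \<delta>)"
    then obtain k where k: "k < K" and z: "z \<in> ball (c k) \<delta>" by blast
    define \<tau> where "\<tau> = 1 / 2 + 2 * \<delta> * real k"
    define w where "w = z - \<tau> *\<^sub>R e"
    have w: "norm w < \<delta>" "z = \<tau> *\<^sub>R e + w"
      using z by (auto simp: w_def c_def \<tau>_def dist_norm norm_minus_commute)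
    have "2 * \<delta> * real (Suc k) \<le> 2 * \<delta> * real K" using k d by (intro mult_left_mono) auto
    also have "\<dots> \<le> 2 * \<delta> * (1 / s)" using K d by (intro mult_left_mono) auto
    also have "\<dots> = 1 / 2" using s by (simp add: \<delta>_def)
    finally have \<tau>: "1 / 2 \<le> \<tau>" "\<tau> + 2 * \<delta> \<le> 1" using d by (auto simp: \<tau>_def algebra_simps)
    have n\<tau>: "norm (\<tau> *\<^sub>R e) = \<tau>" using e \<tau> by simp
    have "norm z \<le> norm (\<tau> *\<^sub>R e) + norm w"
      using norm_triangle_ineq[of "\<tau> *\<^sub>R e" w] by (simp only: w(2)[symmetric])
    then have nz: "norm z < 1" using w(1) \<tau> d n\<tau> by linarith
    have zl: "\<tau> - \<delta> < norm z" using norm_triangle_ineq4[of z w] w n\<tau> by (simp add: algebra_simps)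
    then have z4: "1 / 4 \<le> norm z" using \<tau> d by linarith
    then have z0: "z \<noteq> 0" by auto
    have ee: "e \<bullet> e = 1" using e by (simp add: norm_eq_1)
    have "(norm z)\<^sup>2 - (e \<bullet> z)\<^sup>2 = (norm w)\<^sup>2 - (e \<bullet> w)\<^sup>2"
      unfolding power2_norm_eq_inner w(2)
      by (simp add: inner_add_left inner_add_right ee inner_commute[of w e] power2_eq_square algebra_simps)
    also have "\<dots> \<le> \<delta>\<^sup>2" using power_mono[of "norm w" \<delta> 2] w(1) by (smt (verit) norm_ge_zero zero_le_power2)
    also have "\<dots> = s\<^sup>2 * (1 / 4)\<^sup>2" by (simp add: \<delta>_def power_divide)
    also have "\<dots> \<le> s\<^sup>2 * (norm z)\<^sup>2" using z4 by (intro mult_left_mono power_mono) auto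
    finally show "z \<in> ?C'" using nz z0 by simp
  qed
  have disj: "disjoint_family_on (\<lambda>k. ball (c k) \<delta>) {..<K}"
    unfolding disjoint_family_on_def
  proof (intro ballI impI)
    fix k l :: nat assume "k \<noteq> l"
    have "dist (c k) (c l) = \<bar>2 * \<delta> * (real k - real l)\<bar>"
      using e by (simp add: c_def dist_norm flip: scaleR_diff_left) (simp add: algebra_simps)
    also have "\<dots> = 2 * \<delta> * \<bar>real k - real l\<bar>" using d by (simp add: abs_mult)
    also have "\<dots> \<ge> 2 * \<delta> * 1" using d \<open>k \<noteq> l\<close> by (intro mult_left_mono) linarith+
    finally have "2 * \<delta> \<le> dist (c k) (c l)" by simp
    then show "ball (c k) \<delta> \<inter> ball (c l) \<delta> = {}" by (intro disjoint_ballI) auto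
  qed
  have "ennreal (real K * (unit_ball_vol (real CARD('n)) * \<delta> ^ CARD('n)))
      = (\<Sum>k<K. emeasure lborel (ball (c k) \<delta>))"
    using d by (simp add: emeasure_ball ennreal_mult ennreal_of_nat_eq_real_of_nat)
  also have "\<dots> = emeasure lborel (\<Union>k<K. ball (c k) \<delta>)"
    by (rule sum_emeasure[OF _ disj]) auto
  also have "\<dots> \<le> emeasure lborel ?C" by (rule emeasure_mono[OF sub Cm])
  finally have "of_nat CARD('n) * ennreal (real K * (unit_ball_vol (real CARD('n)) * \<delta> ^ CARD('n)))
      \<le> of_nat CARD('n) * emeasure lborel ?C" by (rule mult_left_mono) simp
  also have "\<dots> = emeasure sphere_measure ?A"
    by (rule emeasure_sphere_measure[symmetric]) auto
  also have "\<dots> = ennreal (measure sphere_measure ?A)"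
    by (rule sphere.emeasure_eq_measure)
  finally have "ennreal (real CARD('n) * (real K * (unit_ball_vol (real CARD('n)) * \<delta> ^ CARD('n))))
      \<le> ennreal (measure sphere_measure ?A)"
    using d by (simp add: ennreal_mult ennreal_of_nat_eq_real_of_nat)
  then have "real CARD('n) * (real K * (unit_ball_vol (real CARD('n)) * \<delta> ^ CARD('n))) \<le> measure sphere_measure ?A"
    by (simp add: ennreal_le_iff)
  moreover have "real CARD('n) * (1 / (2 * s) * (unit_ball_vol (real CARD('n)) * \<delta> ^ CARD('n)))
      \<le> real CARD('n) * (real K * (unit_ball_vol (real CARD('n)) * \<delta> ^ CARD('n)))"
    using K d by (intro mult_left_mono mult_right_mono) auto
  ultimately show ?thesis by (simp add: \<delta>_def)
qed

text \<open>\<open>gegenbauer_near_pole\<close> with the angle replaced by its sine: here \<theta>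
  \<le> 2 sin \<theta>, because the cosine is at least 1/2. The factor 4 n in the radius absorbs
  this 2 and the estimate p + n - 2 \<le> n p.\<close>

lemma gegenbauer_cap:
  fixes n :: real
  assumes n: "n = real N + 2" "N \<ge> 1" and p: "p \<ge> 1" and t: "t \<in> {-1..1}" "1 - t\<^sup>2 \<le> (1 / (4 * n * p))\<^sup>2"
  shows "(gegenbauer n p 1)\<^sup>2 \<le> 4 * (gegenbauer n p t)\<^sup>2"
proof -
  have main: "(gegenbauer n p 1)\<^sup>2 \<le> 4 * (gegenbauer n p t)\<^sup>2"
    if t: "t \<in> {0..1}" "1 - t\<^sup>2 \<le> (1 / (4 * n * p))\<^sup>2" for t
  proof -
    define s where "s = 1 / (4 * n * p)"
    have np: "n \<ge> 3" "real p \<ge> 1" "3 \<le> n * real p"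
      using n p mult_mono[of 3 n 1 "real p"] by auto
    have s: "0 < s" "s \<le> 1 / 4"
      using np by (auto simp: s_def field_simps)
    define \<theta> where "\<theta> = arccos t"
    have th: "cos \<theta> = t" "sin \<theta> = sqrt (1 - t\<^sup>2)" "0 \<le> \<theta>" "\<theta> \<le> pi / 2"
      using t(1) arccos_le_pi2[of t] arccos_lbound[of t] by (simp_all add: \<theta>_def cos_arccos sin_arccos)
    have sl: "sin \<theta> \<le> s"
      using t(2) s real_sqrt_le_mono[of "1 - t\<^sup>2" "s\<^sup>2"] by (simp add: th s_def)
    have tl: "1 / 2 \<le> t"
    proof (rule ccontr)
      assume "\<not> ?thesis"
      then have "t\<^sup>2 \<le> (1 / 2)\<^sup>2" using t(1) by (intro power_mono) auto
      moreover have "s\<^sup>2 \<le> (1 / 4)\<^sup>2" using s by (intro power_mono) auto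
      ultimately show False using t(2) by (simp add: s_def[symmetric] power2_eq_square)
    qed
    have \<theta>s: "\<theta> \<le> 2 * s"
    proof (cases "\<theta> = 0")
      case False
      then have "0 < \<theta>" using th by simp
      then obtain z where z: "0 < z" "z < \<theta>" "sin \<theta> - sin 0 = (\<theta> - 0) * cos z"
        using MVT2[of 0 \<theta> sin cos] by auto
      have "cos \<theta> \<le> cos z" using z th by (intro cos_monotone_0_pi_le) auto
      then have "1 / 2 \<le> cos z" using tl th by simp
      then have "\<theta> * (1 / 2) \<le> \<theta> * cos z" using th by (intro mult_left_mono) auto
      moreover have "sin \<theta> = \<theta> * cos z" using z by simp
      ultimately show ?thesis using sl by linarith
    qed (use s in simp)
    have "4 * \<theta>\<^sup>2 * (real p * (real p + n - 2)) \<le> 4 * (2 * s)\<^sup>2 * (real p * (n * real p))"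
    proof (intro mult_mono power_mono \<theta>s)
      have "0 \<le> (n - 1) * (real p - 1)" using np by simp
      then show "real p + n - 2 \<le> n * real p" by (simp add: algebra_simps)
    qed (use np s th in auto)
    also have "\<dots> = (16 * n * (real p)\<^sup>2) / (16 * n\<^sup>2 * (real p)\<^sup>2)"
      by (simp add: s_def power2_eq_square)
    also have "\<dots> = 1 / n" using np by (simp add: power2_eq_square)
    also have "\<dots> \<le> 1" using np by simp
    finally have "4 * \<theta>\<^sup>2 * (real p * (real p + n - 2)) \<le> 1" .
    then have "(gegenbauer n p 1)\<^sup>2 \<le> 4 * (gegenbauer n p (cos \<theta>))\<^sup>2"
      using \<theta>s s th by (intro gegenbauer_near_pole[OF n p]) auto
    then show ?thesis by (simp add: th)
  qed
  have "(gegenbauer n p \<bar>t\<bar>)\<^sup>2 = (gegenbauer n p t)\<^sup>2"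
    using abs_gegenbauer_minus[of n p t] by (auto simp: abs_if power2_eq_iff split: if_splits)
  then show ?thesis using main[of "\<bar>t\<bar>"] t by auto
qed

abbreviation (input) moment :: "'n::finite itself \<Rightarrow> nat \<Rightarrow> real" where
  "moment _ p \<equiv> moment_const (measure (sphere_measure :: (real ^ 'n) measure) (sphere 0 1)) (real CARD('n) - 1) p"

lemma measure_sphere_pos: "0 < measure (sphere_measure :: (real ^ 'n) measure) (sphere 0 1)"
proof -
  obtain i :: 'n where True by simp
  have "0 < real CARD('n) * unit_ball_vol (real CARD('n)) / (2 * 1) * (1 / 4) ^ CARD('n)" by simp
  also have "\<dots> \<le> measure (sphere_measure :: (real ^ 'n) measure) (sphere 0 1 \<inter> {y. 1 - (axis i 1 \<bullet> y)\<^sup>2 \<le> 1\<^sup>2})"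
    by (rule cap_measure_lower) (auto simp: norm_axis_1)
  also have "\<dots> \<le> measure (sphere_measure :: (real ^ 'n) measure) (sphere 0 1)"
    by (rule sphere.finite_measure_mono) (auto simp: sets_sphere_measure sets_restrict_space)
  finally show ?thesis .
qed

text \<open>By the reproducing property the zonal function has squared norm M G1. On a cap of radius
  comparable to 1/p its square is at least G1^2 / 4, so the mass there is at least a multiple of
  G1^2 / p^(N+1), while \<open>polar_cap_mass\<close> with r = 1/p bounds it by a multiple of M G1 /
  p. Dividing by G1 leaves the claim.\<close>

lemma zonal_pole_bound:
  assumes n: "CARD('n::finite) = N + 2" "N \<ge> 1"
  shows "\<exists>C>0. \<forall>p\<ge>1. 0 \<le> gegenbauer (real CARD('n)) p 1 \<and>
    gegenbauer (real CARD('n)) p 1 \<le> C * moment TYPE('n) p * real p ^ N"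
proof -
  let ?n = "real CARD('n)"
  let ?\<sigma> = "sphere_measure :: (real ^ 'n) measure"
  obtain i :: 'n where True by simp
  define e where "e = (axis i 1 :: real ^ 'n)"
  have e: "norm e = 1" by (simp add: e_def norm_axis_1)
  define d where "d = ?n - 1"
  have d: "d = ?n - 1" "1 \<le> d" using n by (auto simp: d_def)
  define C1 where "C1 = 18 * (2 * (d\<^sup>2 + 7 * d + 25))"
  have C1: "C1 > 0" using d by (simp add: C1_def add_nonneg_pos)
  define c2 where "c2 = ?n * unit_ball_vol ?n / 2 * (1 / 4) ^ (N + 2)"
  have c2: "c2 > 0" using n by (auto simp: c2_def)
  define C where "C = 4 * C1 * (4 * ?n) ^ (N + 1) / c2"
  have nn: "?n = real N + 2" using n by simp
  have Cpos: "C > 0" using C1 c2 n by (auto simp: C_def)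
  have main: "0 \<le> gegenbauer ?n p 1 \<and> gegenbauer ?n p 1 \<le> C * moment TYPE('n) p * real p ^ N" if p: "p \<ge> 1" for p
  proof -
    define M where "M = moment TYPE('n) p"
    have M: "M > 0" unfolding M_def using measure_sphere_pos[where 'n = 'n] d by (intro moment_const_pos) auto
    define G1 where "G1 = gegenbauer ?n p 1"
    define s where "s = 1 / (4 * ?n * p)"
    have np: "?n \<ge> 3" "real p \<ge> 1" "3 \<le> ?n * real p"
      using n p mult_mono[of 3 ?n 1 "real p"] by auto
    have s: "0 < s" "s \<le> 1" "s \<le> 1 / real p"
      using np by (auto simp: s_def field_simps)
    let ?Z = "zonal p e"
    have Z: "solid_harmonic p ?Z" by (rule solid_harmonic_zonal[OF e])
    have ZZ: "(LINT y|?\<sigma>. (?Z y)\<^sup>2) = M * G1"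
      using zonal_reproducing[OF Z e] n e
      by (simp add: M_def power2_eq_square zonal_sphere[OF e] G1_def norm_eq_1)
    have "0 \<le> (LINT y|?\<sigma>. (?Z y)\<^sup>2)" by simp
    then have G1: "0 \<le> G1" using ZZ M by (simp add: zero_le_mult_iff)
    obtain m where m: "p = Suc m" using p by (cases p) auto
    have cap: "(LINT y|?\<sigma>. indicator {y. 1 - (e \<bullet> y)\<^sup>2 \<le> (1 / real p)\<^sup>2} y * (?Z y)\<^sup>2) \<le> C1 * (1 / real p) * (M * G1)"
      using polar_cap_mass[of m ?Z e d "1 / real p"] Z e d m ZZ unfolding C1_def by simp
    let ?A = "sphere 0 1 \<inter> {y :: real ^ 'n. 1 - (e \<bullet> y)\<^sup>2 \<le> s\<^sup>2}"
    let ?B = "{y :: real ^ 'n. 1 - (e \<bullet> y)\<^sup>2 \<le> (1 / real p)\<^sup>2}"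
    have Am: "?A \<in> sets ?\<sigma>"
      unfolding sets_sphere_measure sets_restrict_space by auto
    have Bm: "indicator ?B \<in> borel_measurable ?\<sigma>" by (intro measurable_sphere_borel) measurable
    have poly: "real_polynomial_function ?Z" using Z by (rule solid_harmonicD)
    have Z2: "integrable ?\<sigma> (\<lambda>y. (?Z y)\<^sup>2)"
      by (intro integrable_sphere continuous_intros continuous_on_real_polynomial_function[OF poly])
    have "G1\<^sup>2 / 4 * measure ?\<sigma> ?A = (LINT y|?\<sigma>. G1\<^sup>2 / 4 * indicator ?A y)"
    proof -
      have "?A \<inter> sphere 0 1 = ?A" by auto
      then show ?thesis using Am by simp
    qed
    also have "\<dots> \<le> (LINT y|?\<sigma>. indicator ?B y * (?Z y)\<^sup>2)"
    proof (rule integral_mono)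
      show "integrable ?\<sigma> (\<lambda>y. G1\<^sup>2 / 4 * indicator ?A y)"
        using Am by (intro integrable_mult_right integrable_real_indicator) (auto simp: sphere.emeasure_eq_measure)
      show "integrable ?\<sigma> (\<lambda>y. indicator ?B y * (?Z y)\<^sup>2)"
        by (rule Bochner_Integration.integrable_bound[OF Z2 borel_measurable_times[OF Bm borel_measurable_integrable[OF Z2]]])
           (auto simp: indicator_def)
      fix y assume "y \<in> space ?\<sigma>"
      then have y: "norm y = 1" by simp
      show "G1\<^sup>2 / 4 * indicator ?A y \<le> indicator ?B y * (?Z y)\<^sup>2"
      proof (cases "y \<in> ?A")
        case True
        have "e \<bullet> y \<in> {-1..1}" using inner_sphere_bound[OF e] y by simp
        then have "G1\<^sup>2 \<le> 4 * (gegenbauer ?n p (e \<bullet> y))\<^sup>2"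
          unfolding G1_def using True by (intro gegenbauer_cap[OF nn n(2) p]) (auto simp: s_def)
        moreover have "s\<^sup>2 \<le> (1 / real p)\<^sup>2" using s by (intro power_mono) auto
        ultimately show ?thesis using True y by (auto simp: indicator_def zonal_sphere)
      next
        case False
        then have "indicator ?A y = (0 :: real)" by (rule indicator_simps(2))
        then show ?thesis by (simp only: mult_zero_right) simp
      qed
    qed
    also note cap
    finally have 1: "G1\<^sup>2 / 4 * measure ?\<sigma> ?A \<le> C1 * (1 / real p) * (M * G1)" .
    have "c2 * s ^ (N + 1) \<le> measure ?\<sigma> ?A"
    proof -
      have "c2 * s ^ (N + 1) = ?n * unit_ball_vol ?n / (2 * s) * (s / 4) ^ CARD('n)"
        unfolding c2_def n(1) using s by (simp add: power_divide field_simps)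
      then show ?thesis using cap_measure_lower[OF e s(1,2)] by simp
    qed
    then have "G1\<^sup>2 / 4 * (c2 * s ^ (N + 1)) \<le> C1 * (1 / real p) * (M * G1)"
      using 1 mult_left_mono[of "c2 * s ^ (N + 1)" "measure ?\<sigma> ?A" "G1\<^sup>2 / 4"] by simp
    then have 2: "G1 * (G1 * (c2 * s ^ (N + 1))) \<le> G1 * (4 * C1 * (1 / real p) * M)"
      by (simp add: power2_eq_square mult_ac)
    have 3: "G1 * (c2 * s ^ (N + 1)) \<le> 4 * C1 * (1 / real p) * M"
    proof (cases "G1 = 0")
      case True
      then show ?thesis using C1 M by simp
    next
      case False
      then show ?thesis using mult_left_le_imp_le[OF 2] G1 by simp
    qed
    have "s ^ (N + 1) * (4 * ?n) ^ (N + 1) * real p ^ (N + 1) = (s * (4 * ?n) * real p) ^ (N + 1)"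
      by (simp only: power_mult_distrib)
    also have "s * (4 * ?n) * real p = 1" using np by (simp add: s_def)
    finally have sn: "s ^ (N + 1) * (4 * ?n) ^ (N + 1) * real p ^ (N + 1) = 1" by simp
    have "G1 * c2 = G1 * (c2 * s ^ (N + 1)) * ((4 * ?n) ^ (N + 1) * real p ^ (N + 1))"
      using sn by (simp add: mult_ac)
    also have "\<dots> \<le> 4 * C1 * (1 / real p) * M * ((4 * ?n) ^ (N + 1) * real p ^ (N + 1))"
      using 3 by (intro mult_right_mono) auto
    also have "\<dots> = C * M * real p ^ N * c2"
      using c2 np by (simp add: C_def)
    finally have "G1 \<le> C * M * real p ^ N" using c2 by simp
    then show ?thesis using G1 by (simp add: G1_def M_def)
  qed
  show ?thesis using Cpos main by blast
qed

section \<open>The bilinear estimate\<close>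

lemma dyadic_level:
  fixes x :: real
  assumes "1 < x" "x \<le> 2 ^ J"
  obtains j where "1 \<le> j" "j \<le> J" "2 ^ (j - 1) < x" "x \<le> 2 ^ j"
proof -
  define j where "j = (LEAST j. x \<le> 2 ^ j)"
  have j: "x \<le> 2 ^ j" "j \<le> J"
    unfolding j_def using assms(2) by (auto intro: LeastI Least_le)
  have "j \<noteq> 0" using j assms by (metis leD power_0)
  moreover from this have "\<not> x \<le> 2 ^ (j - 1)"
    unfolding j_def by (intro not_less_Least) auto
  ultimately show ?thesis using that[of j] j by auto
qed

text \<open>Where 2^(j-1) < p sin \<theta> \<le> 2^j, the single term j suffices; the others are
  nonnegative, so full caps may stand in for annuli. The factor \<rho>^2 in the condition on B pays
  for using the decay at 2^(j-1) instead of 2^j.\<close>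

lemma gegenbauer_dyadic_bound:
  fixes n :: real
  assumes n: "n = real N + 2" "N \<ge> 1" and p: "p \<ge> 1" and t: "t \<in> {-1..1}" and J: "real p \<le> 2 ^ J"
    and \<rho>: "\<rho> > 0" "\<rho>\<^sup>2 = 1 / 2 ^ N"
    and B: "B \<ge> 1" "exp \<bar>(real N / 2)\<^sup>2 - real N / 2\<bar> * (2 * (real N / 2)\<^sup>2 + 3) \<le> B\<^sup>2 * \<rho>\<^sup>2"
  shows "\<bar>gegenbauer n p t\<bar> \<le> B * \<bar>gegenbauer n p 1\<bar> *
    (\<Sum>j\<le>J. \<rho> ^ j * indicator {t. 1 - t\<^sup>2 \<le> (2 ^ j / real p)\<^sup>2} t)"
proof -
  let ?G = "gegenbauer n p"
  define s where "s = sqrt (1 - t\<^sup>2)"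
  have t2: "t\<^sup>2 \<le> 1" using t by (auto simp: abs_square_le_1)
  then have s: "0 \<le> s" "s\<^sup>2 = 1 - t\<^sup>2" "s \<le> 1" by (auto simp: s_def)
  have pp: "real p > 0" using p by simp
  let ?f = "\<lambda>j. \<rho> ^ j * indicator {t. 1 - t\<^sup>2 \<le> (2 ^ j / real p)\<^sup>2} t"
  have f0: "0 \<le> ?f j" for j using \<rho> by simp
  have single: "?f j \<le> (\<Sum>j\<le>J. ?f j)" if "j \<le> J" for j
    using that by (intro member_le_sum f0) auto
  have f: "?f j = \<rho> ^ j" if "real p * s \<le> 2 ^ j" for j
  proof -
    have "s \<le> 2 ^ j / real p" using that pp by (simp add: field_simps)
    then have "s\<^sup>2 \<le> (2 ^ j / real p)\<^sup>2" using s by (intro power_mono) auto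
    then show ?thesis using s by (simp add: indicator_def)
  qed
  have suff: ?thesis if "\<bar>?G t\<bar> \<le> B * \<bar>?G 1\<bar> * ?f j" "j \<le> J" for j
    by (rule order_trans[OF that(1) mult_left_mono[OF single[OF that(2)]]]) (use B in auto)
  show ?thesis
  proof (cases "real p * s \<le> 1")
    case True
    have "\<bar>?G t\<bar> \<le> \<bar>?G 1\<bar>" by (rule abs_gegenbauer_le_1[OF n p t])
    also have "\<dots> \<le> B * \<bar>?G 1\<bar> * ?f 0"
      using f[of 0] True B mult_right_mono[of 1 B "\<bar>?G 1\<bar>"] by simp
    finally show ?thesis using suff[of 0] by simp
  next
    case False
    have "real p * s \<le> real p * 1" using s by (intro mult_left_mono) auto
    then have "real p * s \<le> 2 ^ J" using J by linarith
    with False obtain j where j: "1 \<le> j" "j \<le> J" "2 ^ (j - 1) < real p * s" "real p * s \<le> 2 ^ j"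
      using dyadic_level[of "real p * s" J] by auto
    have "(?G t)\<^sup>2 * (real p * s) ^ N \<le> (B\<^sup>2 * \<rho>\<^sup>2) * (?G 1)\<^sup>2"
      using gegenbauer_decay[OF n p t] False mult_right_mono[OF B(2), of "(?G 1)\<^sup>2"] by (simp add: s_def)
    moreover have "(?G t)\<^sup>2 * (2 ^ (j - 1)) ^ N \<le> (?G t)\<^sup>2 * (real p * s) ^ N"
      using j by (intro mult_left_mono power_mono) auto
    ultimately have 1: "(?G t)\<^sup>2 * (2 ^ (j - 1)) ^ N \<le> (B\<^sup>2 * \<rho>\<^sup>2) * (?G 1)\<^sup>2" by linarith
    have 2: "(2 ^ (j - 1)) ^ N * (\<rho>\<^sup>2) ^ (j - 1) = 1"
      unfolding \<rho>(2) by (simp add: power_divide flip: power_mult)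
    have "(?G t)\<^sup>2 = (?G t)\<^sup>2 * (2 ^ (j - 1)) ^ N * (\<rho>\<^sup>2) ^ (j - 1)"
      using 2 by (simp add: mult.assoc)
    also have "\<dots> \<le> (B\<^sup>2 * \<rho>\<^sup>2) * (?G 1)\<^sup>2 * (\<rho>\<^sup>2) ^ (j - 1)"
      using 1 by (intro mult_right_mono) auto
    also have "\<dots> = (B * \<bar>?G 1\<bar> * \<rho> ^ j)\<^sup>2"
      using j(1) by (cases j) (auto simp: power_mult_distrib power_even_eq[symmetric] power2_eq_square mult_ac simp flip: power_mult)
    finally have "\<bar>?G t\<bar> \<le> \<bar>B * \<bar>?G 1\<bar> * \<rho> ^ j\<bar>" by (simp only: abs_le_square_iff)
    also have "\<dots> = B * \<bar>?G 1\<bar> * \<rho> ^ j" using B \<rho> by (simp add: abs_mult)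
    finally show ?thesis using suff[of j] f[OF j(4)] j(2) by simp
  qed
qed

lemma exists_dyadic:
  assumes "p \<ge> (1::nat)"
  obtains J :: nat where "real p \<le> 2 ^ J" "2 ^ J < 2 * real p"
proof -
  define J where "J = (LEAST j. real p \<le> 2 ^ j)"
  have ex: "real p \<le> 2 ^ p"
    using of_nat_less_two_power[of p, where ?'a = real] by linarith
  then have J: "real p \<le> 2 ^ J" unfolding J_def by (rule LeastI)
  have "2 ^ J < 2 * real p"
  proof (cases J)
    case 0
    then show ?thesis using assms by simp
  next
    case (Suc j)
    have "\<not> real p \<le> 2 ^ j" using not_less_Least[of j "\<lambda>j. real p \<le> 2 ^ j"] Suc by (simp add: J_def)
    then show ?thesis using Suc by simp
  qed
  with J show ?thesis using that by blast
qed

text \<open>The pole value contributes M p^N, and the caps of level j contribute the weight \<rho>^j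
  times the mass fraction 2^j / p from \<open>polar_cap_mass\<close>.\<close>

lemma zonal_mass_bound:
  assumes n: "CARD('n::finite) = N + 2" "N \<ge> 1" and \<rho>: "\<rho> > 0" "\<rho>\<^sup>2 = 1 / 2 ^ N"
  shows "\<exists>C>0. \<forall>p q J. \<forall>Q :: real ^ 'n \<Rightarrow> real. \<forall>x \<in> sphere 0 1. 1 \<le> p \<longrightarrow> p \<le> q \<longrightarrow> real p \<le> 2 ^ J \<longrightarrow>
    solid_harmonic q Q \<longrightarrow> (LINT y|sphere_measure. \<bar>zonal p x y\<bar> * (Q y)\<^sup>2)
      \<le> C * moment TYPE('n) p * (real p ^ (N - 1) * (\<Sum>j\<le>J. (2 * \<rho>) ^ j)) * (LINT y|sphere_measure. (Q y)\<^sup>2)"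
proof -
  let ?n = "real CARD('n)"
  let ?\<sigma> = "sphere_measure :: (real ^ 'n) measure"
  have nn: "?n = real N + 2" using n by simp
  define d where "d = ?n - 1"
  have d: "d = ?n - 1" "1 \<le> d" using n by (auto simp: d_def)
  define C1 where "C1 = 18 * (2 * (d\<^sup>2 + 7 * d + 25))"
  have C1: "C1 > 0" using d by (simp add: C1_def add_nonneg_pos)
  obtain C2 where C2: "C2 > 0" "\<And>p. p \<ge> 1 \<Longrightarrow> 0 \<le> gegenbauer ?n p 1 \<and> gegenbauer ?n p 1 \<le> C2 * moment TYPE('n) p * real p ^ N"
    using zonal_pole_bound[where 'n = 'n, OF n] by blast
  define E where "E = exp \<bar>(real N / 2)\<^sup>2 - real N / 2\<bar> * (2 * (real N / 2)\<^sup>2 + 3)"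
  define B where "B = max 1 (sqrt E / \<rho>)"
  have E: "0 \<le> E" by (simp add: E_def)
  have B: "B \<ge> 1" "E \<le> B\<^sup>2 * \<rho>\<^sup>2"
  proof -
    show "B \<ge> 1" by (simp add: B_def)
    have "sqrt E \<le> B * \<rho>" using \<rho> by (simp add: B_def pos_divide_le_eq[symmetric])
    then have "(sqrt E)\<^sup>2 \<le> (B * \<rho>)\<^sup>2" using E by (intro power_mono) auto
    then show "E \<le> B\<^sup>2 * \<rho>\<^sup>2" using E by (simp add: power_mult_distrib)
  qed
  have "(LINT y|?\<sigma>. \<bar>zonal p x y\<bar> * (Q y)\<^sup>2)
      \<le> (B * C2 * C1) * moment TYPE('n) p * (real p ^ (N - 1) * (\<Sum>j\<le>J. (2 * \<rho>) ^ j)) * (LINT y|?\<sigma>. (Q y)\<^sup>2)"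
    if x: "x \<in> sphere 0 1" and p: "1 \<le> p" and pq: "p \<le> q" and J: "real p \<le> 2 ^ J" and Q: "solid_harmonic q Q"
    for p q J x and Q :: "real ^ 'n \<Rightarrow> real"
  proof -
    define G1 where "G1 = gegenbauer ?n p 1"
    define I where "I = (LINT y|?\<sigma>. (Q y)\<^sup>2)"
    have G1: "0 \<le> G1" "G1 \<le> C2 * moment TYPE('n) p * real p ^ N" using C2(2)[OF p] by (auto simp: G1_def)
    have I: "0 \<le> I" by (simp add: I_def)
    obtain m where m: "q = Suc m" using p pq by (cases q) auto
    have x1: "norm x = 1" using x by simp
    have pp: "real p > 0" using p by simp
    have poly: "real_polynomial_function Q" using Q by (rule solid_harmonicD)
    have Q2: "integrable ?\<sigma> (\<lambda>y. (Q y)\<^sup>2)"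
      by (intro integrable_sphere continuous_intros continuous_on_real_polynomial_function[OF poly])
    let ?S = "\<lambda>j. {y :: real ^ 'n. 1 - (x \<bullet> y)\<^sup>2 \<le> (2 ^ j / real p)\<^sup>2}"
    have Sm: "indicator (?S j) \<in> borel_measurable ?\<sigma>" for j by (intro measurable_sphere_borel) measurable
    have SQ: "integrable ?\<sigma> (\<lambda>y. indicator (?S j) y * (Q y)\<^sup>2)" for j
      by (rule Bochner_Integration.integrable_bound[OF Q2 borel_measurable_times[OF Sm borel_measurable_integrable[OF Q2]]])
         (auto simp: indicator_def)
    \<comment> \<open>Since p \<le> q, the radius 2^j / p is at least 1/q, as the cap estimate for Q
      demands.\<close>
    have mass: "(LINT y|?\<sigma>. indicator (?S j) y * (Q y)\<^sup>2) \<le> C1 * (2 ^ j / real p) * I" for j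
    proof -
      have "real p \<le> real (Suc m)" using pq m by simp
      also have "real (Suc m) * 1 \<le> real (Suc m) * 2 ^ j" by (intro mult_left_mono) auto
      finally have "1 \<le> real (Suc m) * (2 ^ j / real p)" using pp by (simp add: field_simps)
      then show ?thesis
        using polar_cap_mass[of m Q x d "2 ^ j / real p"] Q x1 d m unfolding C1_def I_def by simp
    qed
    have "(LINT y|?\<sigma>. \<bar>zonal p x y\<bar> * (Q y)\<^sup>2)
        \<le> (LINT y|?\<sigma>. B * G1 * (\<Sum>j\<le>J. \<rho> ^ j * (indicator (?S j) y * (Q y)\<^sup>2)))"
    proof (rule integral_mono)
      show "integrable ?\<sigma> (\<lambda>y. \<bar>zonal p x y\<bar> * (Q y)\<^sup>2)"
        by (intro integrable_sphere continuous_intros continuous_on_zonal_pair continuous_on_real_polynomial_function[OF poly])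
      show "integrable ?\<sigma> (\<lambda>y. B * G1 * (\<Sum>j\<le>J. \<rho> ^ j * (indicator (?S j) y * (Q y)\<^sup>2)))"
        by (intro integrable_mult_right Bochner_Integration.integrable_sum SQ)
      fix y assume "y \<in> space ?\<sigma>"
      then have y: "y \<in> sphere 0 1" by simp
      have "\<bar>gegenbauer ?n p (x \<bullet> y)\<bar> \<le> B * \<bar>gegenbauer ?n p 1\<bar> *
          (\<Sum>j\<le>J. \<rho> ^ j * indicator {t. 1 - t\<^sup>2 \<le> (2 ^ j / real p)\<^sup>2} (x \<bullet> y))"
        using B unfolding E_def by (intro gegenbauer_dyadic_bound[OF nn n(2) p inner_sphere_bound[OF x1 y] J \<rho>])
      then have "\<bar>zonal p x y\<bar> \<le> B * G1 * (\<Sum>j\<le>J. \<rho> ^ j * indicator (?S j) y)"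
        using G1 y by (simp add: zonal_sphere G1_def indicator_def)
      then have "\<bar>zonal p x y\<bar> * (Q y)\<^sup>2 \<le> B * G1 * (\<Sum>j\<le>J. \<rho> ^ j * indicator (?S j) y) * (Q y)\<^sup>2"
        by (rule mult_right_mono) simp
      also have "\<dots> = B * G1 * (\<Sum>j\<le>J. \<rho> ^ j * (indicator (?S j) y * (Q y)\<^sup>2))"
        by (simp only: sum_distrib_right mult.assoc)
      finally show "\<bar>zonal p x y\<bar> * (Q y)\<^sup>2 \<le> B * G1 * (\<Sum>j\<le>J. \<rho> ^ j * (indicator (?S j) y * (Q y)\<^sup>2))" .
    qed
    also have "\<dots> = B * G1 * (\<Sum>j\<le>J. \<rho> ^ j * (LINT y|?\<sigma>. indicator (?S j) y * (Q y)\<^sup>2))"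
      using SQ by (simp only: integral_mult_right_zero Bochner_Integration.integral_sum integrable_mult_right)
    also have "\<dots> \<le> B * G1 * (\<Sum>j\<le>J. \<rho> ^ j * (C1 * (2 ^ j / real p) * I))"
      using B G1 \<rho> by (intro mult_left_mono sum_mono mass mult_nonneg_nonneg) auto
    also have "\<dots> = G1 * (B * (C1 * I / real p * (\<Sum>j\<le>J. (2 * \<rho>) ^ j)))"
      by (simp add: sum_distrib_left power_mult_distrib mult_ac)
    also have "\<dots> \<le> C2 * moment TYPE('n) p * real p ^ N * (B * (C1 * I / real p * (\<Sum>j\<le>J. (2 * \<rho>) ^ j)))"
      using B C1 I \<rho> pp by (intro mult_right_mono G1 mult_nonneg_nonneg divide_nonneg_nonneg sum_nonneg) auto
    also have "real p ^ N = real p * real p ^ (N - 1)" using n(2) by (cases N) auto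
    also have "C2 * moment TYPE('n) p * (real p * real p ^ (N - 1)) * (B * (C1 * I / real p * (\<Sum>j\<le>J. (2 * \<rho>) ^ j)))
      = (B * C2 * C1) * moment TYPE('n) p * (real p ^ (N - 1) * (\<Sum>j\<le>J. (2 * \<rho>) ^ j)) * I"
      using pp by (simp add: field_simps)
    finally show ?thesis by (simp add: I_def)
  qed
  moreover have "B * C2 * C1 > 0" using B C1 C2 by simp
  ultimately show ?thesis by blast
qed

section \<open>Comparison of the geometric sum with Lambda\<close>

lemma Lambda_2_square:
  assumes p: "2 \<le> p"
  shows "(Lambda 2 p)\<^sup>2 = sqrt (real p)"
proof -
  have "(Lambda 2 p)\<^sup>2 = (real p powr (1/4)) powr 2" using p by (simp add: Lambda_def powr_numeral)
  also have "\<dots> = real p powr (1 / 2)" by (simp only: powr_powr) simp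
  finally show ?thesis by (simp add: powr_half_sqrt)
qed
lemma Lambda_3_square:
  assumes p: "2 \<le> p"
  shows "(Lambda 3 p)\<^sup>2 = real p * ln (real p)"
proof -
  have "0 < ln (real p)" using p by simp
  have "(Lambda 3 p)\<^sup>2 = (real p powr (1/2)) ^ 2 * (ln (real p) powr (1/2)) ^ 2" using p by (simp add: Lambda_def power_mult_distrib)
  also have "\<dots> = real p * ln (real p)" using p by (simp add: powr_half_sqrt)
  finally show ?thesis .
qed
lemma Lambda_square:
  assumes p: "3 \<le> N" "2 \<le> p"
  shows "(Lambda (N + 1) p)\<^sup>2 = real p ^ (N - 1)"
proof -
  have "(Lambda (N + 1) p)\<^sup>2 = (real p powr (real (N - 1) / 2)) powr 2"
    using p by (simp add: Lambda_def powr_numeral of_nat_diff)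
  also have "\<dots> = real p powr real (N - 1)" by (simp only: powr_powr) simp
  finally show ?thesis using p powr_realpow[of "real p" "N - 1"] by simp
qed

text \<open>The ratio 2^(1 - N/2) is sqrt 2 for N = 1, where the last term dominates and is
  comparable to sqrt p; it is 1 for N = 2, where the J + 1 terms are counted; and it is at most 1 /
  sqrt 2 for larger N, where the series converges.\<close>

lemma dyadic_sum_bound:
  assumes N: "N \<ge> 1"
  shows "\<exists>C>0. \<forall>p J. 2 \<le> p \<longrightarrow> 2 ^ J < 2 * real p \<longrightarrow>
    real p ^ (N - 1) * (\<Sum>j\<le>J. (2 * (1 / sqrt 2) ^ N) ^ j) \<le> C * (Lambda (N + 1) p)\<^sup>2"
proof -
  consider "N = 1" | "N = 2" | "N \<ge> 3" using N by linarith
  then show ?thesis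
  proof cases
    case 1
    define r where "r = sqrt 2"
    have r: "r > 1" "r\<^sup>2 = 2" by (auto simp: r_def)
    have r': "2 * (1 / sqrt 2) ^ N = r" using 1 by (simp add: r_def real_div_sqrt)
    have "real p ^ (N - 1) * (\<Sum>j\<le>J. r ^ j) \<le> (2 * r / (r - 1)) * (Lambda (N + 1) p)\<^sup>2"
      if p: "2 \<le> p" and J: "2 ^ J < 2 * real p" for p J
    proof -
      have L: "(Lambda (N + 1) p)\<^sup>2 = sqrt (real p)"
        using Lambda_2_square[OF p] 1 by (simp add: numeral_2_eq_2)
      have "r ^ Suc J - 1 \<le> r * (r * sqrt (real p))"
      proof -
        have "(r ^ J)\<^sup>2 = (r\<^sup>2) ^ J" by (simp only: power_mult[of r J 2, symmetric] power_mult[of r 2 J, symmetric] mult.commute[of J 2])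
        then have "sqrt ((r ^ J)\<^sup>2) = sqrt (2 ^ J)" by (simp only: r(2))
        moreover have "sqrt ((r ^ J)\<^sup>2) = r ^ J" using r by (intro real_sqrt_unique) auto
        ultimately have "r ^ J = sqrt (2 ^ J)" by simp
        also have "\<dots> \<le> sqrt (2 * real p)" using J by simp
        also have "\<dots> = r * sqrt (real p)" by (simp add: r_def real_sqrt_mult)
        finally have "r ^ J \<le> r * sqrt (real p)" .
        then have "r * r ^ J \<le> r * (r * sqrt (real p))" using r by (intro mult_left_mono) auto
        then show ?thesis unfolding power_Suc by linarith
      qed
      moreover have "r \<le> 2" by (rule power2_le_imp_le) (use r in auto)
      then have "r * (r * sqrt (real p)) \<le> 2 * (r * sqrt (real p))"
        using r by (intro mult_right_mono) auto
      ultimately have "r ^ Suc J - 1 \<le> 2 * (r * sqrt (real p))" by linarith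
      then have "(r ^ Suc J - 1) / (r - 1) \<le> 2 * (r * sqrt (real p)) / (r - 1)"
        using r by (intro divide_right_mono) auto
      moreover have "(\<Sum>j\<le>J. r ^ j) = (r ^ Suc J - 1) / (r - 1)"
        using r geometric_sum[of r "Suc J"] by (simp only: lessThan_Suc_atMost)
      moreover have "real p ^ (N - 1) = 1" using 1 by simp
      ultimately have "real p ^ (N - 1) * (\<Sum>j\<le>J. r ^ j) \<le> 2 * r / (r - 1) * sqrt (real p)"
        by (simp only: mult_1_left) (simp only: times_divide_eq_left mult.assoc)
      then show ?thesis by (simp only: L)
    qed
    moreover have "2 * r / (r - 1) > 0" using r by simp
    ultimately show ?thesis unfolding r' by blast
  next
    case 2
    have r': "2 * (1 / sqrt 2) ^ N = 1" using 2 by (simp add: power_divide)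
    have "real p ^ (N - 1) * (\<Sum>j\<le>J. 1 ^ j) \<le> (3 / ln 2) * (Lambda (N + 1) p)\<^sup>2"
      if p: "2 \<le> p" and J: "2 ^ J < 2 * real p" for p J
    proof -
      have lp: "ln 2 \<le> ln (real p)" "0 < ln (real p)" using p by auto
      have L: "(Lambda (N + 1) p)\<^sup>2 = real p * ln (real p)"
        using Lambda_3_square[OF p] 2 by simp
      have "real J * ln 2 = ln (2 ^ J)" by (simp add: ln_realpow)
      also have "\<dots> \<le> ln (2 * real p)" using J p by simp
      also have "\<dots> = ln 2 + ln (real p)" using p by (simp add: ln_mult)
      \<comment> \<open>Passing from J to J + 1 costs another ln 2; both copies are at most ln p
        because p \<ge> 2. At p = 1 the right-hand side would vanish.\<close>
      finally have "(real J + 1) * ln 2 \<le> 3 * ln (real p)" using lp by (simp add: algebra_simps)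
      then have "real J + 1 \<le> 3 / ln 2 * ln (real p)" by (simp add: field_simps)
      then have "real p * (real J + 1) \<le> real p * (3 / ln 2 * ln (real p))" by (intro mult_left_mono) auto
      then show ?thesis using L 2 by (simp add: mult_ac add_ac)
    qed
    moreover have "3 / ln (2 :: real) > 0" by simp
    ultimately show ?thesis unfolding r' by blast
  next
    case 3
    define r where "r = 1 / sqrt (2 :: real)"
    have r: "0 < r" "r < 1" "r\<^sup>2 = 1 / 2" by (auto simp: r_def power_divide)
    \<comment> \<open>Among N \<ge> 3 the ratio is largest at N = 3, where 2 r^3 = r.\<close>
    have rN: "2 * r ^ N \<le> r" "0 \<le> 2 * r ^ N"
    proof -
      have "r ^ N \<le> r ^ 3" using r 3 by (intro power_decreasing) auto
      also have "r ^ 3 = r\<^sup>2 * r" by (simp add: power2_eq_square power3_eq_cube)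
      finally show "2 * r ^ N \<le> r" using r by simp
      show "0 \<le> 2 * r ^ N" using r by simp
    qed
    have "real p ^ (N - 1) * (\<Sum>j\<le>J. (2 * r ^ N) ^ j) \<le> (1 / (1 - r)) * (Lambda (N + 1) p)\<^sup>2"
      if p: "2 \<le> p" for p J
    proof -
      have L: "(Lambda (N + 1) p)\<^sup>2 = real p ^ (N - 1)"
        by (rule Lambda_square[OF 3 p])
      have "(\<Sum>j\<le>J. (2 * r ^ N) ^ j) \<le> (\<Sum>j\<le>J. r ^ j)"
        using rN by (intro sum_mono power_mono)
      also have "\<dots> = (1 - r ^ Suc J) / (1 - r)"
        using r sum_gp0[of r J] by simp
      also have "\<dots> \<le> 1 / (1 - r)" using r by (intro divide_right_mono) auto
      finally have "real p ^ (N - 1) * (\<Sum>j\<le>J. (2 * r ^ N) ^ j) \<le> real p ^ (N - 1) * (1 / (1 - r))"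
        by (intro mult_left_mono) auto
      then show ?thesis by (simp only: L mult.commute)
    qed
    moreover have "1 / (1 - r) > 0" using r by simp
    ultimately show ?thesis unfolding r_def[symmetric] by blast
  qed
qed

lemma solid_harmonic_product_bound:
  fixes N :: nat
  assumes n: "CARD('n::finite) = N + 2" "N \<ge> 1"
  shows "\<exists>C>0. \<forall>p q. \<forall>P Q :: real ^ 'n \<Rightarrow> real. 2 \<le> p \<longrightarrow> p \<le> q \<longrightarrow> solid_harmonic p P \<longrightarrow> solid_harmonic q Q \<longrightarrow>
    (LINT x|sphere_measure. (P x)\<^sup>2 * (Q x)\<^sup>2)
      \<le> C * (Lambda (N + 1) p)\<^sup>2 * (LINT x|sphere_measure. (P x)\<^sup>2) * (LINT x|sphere_measure. (Q x)\<^sup>2)"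
proof -
  let ?\<sigma> = "sphere_measure :: (real ^ 'n) measure"
  define \<rho> where "\<rho> = (1 / sqrt 2) ^ N"
  have \<rho>: "\<rho> > 0" "\<rho>\<^sup>2 = 1 / 2 ^ N"
  proof -
    show "\<rho> > 0" by (simp add: \<rho>_def)
    have "\<rho>\<^sup>2 = ((1 / sqrt 2)\<^sup>2) ^ N"
      unfolding \<rho>_def by (simp only: power_mult[of _ N 2, symmetric] power_mult[of _ 2 N, symmetric] mult.commute[of N 2])
    then show "\<rho>\<^sup>2 = 1 / 2 ^ N" by (simp add: power_divide)
  qed
  obtain C1 where C1: "C1 > 0" "\<And>p q J Q x. \<lbrakk>x \<in> sphere 0 1; 1 \<le> p; p \<le> q; real p \<le> 2 ^ J; solid_harmonic q Q\<rbrakk> \<Longrightarrow>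
     (LINT y|?\<sigma>. \<bar>zonal p x y\<bar> * (Q y)\<^sup>2)
      \<le> C1 * moment TYPE('n) p * (real p ^ (N - 1) * (\<Sum>j\<le>J. (2 * \<rho>) ^ j)) * (LINT y|?\<sigma>. (Q y)\<^sup>2)"
    using zonal_mass_bound[where 'n = 'n, OF n \<rho>] by blast
  obtain C2 where C2: "C2 > 0" "\<And>p J. \<lbrakk>2 \<le> p; 2 ^ J < 2 * real p\<rbrakk> \<Longrightarrow>
     real p ^ (N - 1) * (\<Sum>j\<le>J. (2 * \<rho>) ^ j) \<le> C2 * (Lambda (N + 1) p)\<^sup>2"
    using dyadic_sum_bound[OF n(2)] unfolding \<rho>_def by blast
  have "(LINT x|?\<sigma>. (P x)\<^sup>2 * (Q x)\<^sup>2)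
      \<le> (C1 * C2) * (Lambda (N + 1) p)\<^sup>2 * (LINT x|?\<sigma>. (P x)\<^sup>2) * (LINT x|?\<sigma>. (Q x)\<^sup>2)"
    if p: "2 \<le> p" and pq: "p \<le> q" and P: "solid_harmonic p P" and Q: "solid_harmonic q Q"
    for p q and P Q :: "real ^ 'n \<Rightarrow> real"
  proof -
    define M where "M = moment TYPE('n) p"
    define I where "I = (LINT x|?\<sigma>. (P x)\<^sup>2)"
    define S where "S = C1 * M * (C2 * (Lambda (N + 1) p)\<^sup>2) * (LINT y|?\<sigma>. (Q y)\<^sup>2)"
    define A where "A = (LINT x|?\<sigma>. (P x)\<^sup>2 * (Q x)\<^sup>2)"
    have M: "M > 0" unfolding M_def using measure_sphere_pos[where 'n = 'n] n by (intro moment_const_pos) auto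
    have I: "0 \<le> I" by (simp add: I_def)
    have S0: "0 \<le> S" using C1 C2 M by (simp add: S_def)
    have p1: "1 \<le> p" using p by simp
    obtain J where J: "real p \<le> 2 ^ J" "2 ^ J < 2 * real p" using exists_dyadic[OF p1] by blast
    have S: "(LINT y|?\<sigma>. \<bar>zonal p x y\<bar> * (Q y)\<^sup>2) \<le> S" if x: "x \<in> sphere 0 1" for x
    proof -
      note C1(2)[OF x p1 pq J(1) Q]
      also have "C1 * moment TYPE('n) p * (real p ^ (N - 1) * (\<Sum>j\<le>J. (2 * \<rho>) ^ j)) * (LINT y|?\<sigma>. (Q y)\<^sup>2)
          \<le> C1 * M * (C2 * (Lambda (N + 1) p)\<^sup>2) * (LINT y|?\<sigma>. (Q y)\<^sup>2)"
        unfolding M_def[symmetric] using C1 M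
        by (intro mult_right_mono mult_left_mono C2(2)[OF p J(2)]) auto
      finally show ?thesis by (simp add: S_def)
    qed
    have cQ: "continuous_on (sphere 0 1) Q"
      using Q by (intro continuous_on_real_polynomial_function solid_harmonicD)
    \<comment> \<open>\<open>restriction_bound\<close> asks for a positive S, but S is 0 when Q
      vanishes on the sphere; hence S + \<eta> with \<eta> tending to 0. The 1 in I + 1 guards
      against P vanishing there.\<close>
    have "M * A \<le> S * I"
    proof (rule field_le_epsilon)
      fix \<epsilon> :: real assume \<epsilon>: "\<epsilon> > 0"
      define \<eta> where "\<eta> = \<epsilon> / (I + 1)"
      have \<eta>: "\<eta> > 0" "\<eta> * I \<le> \<epsilon>" using \<epsilon> I by (auto simp: \<eta>_def field_simps)
      have "M * A \<le> (S + \<eta>) * I"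
        unfolding A_def I_def
        using S \<eta>(1) S0 by (intro restriction_bound[OF P cQ _ M_def]) (use n in \<open>auto intro: add_increasing2\<close>)
      also have "\<dots> \<le> S * I + \<epsilon>" using \<eta> by (simp add: distrib_right)
      finally show "M * A \<le> S * I + \<epsilon>" .
    qed
    also have "S * I = M * ((C1 * C2) * (Lambda (N + 1) p)\<^sup>2 * I * (LINT x|?\<sigma>. (Q x)\<^sup>2))"
      by (simp add: S_def mult_ac)
    finally show ?thesis using M by (simp add: A_def I_def)
  qed
  moreover have "C1 * C2 > 0" using C1 C2 by simp
  ultimately show ?thesis by blast
qed

section \<open>From real to complex harmonics\<close>

lemma partial_deriv_Complex:
  fixes f g :: "real ^ 'n \<Rightarrow> real"
  assumes "real_polynomial_function f" "real_polynomial_function g"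
  shows "partial_deriv i (\<lambda>x. Complex (f x) (g x)) = (\<lambda>x. Complex (pd i f x) (pd i g x))"
proof
  fix x
  have "((\<lambda>x. of_real (f x) + \<i> * of_real (g x)) has_derivative
      (\<lambda>h. of_real (grad f x \<bullet> h) + \<i> * of_real (grad g x \<bullet> h))) (at x)"
    by (intro has_derivative_add has_derivative_mult_right has_derivative_of_real has_derivative_grad assms)
  note D = frechet_derivative_at[OF this]
  show "partial_deriv i (\<lambda>x. Complex (f x) (g x)) x = Complex (pd i f x) (pd i g x)"
    unfolding Complex_eq partial_deriv_def D[symmetric] by (simp add: inner_axis)
qed

lemma real_polynomial_function_monomial_sum:
  fixes c :: "('n::finite \<Rightarrow> nat) \<Rightarrow> real"
  shows "real_polynomial_function (\<lambda>x :: real ^ 'n. \<Sum>\<alpha> | sum \<alpha> UNIV = p. c \<alpha> * (\<Prod>i\<in>UNIV. (x $ i) ^ \<alpha> i))"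
proof -
  have "real_polynomial_function (\<lambda>x :: real ^ 'n. x $ i)" for i
    by (intro real_polynomial_function.intros(1) bounded_linear_vec_nth)
  then have "real_polynomial_function (\<lambda>x :: real ^ 'n. \<Prod>i\<in>UNIV. (x $ i) ^ \<alpha> i)" for \<alpha>
    by (intro real_polynomial_function_prod real_polynomial_function_power) auto
  then show ?thesis
    by (intro real_polynomial_function_sum real_polynomial_function.intros(2,4) finite_multiindices)
qed

text \<open>The monomials are real, so splitting the coefficients into real and imaginary parts
  splits the polynomial, and its Laplacian along with it.\<close>

lemma spherical_harmonic_parts:
  fixes H :: "real ^ 'n \<Rightarrow> complex"
  assumes "spherical_harmonic p H"
  obtains P1 P2 where "solid_harmonic p P1" "solid_harmonic p P2" "\<And>x. x \<in> sphere 0 1 \<Longrightarrow> H x = Complex (P1 x) (P2 x)"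
proof -
  obtain P where P: "homogeneous_polynomial p P" "\<And>x. laplacian P x = 0" "\<And>x. x \<in> sphere 0 1 \<Longrightarrow> H x = P x"
    using assms unfolding spherical_harmonic_def by blast
  obtain c where c: "P = (\<lambda>x. \<Sum>\<alpha> | sum \<alpha> UNIV = p. c \<alpha> * of_real (\<Prod>i\<in>UNIV. (x $ i) ^ \<alpha> i))"
    using P(1) unfolding homogeneous_polynomial_def by blast
  define F where "F r x = (\<Sum>\<alpha> | sum \<alpha> UNIV = p. r (c \<alpha>) * (\<Prod>i\<in>UNIV. (x $ i) ^ \<alpha> i))" for r :: "complex \<Rightarrow> real" and x :: "real ^ 'n"
  have F: "P = (\<lambda>x. Complex (F Re x) (F Im x))"
    unfolding c F_def by (simp add: fun_eq_iff complex_eq_iff del: of_real_prod of_real_power)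
  have poly: "real_polynomial_function (F r)" for r
    unfolding F_def[abs_def] by (rule real_polynomial_function_monomial_sum)
  have hom: "F r (a *\<^sub>R x) = a ^ p * F r x" for r a x
    unfolding F_def sum_distrib_left
  proof (intro sum.cong refl)
    fix \<alpha> :: "'n \<Rightarrow> nat" assume "\<alpha> \<in> {\<alpha>. sum \<alpha> UNIV = p}"
    then have "(\<Prod>i\<in>UNIV. a ^ \<alpha> i) = a ^ p" by (simp flip: power_sum)
    then show "r (c \<alpha>) * (\<Prod>i\<in>UNIV. ((a *\<^sub>R x) $ i) ^ \<alpha> i) = a ^ p * (r (c \<alpha>) * (\<Prod>i\<in>UNIV. (x $ i) ^ \<alpha> i))"
      by (simp add: power_mult_distrib prod.distrib)
  qed
  have "laplacian P x = Complex (\<Sum>i\<in>UNIV. pd i (pd i (F Re)) x) (\<Sum>i\<in>UNIV. pd i (pd i (F Im)) x)" for x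
    unfolding laplacian_def F
    by (simp add: partial_deriv_Complex poly real_polynomial_function_pd complex_eq_iff)
  then have "(\<Sum>i\<in>UNIV. pd i (pd i (F Re)) x) = 0" "(\<Sum>i\<in>UNIV. pd i (pd i (F Im)) x) = 0" for x
    using P(2)[of x] by (simp_all add: complex_eq_iff)
  then have "solid_harmonic p (F Re)" "solid_harmonic p (F Im)"
    using poly hom by (auto simp: solid_harmonic_def)
  then show ?thesis using that[of "F Re" "F Im"] P(3) fun_cong[OF F] by simp
qed

text \<open>The square of |Hp Hq| is the sum of four products of squared real and imaginary parts.
  The real bound applies to each with the same constant, and the four right-hand sides add up to the
  product of the two squared norms, so complex values do not worsen the constant.\<close>

lemma spherical_harmonic_product_bound:
  assumes n: "CARD('n::finite) = N + 2" "N \<ge> 1"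
  shows "\<exists>C>0. \<forall>p q. \<forall>Hp Hq :: real ^ 'n \<Rightarrow> complex. 2 \<le> p \<longrightarrow> p \<le> q \<longrightarrow>
    spherical_harmonic p Hp \<longrightarrow> spherical_harmonic q Hq \<longrightarrow>
    L2_norm sphere_measure (\<lambda>x. Hp x * Hq x)
      \<le> C * Lambda (N + 1) p * L2_norm sphere_measure Hp * L2_norm sphere_measure Hq"
proof -
  let ?\<sigma> = "sphere_measure :: (real ^ 'n) measure"
  obtain C where C: "C > 0" "\<And>p q P Q. \<lbrakk>2 \<le> p; p \<le> q; solid_harmonic p P; solid_harmonic q Q\<rbrakk> \<Longrightarrow>
    (LINT x|?\<sigma>. (P x)\<^sup>2 * (Q x)\<^sup>2) \<le> C * (Lambda (N + 1) p)\<^sup>2 * (LINT x|?\<sigma>. (P x)\<^sup>2) * (LINT x|?\<sigma>. (Q x)\<^sup>2)"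
    using solid_harmonic_product_bound[where 'n = 'n, OF n] by blast
  have "L2_norm ?\<sigma> (\<lambda>x. Hp x * Hq x) \<le> sqrt C * Lambda (N + 1) p * L2_norm ?\<sigma> Hp * L2_norm ?\<sigma> Hq"
    if p: "2 \<le> p" "p \<le> q" and Hp: "spherical_harmonic p Hp" and Hq: "spherical_harmonic q Hq"
    for p q and Hp Hq :: "real ^ 'n \<Rightarrow> complex"
  proof -
    obtain P1 P2 where P: "solid_harmonic p P1" "solid_harmonic p P2" "\<And>x. x \<in> sphere 0 1 \<Longrightarrow> Hp x = Complex (P1 x) (P2 x)"
      using spherical_harmonic_parts[OF Hp] by blast
    obtain Q1 Q2 where Q: "solid_harmonic q Q1" "solid_harmonic q Q2" "\<And>x. x \<in> sphere 0 1 \<Longrightarrow> Hq x = Complex (Q1 x) (Q2 x)"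
      using spherical_harmonic_parts[OF Hq] by blast
    let ?I = "\<lambda>f. LINT x|?\<sigma>. (f x)\<^sup>2"
    let ?J = "\<lambda>f g. LINT x|?\<sigma>. (f x)\<^sup>2 * (g x)\<^sup>2"
    have ct: "continuous_on (sphere 0 1) f" if "solid_harmonic r f" for r and f :: "real ^ 'n \<Rightarrow> real"
      using that by (intro continuous_on_real_polynomial_function solid_harmonicD)
    note cts = ct[OF P(1)] ct[OF P(2)] ct[OF Q(1)] ct[OF Q(2)]
    have i1: "integrable ?\<sigma> (\<lambda>x. (f x)\<^sup>2)" if "continuous_on (sphere 0 1) f" for f :: "real ^ 'n \<Rightarrow> real"
      using that by (intro integrable_sphere continuous_intros)
    have i2: "integrable ?\<sigma> (\<lambda>x. (f x)\<^sup>2 * (g x)\<^sup>2)"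
      if "continuous_on (sphere 0 1) f" "continuous_on (sphere 0 1) g" for f g :: "real ^ 'n \<Rightarrow> real"
      using that by (intro integrable_sphere continuous_intros)
    have EP: "(LINT x|?\<sigma>. (cmod (Hp x))\<^sup>2) = ?I P1 + ?I P2"
    proof -
      have "(LINT x|?\<sigma>. (cmod (Hp x))\<^sup>2) = (LINT x|?\<sigma>. (P1 x)\<^sup>2 + (P2 x)\<^sup>2)"
        by (intro Bochner_Integration.integral_cong refl) (simp add: P(3) cmod_power2)
      then show ?thesis using i1 cts by simp
    qed
    have EQ: "(LINT x|?\<sigma>. (cmod (Hq x))\<^sup>2) = ?I Q1 + ?I Q2"
    proof -
      have "(LINT x|?\<sigma>. (cmod (Hq x))\<^sup>2) = (LINT x|?\<sigma>. (Q1 x)\<^sup>2 + (Q2 x)\<^sup>2)"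
        by (intro Bochner_Integration.integral_cong refl) (simp add: Q(3) cmod_power2)
      then show ?thesis using i1 cts by simp
    qed
    have EPQ: "(LINT x|?\<sigma>. (cmod (Hp x * Hq x))\<^sup>2) = (?J P1 Q1 + ?J P1 Q2) + (?J P2 Q1 + ?J P2 Q2)"
    proof -
      have "(LINT x|?\<sigma>. (cmod (Hp x * Hq x))\<^sup>2) = (LINT x|?\<sigma>. ((P1 x)\<^sup>2 * (Q1 x)\<^sup>2 + (P1 x)\<^sup>2 * (Q2 x)\<^sup>2)
          + ((P2 x)\<^sup>2 * (Q1 x)\<^sup>2 + (P2 x)\<^sup>2 * (Q2 x)\<^sup>2))"
        by (intro Bochner_Integration.integral_cong refl)
           (simp add: P(3) Q(3) norm_mult power_mult_distrib cmod_power2 algebra_simps)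
      then show ?thesis
        using i2 cts by (simp add: Bochner_Integration.integral_add Bochner_Integration.integrable_add)
    qed
    define K where "K = C * (Lambda (N + 1) p)\<^sup>2"
    have "(LINT x|?\<sigma>. (cmod (Hp x * Hq x))\<^sup>2) \<le> (K * ?I P1 * ?I Q1 + K * ?I P1 * ?I Q2) + (K * ?I P2 * ?I Q1 + K * ?I P2 * ?I Q2)"
      unfolding EPQ K_def using C(2)[OF p] P Q by (intro add_mono) auto
    also have "\<dots> = K * ((LINT x|?\<sigma>. (cmod (Hp x))\<^sup>2) * (LINT x|?\<sigma>. (cmod (Hq x))\<^sup>2))"
      unfolding EP EQ by (simp only: distrib_left distrib_right mult.assoc)
    finally have "L2_norm ?\<sigma> (\<lambda>x. Hp x * Hq x) \<le> sqrt (K * ((LINT x|?\<sigma>. (cmod (Hp x))\<^sup>2) * (LINT x|?\<sigma>. (cmod (Hq x))\<^sup>2)))"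
      unfolding L2_norm_def by (rule real_sqrt_le_mono)
    also have "\<dots> = sqrt C * Lambda (N + 1) p * L2_norm ?\<sigma> Hp * L2_norm ?\<sigma> Hq"
    proof -
      have "0 \<le> Lambda (N + 1) p" by (simp add: Lambda_def)
      then show ?thesis by (simp add: K_def L2_norm_def real_sqrt_mult)
    qed
    finally show ?thesis .
  qed
  moreover have "sqrt C > 0" using C by simp
  ultimately show ?thesis by blast
qed

theorem corollary1p2:
  fixes d :: nat
  assumes "d \<ge> 2" and "CARD('n::finite) = d + 1"
  shows "\<exists>C::real. C > 0 \<and>
    (\<forall>p q :: nat. \<forall>Hp Hq :: real ^ 'n \<Rightarrow> complex.
       p > 1 \<longrightarrow> q > 1 \<longrightarrow> spherical_harmonic p Hp \<longrightarrow> spherical_harmonic q Hq \<longrightarrow>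
       L2_norm sphere_measure (\<lambda>x. Hp x * Hq x)
         \<le> C * Lambda d (min p q) * L2_norm sphere_measure Hp * L2_norm sphere_measure Hq)"
proof -
  let ?\<sigma> = "sphere_measure :: (real ^ 'n) measure"
  obtain N where N: "d = N + 1" "N \<ge> 1" using assms(1) by (cases d) auto
  then have n: "CARD('n) = N + 2" using assms(2) by simp
  obtain C where C: "C > 0" "\<And>p q Hp Hq. \<lbrakk>2 \<le> p; p \<le> q; spherical_harmonic p Hp; spherical_harmonic q Hq\<rbrakk> \<Longrightarrow>
    L2_norm ?\<sigma> (\<lambda>x. Hp x * Hq x) \<le> C * Lambda (N + 1) p * L2_norm ?\<sigma> Hp * L2_norm ?\<sigma> Hq"
    using spherical_harmonic_product_bound[where 'n = 'n, OF n N(2)] by blast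
  have "L2_norm ?\<sigma> (\<lambda>x. Hp x * Hq x) \<le> C * Lambda d (min p q) * L2_norm ?\<sigma> Hp * L2_norm ?\<sigma> Hq"
    if "p > 1" "q > 1" "spherical_harmonic p Hp" "spherical_harmonic q Hq" for p q and Hp Hq :: "real ^ 'n \<Rightarrow> complex"
  proof (cases "p \<le> q")
    case True
    then show ?thesis using C(2)[of p q Hp Hq] that N by (simp add: min_absorb1)
  next
    case False
    then show ?thesis using C(2)[of q p Hq Hp] that N by (simp add: min_absorb2 mult_ac)
  qed
  then show ?thesis using C(1) by blast
qed

end
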